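(* Let $0\le k\le n$ and let $x=\begin{pmatrix}T\\ P\end{pmatrix}\in \mathrm{O}_{n,k}$ with $P\in\mathbb{K}^{k\times k}$. Choose $A=\begin{pmatrix}\alpha&T\\ \beta&P\end{pmatrix}\in \mathrm{G}(n)$. Then there exists a map $$\gamma^A\colon T_x\mathrm{O}_{n,k}\to \mathrm{O}_{n,k}$$ such that $\gamma^A\circ\rho_{*A}=\rho\circ c_A$. Moreover, the following properties hold. 1) The map $\gamma^A$ is injective on the open subset $$\Gamma^x=\left\{v=A\begin{pmatrix}X\\ Y\end{pmatrix}\in T_x\mathrm{O}_{n,k} \;\middle|\; (\beta X+P)^{-1} \text{ exists}\right\}.$$ This subset $\Gamma^x$ does not depend on the choice of $A$ such that $\rho(A)=x$. Furthermore, if $\gamma^A$ is injective on an open subset $U\subset T_x\mathrm{O}_{n,k}$, then $U\subset\Gamma^x$. 2) The map $\gamma^A$ induces a diffeomorphism between $\Gamma^x\subset T_x\mathrm{O}_{n,k}$ and the open subset $$\Omega^x=\left\{\begin{pmatrix}\tau\\ \pi\end{pmatrix}\in \mathrm{O}_{n,k} \;\middle|\; (\pi+P^* )^{-1}\text{ exists}\right\}.$$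
   Context: $\mathbb{K}$ is the algebra of the real numbers $\mathbb{R}$, the complex numbers $\mathbb{C}$ or the quaternions $\mathbb{H}$ (with $\mathbb{H}^n$ a right $\mathbb{H}$-vector space). For a matrix $A$, $A^*=\bar A^t$ is the conjugate transpose. $\mathrm{G}(n)=\{A\in\mathbb{K}^{n\times n} : AA^*=I_n\}$ is the Lie group $\mathrm{O}(n)$, $\mathrm{U}(n)$ or $\mathrm{Sp}(n)$ according to $\mathbb{K}$. The compact Stiefel manifold of orthonormal $k$-frames in $\mathbb{K}^n$ is $\mathrm{O}_{n,k}=\{x\in\mathbb{K}^{n\times k} : x^*x=I_k\}$. Its elements are written in blocks $\begin{pmatrix}T\\ P\end{pmatrix}$ or $\begin{pmatrix}\tau\\ \pi\end{pmatrix}$ with $T,\tau\in\mathbb{K}^{(n-k)\times k}$ and $P,\pi\in\mathbb{K}^{k\times k}$. The map $\rho\colon \mathrm{G}(n)\to \mathrm{O}_{n,k}$ is the projection onto the last $k$ columns; if $A\in\mathrm{G}(n)$ and $x=\rho(A)$, then $\rho_{*A}\colon T_A\mathrm{G}(n)\to T_x\mathrm{O}_{n,k}$ is the induced map between the tangent spaces. Tangent spaces: $T_A\mathrm{G}(n)=\{Z\in\mathbb{K}^{n\times n} : A^*Z+Z^*A=0\}$, and, for $x=\rho(A)$, $T_x\mathrm{O}_{n,k}=\{v\in\mathbb{K}^{n\times k} : v^*x+x^*v=0\}=\left\{A\begin{pmatrix}X\\ Y\end{pmatrix} : X\in\mathbb{K}^{(n-k)\times k},\ Y\in\mathbb{K}^{k\times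 k},\ Y+Y^*=0\right\}$. For $A\in\mathrm{G}(n)$, the Cayley transform $c_A$ is defined by $c_A(Z)=(I_n-A^*Z)(A+Z)^{-1}$ for those $Z\in\mathbb{K}^{n\times n}$ such that $A+Z$ is invertible; it gives a diffeomorphism from $T_A\mathrm{G}(n)$ onto $\{B\in\mathrm{G}(n) : A^*+B \text{ is invertible}\}$.
   Formalization: As printed two clauses fail: γ^A∘ρ_{*A}=ρ∘c_A is proved only on the vectors A(0 X; −X* Y), Y+Y*=0, which map onto T_xO_{n,k} and still determine γ^A; and "γ^A injective on open U implies U⊂Γ^x" is proved except when K=R and n=k+1. *)

theory Defs
  imports "HOL-Analysis.Analysis" "Jordan_Normal_Form.Matrix" "Jordan_Normal_Form.Conjugate"
begin

section \<open>The algebras of real numbers, complex numbers and quaternions\<close>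

text \<open>By Frobenius' theorem the finite-dimensional real division algebras are, up to
  isomorphism, \<open>\<real>\<close>, \<open>\<complex>\<close> and \<open>\<bbbH>\<close>. The last axiom determines the conjugation, so that up to
  isomorphism the types of the following class are exactly these three algebras, with their
  usual conjugation. \<open>DIM('a)\<close> is 1, 2 or 4, respectively.\<close>

class conj_div_algebra = real_normed_div_algebra + euclidean_space + conjugate +
  assumes conjugate_add: "conjugate (x + y) = conjugate x + conjugate y"
    and conjugate_mult: "conjugate (x * y) = conjugate y * conjugate x"
    and conjugate_mult_self: "conjugate x * x = (norm x)\<^sup>2 *\<^sub>R 1"

instance real :: conj_div_algebra
  by standard (auto simp: power2_eq_square)

instance complex :: conj_div_algebra
  by standard (simp_all add: complex_eq_iff cmod_power2 algebra_simps, simp_all add: power2_eq_square)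

codatatype quat = Quat (qre: real) (qi: real) (qj: real) (qk: real)

lemma quat_eq_iff: "x = y \<longleftrightarrow> qre x = qre y \<and> qi x = qi y \<and> qj x = qj y \<and> qk x = qk y"
  by (auto intro: quat.expand)

instantiation quat :: real_vector
begin

primcorec zero_quat where
  "qre 0 = 0" | "qi 0 = 0" | "qj 0 = 0" | "qk 0 = 0"

primcorec plus_quat where
  "qre (x + y) = qre x + qre y" | "qi (x + y) = qi x + qi y"
| "qj (x + y) = qj x + qj y" | "qk (x + y) = qk x + qk y"

primcorec uminus_quat where
  "qre (- x) = - qre x" | "qi (- x) = - qi x" | "qj (- x) = - qj x" | "qk (- x) = - qk x"

primcorec minus_quat where
  "qre (x - y) = qre x - qre y" | "qi (x - y) = qi x - qi y"
| "qj (x - y) = qj x - qj y" | "qk (x - y) = qk x - qk y"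

primcorec scaleR_quat where
  "qre (scaleR r x) = r * qre x" | "qi (scaleR r x) = r * qi x"
| "qj (scaleR r x) = r * qj x" | "qk (scaleR r x) = r * qk x"

instance
  by standard (auto simp: quat_eq_iff algebra_simps)

end

instantiation quat :: real_algebra_1
begin

primcorec one_quat where
  "qre 1 = 1" | "qi 1 = 0" | "qj 1 = 0" | "qk 1 = 0"

primcorec times_quat where
  "qre (x * y) = qre x * qre y - qi x * qi y - qj x * qj y - qk x * qk y"
| "qi (x * y) = qre x * qi y + qi x * qre y + qj x * qk y - qk x * qj y"
| "qj (x * y) = qre x * qj y - qi x * qk y + qj x * qre y + qk x * qi y"
| "qk (x * y) = qre x * qk y + qi x * qj y - qj x * qi y + qk x * qre y"

instance
  by standard (auto simp: quat_eq_iff algebra_simps)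

end

lemma quat_of_real [simp]:
  "qre (of_real r) = r" "qi (of_real r) = 0" "qj (of_real r) = 0" "qk (of_real r) = 0"
  by (simp_all add: of_real_def)

instantiation quat :: real_inner
begin

definition inner_quat :: "quat \<Rightarrow> quat \<Rightarrow> real" where
  "inner_quat x y = qre x * qre y + qi x * qi y + qj x * qj y + qk x * qk y"

definition norm_quat :: "quat \<Rightarrow> real" where
  "norm_quat x = sqrt (inner x x)"

definition sgn_quat :: "quat \<Rightarrow> quat" where
  "sgn_quat x = scaleR (inverse (norm x)) x"

definition dist_quat :: "quat \<Rightarrow> quat \<Rightarrow> real" where
  "dist_quat x y = norm (x - y)"

definition uniformity_quat :: "(quat \<times> quat) filter" where
  "uniformity_quat = (INF e\<in>{0<..}. principal {(x, y). dist x y < e})"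

definition open_quat :: "quat set \<Rightarrow> bool" where
  "open_quat U \<longleftrightarrow> (\<forall>x\<in>U. eventually (\<lambda>(x', y). x' = x \<longrightarrow> y \<in> U) uniformity)"

instance
proof
  fix x :: quat
  show "inner x x = 0 \<longleftrightarrow> x = 0"
    unfolding inner_quat_def quat_eq_iff
    by (auto simp: add_nonneg_eq_0_iff)
qed (auto simp: inner_quat_def norm_quat_def sgn_quat_def dist_quat_def uniformity_quat_def
      open_quat_def algebra_simps)

end

primcorec quat_conj :: "quat \<Rightarrow> quat" where
  "qre (quat_conj x) = qre x" | "qi (quat_conj x) = - qi x"
| "qj (quat_conj x) = - qj x" | "qk (quat_conj x) = - qk x"

lemma quat_conj_mult_self:
  "quat_conj x * x = of_real ((norm x)\<^sup>2)" "x * quat_conj x = of_real ((norm x)\<^sup>2)"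
  by (auto simp: quat_eq_iff power2_norm_eq_inner inner_quat_def)

instantiation quat :: real_normed_div_algebra
begin

definition inverse_quat :: "quat \<Rightarrow> quat" where
  "inverse_quat x = scaleR (inverse ((norm x)\<^sup>2)) (quat_conj x)"

definition divide_quat :: "quat \<Rightarrow> quat \<Rightarrow> quat" where
  "divide_quat x y = x * inverse y"

instance
proof
  fix x y :: quat
  show "inverse x * x = 1" "x * inverse x = 1" if "x \<noteq> 0"
    using that by (simp_all add: inverse_quat_def quat_conj_mult_self of_real_def)
  have "inner (x * y) (x * y) = inner x x * inner y y"
    by (simp add: inner_quat_def algebra_simps)
  then show "norm (x * y) = norm x * norm y"
    by (simp add: norm_eq_sqrt_inner real_sqrt_mult)
  show "inverse (0 :: quat) = 0"
    by (simp add: inverse_quat_def)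
qed (simp add: divide_quat_def)

end

instantiation quat :: euclidean_space
begin

definition Basis_quat :: "quat set" where
  "Basis_quat = {Quat 1 0 0 0, Quat 0 1 0 0, Quat 0 0 1 0, Quat 0 0 0 1}"

instance
proof
  show "Basis \<noteq> ({} :: quat set)" and "finite (Basis :: quat set)"
    by (simp_all add: Basis_quat_def)
  fix u v :: quat
  show "inner u v = (if u = v then 1 else 0)" if "u \<in> Basis" "v \<in> Basis"
    using that unfolding Basis_quat_def by (elim insertE emptyE; simp add: inner_quat_def)
  show "(\<forall>v\<in>Basis. inner u v = 0) \<longleftrightarrow> u = 0"
    unfolding Basis_quat_def quat_eq_iff[of u] by (simp add: inner_quat_def)
qed

end

lemma DIM_quat [simp]: "DIM(quat) = 4"
  by (simp add: Basis_quat_def)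

instantiation quat :: conj_div_algebra
begin

definition conjugate_quat :: "quat \<Rightarrow> quat" where
  "conjugate_quat = quat_conj"

instance
proof
  fix x y :: quat
  show "conjugate x * x = (norm x)\<^sup>2 *\<^sub>R 1"
    unfolding conjugate_quat_def by (simp only: quat_conj_mult_self of_real_def)
  show "conjugate (x * y) = conjugate y * conjugate x"
    unfolding conjugate_quat_def quat_eq_iff by (simp add: algebra_simps)
qed (auto simp: conjugate_quat_def quat_eq_iff)

end


section \<open>Smooth maps between sets of matrices\<close>

text \<open>The Euclidean topology on the \<open>r \<times> c\<close>-matrices.\<close>

definition mat_topology :: "nat \<Rightarrow> nat \<Rightarrow> 'a::topological_space mat topology" where
  "mat_topology r c = pullback_topology (carrier_mat r c)
     (\<lambda>M. restrict (index_mat M) ({..<r} \<times> {..<c}))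
     (product_topology (\<lambda>_. euclidean) ({..<r} \<times> {..<c}))"

text \<open>\<open>Ck_on m r c r' c' U f\<close>: on the open set \<open>U\<close> of \<open>r \<times> c\<close>-matrices, the map \<open>f\<close> to the
  \<open>r' \<times> c'\<close>-matrices is \<open>m\<close> times continuously differentiable over the reals, i.e. all
  iterated directional derivatives up to order \<open>m\<close> exist and are continuous.\<close>

primrec Ck_on :: "nat \<Rightarrow> nat \<Rightarrow> nat \<Rightarrow> nat \<Rightarrow> nat \<Rightarrow> 'a::conj_div_algebra mat set \<Rightarrow>
    ('a mat \<Rightarrow> 'a mat) \<Rightarrow> bool" where
  "Ck_on 0 r c r' c' U f \<longleftrightarrow>
     continuous_map (subtopology (mat_topology r c) U) (mat_topology r' c') f"
| "Ck_on (Suc m) r c r' c' U f \<longleftrightarrow>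
     continuous_map (subtopology (mat_topology r c) U) (mat_topology r' c') f \<and>
     (\<forall>H\<in>carrier_mat r c. \<exists>g.
        (\<forall>M\<in>U. \<forall>i<r'. \<forall>j<c'.
           ((\<lambda>t::real. f (M + of_real t \<cdot>\<^sub>m H) $$ (i, j)) has_vector_derivative g M $$ (i, j)) (at 0)) \<and>
        Ck_on m r c r' c' U g)"

text \<open>As usual, a map on an arbitrary set of matrices is smooth if it extends locally to a
  smooth map on an open set of matrices. For embedded submanifolds, such as Stiefel manifolds,
  tangent spaces and their open subsets, this is smoothness as a map between manifolds.\<close>

definition smooth_on_mat :: "nat \<Rightarrow> nat \<Rightarrow> nat \<Rightarrow> nat \<Rightarrow> 'a::conj_div_algebra mat set \<Rightarrow>
    ('a mat \<Rightarrow> 'a mat) \<Rightarrow> bool" where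
  "smooth_on_mat r c r' c' S f \<longleftrightarrow>
     (\<forall>M\<in>S. \<exists>U F. openin (mat_topology r c) U \<and> M \<in> U \<and> (\<forall>m. Ck_on m r c r' c' U F) \<and>
        (\<forall>N\<in>U \<inter> S. F N = f N))"

definition diffeo_mat :: "nat \<Rightarrow> nat \<Rightarrow> nat \<Rightarrow> nat \<Rightarrow> 'a::conj_div_algebra mat set \<Rightarrow>
    'a mat set \<Rightarrow> ('a mat \<Rightarrow> 'a mat) \<Rightarrow> bool" where
  "diffeo_mat r c r' c' S S' f \<longleftrightarrow>
     bij_betw f S S' \<and> smooth_on_mat r c r' c' S f \<and> smooth_on_mat r' c' r c S' (inv_into S f)"


section \<open>Stiefel manifolds and Cayley transforms\<close>

definition adj :: "'a::conjugate mat \<Rightarrow> 'a mat" where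
  "adj M = Matrix.mat (dim_col M) (dim_row M) (\<lambda>(i, j). conjugate (M $$ (j, i)))"

definition unitary_grp :: "nat \<Rightarrow> 'a::conj_div_algebra mat set" where
  "unitary_grp n = {A \<in> carrier_mat n n. A * adj A = 1\<^sub>m n}"

definition stiefel :: "nat \<Rightarrow> nat \<Rightarrow> 'a::conj_div_algebra mat set" where
  "stiefel n k = {x \<in> carrier_mat n k. adj x * x = 1\<^sub>m k}"

definition rho :: "nat \<Rightarrow> nat \<Rightarrow> 'a mat \<Rightarrow> 'a mat" where
  "rho n k A = Matrix.mat n k (\<lambda>(i, j). A $$ (i, n - k + j))"

definition tangent_grp :: "nat \<Rightarrow> 'a::conj_div_algebra mat \<Rightarrow> 'a mat set" where
  "tangent_grp n A = {Z \<in> carrier_mat n n. adj A * Z + adj Z * A = 0\<^sub>m n n}"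

definition tangent_stiefel :: "nat \<Rightarrow> nat \<Rightarrow> 'a::conj_div_algebra mat \<Rightarrow> 'a mat set" where
  "tangent_stiefel n k x = {v \<in> carrier_mat n k. adj v * x + adj x * v = 0\<^sub>m k k}"

text \<open>The differential of \<open>rho\<close> at \<open>A\<close>. It is computed along the line \<open>A + t Z\<close>, as
  \<open>rho n k\<close> is defined on all \<open>n \<times> n\<close>-matrices.\<close>

definition rho_diff :: "nat \<Rightarrow> nat \<Rightarrow> 'a::conj_div_algebra mat \<Rightarrow> 'a mat \<Rightarrow> 'a mat" where
  "rho_diff n k A Z = Matrix.mat n k (\<lambda>(i, j).
     vector_derivative (\<lambda>t::real. rho n k (A + of_real t \<cdot>\<^sub>m Z) $$ (i, j)) (at 0))"

lemma rho_diff_eq: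
  assumes "k \<le> n" "A \<in> carrier_mat n n" "Z \<in> carrier_mat n n"
  shows "rho_diff n k A Z = rho n k Z"
proof (rule eq_matI)
  fix i j assume "i < dim_row (rho n k Z)" "j < dim_col (rho n k Z)"
  then have ij: "i < n" "j < k"
    by (auto simp: rho_def)
  define a z where "a = A $$ (i, n - k + j)" and "z = Z $$ (i, n - k + j)"
  have "rho n k (A + of_real t \<cdot>\<^sub>m Z) $$ (i, j) = a + t *\<^sub>R z" for t :: real
    using ij assms by (auto simp: rho_def a_def z_def scaleR_conv_of_real)
  moreover have "((\<lambda>t::real. a + t *\<^sub>R z) has_vector_derivative z) (at 0)"
    by (auto intro!: derivative_eq_intros)
  ultimately show "rho_diff n k A Z $$ (i, j) = rho n k Z $$ (i, j)"
    using ij by (simp add: rho_diff_def vector_derivative_at) (simp add: rho_def z_def)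
qed (auto simp: rho_diff_def rho_def)

definition mat_inv :: "'a::semiring_1 mat \<Rightarrow> 'a mat" where
  "mat_inv M = (THE N. inverts_mat M N \<and> inverts_mat N M)"

lemma mat_inv_eqI:
  assumes "M \<in> carrier_mat n n" "N \<in> carrier_mat n n" "M * N = 1\<^sub>m n" "N * M = 1\<^sub>m n"
  shows "mat_inv M = N"
  unfolding mat_inv_def
proof (rule the_equality)
  show "inverts_mat M N \<and> inverts_mat N M"
    using assms by (auto simp: inverts_mat_def)
  fix N' assume *: "inverts_mat M N' \<and> inverts_mat N' M"
  have "M * N' = 1\<^sub>m n" "N' * M = 1\<^sub>m (dim_row N')"
    using * assms(1) by (auto simp: inverts_mat_def)
  from arg_cong[OF this(1), of dim_col] arg_cong[OF this(2), of dim_col]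
  have N': "N' \<in> carrier_mat n n"
    using assms(1) by auto
  have "N' = N' * (M * N)"
    using assms N' by simp
  also have "\<dots> = (N' * M) * N"
    using assms N' by (metis assoc_mult_mat)
  also have "\<dots> = N"
    using \<open>N' * M = 1\<^sub>m (dim_row N')\<close> N' assms by simp
  finally show "N' = N" .
qed

definition cayley :: "nat \<Rightarrow> 'a::conj_div_algebra mat \<Rightarrow> 'a mat \<Rightarrow> 'a mat" where
  "cayley n A Z = (1\<^sub>m n - adj A * Z) * mat_inv (A + Z)"

text \<open>The horizontal space of \<open>rho\<close> at \<open>A\<close>: the complement
  \<open>{A (0, X; - X\<^sup>*, Y) | Y + Y\<^sup>* = 0}\<close> of the vertical space \<open>{A (M, 0; 0, 0) | M + M\<^sup>* = 0}\<close>, the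
  kernel of the differential of \<open>rho\<close> on the tangent space of the group. The differential of
  \<open>rho\<close> maps the horizontal space isomorphically to the tangent space of the Stiefel manifold.
  On the whole tangent space of the group, \<open>rho (cayley n A Z)\<close> does in general not only depend
  on \<open>rho_diff n k A Z\<close>: for \<open>\<complex>\<close>, \<open>n = 2\<close>, \<open>k = 1\<close>, \<open>A = 1\<close> and \<open>Z = (m, 1; -1, 0)\<close> with \<open>m\<close>
  imaginary, the lower entry of \<open>rho (cayley n A Z)\<close> is \<open>m / (2 + m)\<close>.\<close>

definition horizontal_space :: "nat \<Rightarrow> nat \<Rightarrow> 'a::conj_div_algebra mat \<Rightarrow> 'a mat set" where
  "horizontal_space n k A = {Z \<in> tangent_grp n A.
     fst (split_block (adj A * Z) (n - k) (n - k)) = 0\<^sub>m (n - k) (n - k)}"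

text \<open>For \<open>\<real>\<close> and \<open>n = k + 1\<close> this set need not be the largest open set on which the Cayley
  transform of the Stiefel manifold is injective: for \<open>n = 2\<close>, \<open>k = 1\<close> and \<open>A = (0, 1; 1, 0)\<close> it is
  the punctured line \<open>X \<noteq> 0\<close>, while the transform
  \<open>X \<mapsto> ((1 - X\<^sup>2) / (1 + X\<^sup>2), 2 X / (1 + X\<^sup>2))\<close> is injective on the whole line.\<close>

definition Gamma_set :: "nat \<Rightarrow> nat \<Rightarrow> 'a::conj_div_algebra mat \<Rightarrow> 'a mat set" where
  "Gamma_set n k A = (case split_block A (n - k) (n - k) of (\<alpha>, T, \<beta>, P) \<Rightarrow>
     {v \<in> tangent_stiefel n k (rho n k A).
        \<exists>X\<in>carrier_mat (n - k) k. \<exists>Y\<in>carrier_mat k k.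
          v = A * (X @\<^sub>r Y) \<and> invertible_mat (\<beta> * X + P)})"

definition Omega_set :: "nat \<Rightarrow> nat \<Rightarrow> 'a::conj_div_algebra mat \<Rightarrow> 'a mat set" where
  "Omega_set n k P = {y \<in> stiefel n k.
     \<exists>\<tau>\<in>carrier_mat (n - k) k. \<exists>\<pi>\<in>carrier_mat k k.
       y = \<tau> @\<^sub>r \<pi> \<and> invertible_mat (\<pi> + adj P)}"

end

theory Submission
  imports Defs
begin

text \<open>Write \<open>J\<^sub>1\<close>, \<open>J\<^sub>2\<close> for the inclusions of the first \<open>n - k\<close> and the last \<open>k\<close> coordinates, so that
  \<open>x = A J\<^sub>2\<close>, and put \<open>e = A\<^sup>* J\<^sub>2\<close>, the frame \<open>(\<beta>\<^sup>*; P\<^sup>*)\<close>. A tangent vector \<open>v = A (X; Y)\<close> at \<open>x\<close> has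
  the horizontal lift \<open>A W\<close> with the skew-adjoint matrix \<open>W = (0, X; - X\<^sup>*, Y)\<close>. Since
  \<open>A + A W = A (1 + W)\<close>, the last \<open>k\<close> columns of the Cayley transform of \<open>A W\<close> are
  \<open>(1 - W) (1 + W)\<inverse> e\<close>, and this is the value \<open>\<gamma>(v)\<close>. The matrix \<open>1 + W\<close> is invertible because
  \<open>c = - W c\<close> implies \<open>c\<^sup>* c = 0\<close>.

  Everything else follows from the midpoint \<open>z = (1 + W)\<inverse> e\<close>: as \<open>z + W z = e\<close> and \<open>y = \<gamma>(v) = z - W z\<close>,
  one has \<open>y + e = 2 z\<close> and \<open>e - y = 2 W z\<close>. So \<open>y\<close> is a frame because \<open>z\<^sup>* W z\<close> is skew, and the pairs
  \<open>(X, Y)\<close> that belong to a given \<open>y\<close> are the solutions of \<open>W (y + e) = e - y\<close>. Its upper block is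
  \<open>X w = J\<^sub>1\<^sup>* (e - y)\<close> and its lower block is \<open>Y w = J\<^sub>2\<^sup>* (e - y) + X\<^sup>* J\<^sub>1\<^sup>* (y + e)\<close>, where
  \<open>w = J\<^sub>2\<^sup>* (y + e)\<close> is the matrix \<open>\<pi> + P\<^sup>*\<close> whose invertibility defines \<open>\<Omega>\<close>. If \<open>w\<close> is invertible, the
  solution is unique and a rational expression in \<open>y\<close> (\<open>skew_lift_mult_iff\<close>), and \<open>Y\<close> is then
  skew-adjoint because \<open>y\<close> and \<open>e\<close> are both frames (\<open>inv_Y_skew\<close>). Moreover \<open>w\<close> and \<open>(\<beta> X + P)\<^sup>*\<close> have the
  same kernel (\<open>half_sum_bottom_kernel\<close>), so that \<open>\<Gamma>\<close> is the preimage of \<open>\<Omega>\<close> under \<open>\<gamma>\<close>. This gives the bijection.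
  Independence of \<open>A\<close> holds because \<open>\<beta> X + P\<close> can be expressed by \<open>x\<close> and \<open>v\<close> alone (\<open>denom_coord\<close>).

  For maximality, let \<open>w\<close> be singular at \<open>v\<close>. Then there is a pair \<open>(X', Y') \<noteq> 0\<close> with \<open>Y'\<close> skew-adjoint whose
  matrix \<open>W'\<close> satisfies \<open>W' z = 0\<close>. Replacing \<open>W\<close> by \<open>W + t W'\<close> leaves \<open>z\<close> and hence \<open>\<gamma>\<close> unchanged, so \<open>\<gamma>\<close> is
  not injective near \<open>v\<close>. With \<open>q\<^sup>* w = 0\<close> one can take \<open>X' = 0\<close>, \<open>Y' = q s q\<^sup>*\<close> if there is an imaginary number
  \<open>s \<noteq> 0\<close>, and \<open>X' = a q\<^sup>*\<close>, \<open>Y' = q b\<^sup>* - b q\<^sup>*\<close> with \<open>(a, b) \<noteq> 0\<close>, \<open>a\<^sup>* J\<^sub>1\<^sup>* z = b\<^sup>* J\<^sub>2\<^sup>* z\<close> and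
  \<open>b\<^sup>* q = 0\<close> if \<open>n \<ge> k + 2\<close>. If \<open>n = k\<close>, then \<open>w\<close> is never singular.

  Two foundations have to be laid for matrices over a noncommutative algebra. Linear algebra is derived from the fact
  that a linear system with more unknowns than equations has a nontrivial solution. Smoothness is reduced to the
  closure of the class of smooth maps under sums, products, adjoints and inverses (\<open>Ck_on_mat_inv\<close>): both
  \<open>\<gamma>\<close> and its inverse are built from the variable and constant matrices with these operations.\<close>

section \<open>Conjugation and the adjoint of a matrix\<close>

lemma conjugate_zero [simp]: "conjugate (0::'a::conj_div_algebra) = 0"
  using conjugate_add[of "0::'a" 0] by simp

lemma conjugate_uminus: "conjugate (- x) = - conjugate (x::'a::conj_div_algebra)"
  using conjugate_add[of x "- x"] by (simp add: eq_neg_iff_add_eq_0 add.commute)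

lemma conjugate_one [simp]: "conjugate (1::'a::conj_div_algebra) = 1"
  using conjugate_mult_self[of "1::'a"] by simp

lemma conjugate_of_real: "conjugate (of_real r) = (of_real r::'a::conj_div_algebra)"
proof (cases "r = 0")
  case False
  have "conjugate (of_real r) * of_real r = (of_real r * of_real r :: 'a)"
    using conjugate_mult_self[of "of_real r :: 'a"]
    by (simp add: power2_eq_square scaleR_conv_of_real flip: of_real_mult)
  then show ?thesis using False by simp
qed simp

lemma conjugate_scaleR: "conjugate (r *\<^sub>R x) = r *\<^sub>R conjugate (x::'a::conj_div_algebra)"
  by (simp add: scaleR_conv_of_real conjugate_mult conjugate_of_real)
     (metis Real_Vector_Spaces.scaleR_conv_of_real mult.right_neutral mult_scaleR_right)

lemma conjugate_sum:
  "conjugate (sum f S) = (\<Sum>i\<in>S. conjugate (f i :: 'a::conj_div_algebra))"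
  by (induction S rule: infinite_finite_induct) (auto simp: conjugate_add)

text \<open>Conjugation preserves the directional derivatives in the definition of smoothness because it is
  real-linear.\<close>

lemma bounded_linear_conjugate: "bounded_linear (conjugate :: 'a::conj_div_algebra \<Rightarrow> 'a)"
  by (intro linear_linear[THEN iffD2] linearI) (auto simp: conjugate_add conjugate_scaleR)

text \<open>Otherwise \<open>x - conjugate x\<close>, which is imaginary, vanishes for all \<open>x\<close>;
  then \<open>x\<^sup>2 = \<bar>x\<bar>\<^sup>2\<close>, and every \<open>x\<close> is real.\<close>

lemma exists_imaginary:
  assumes "DIM('a::conj_div_algebra) \<noteq> 1"
  shows "\<exists>s::'a. s \<noteq> 0 \<and> conjugate s = - s"
proof (rule ccontr)
  assume no: "\<not> ?thesis"
  have real: "\<exists>r. x = r *\<^sub>R 1" for x :: 'a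
  proof -
    have "conjugate (x - conjugate x) = - (x - conjugate x)"
      using conjugate_add[of x "- conjugate x"] by (simp add: conjugate_uminus)
    with no have "x - conjugate x = 0" by blast
    then have "conjugate x = x" by simp
    then have "(x - norm x *\<^sub>R 1) * (x + norm x *\<^sub>R 1) = 0"
      using conjugate_mult_self[of x] by (simp add: algebra_simps power2_eq_square)
    then have "x = norm x *\<^sub>R 1 \<or> x = (- norm x) *\<^sub>R 1"
      by (auto simp: eq_neg_iff_add_eq_0)
    then show ?thesis by blast
  qed
  have "UNIV \<subseteq> span {1::'a}"
    using real by (metis span_base insertI1 span_scale subsetI)
  then have "DIM('a) \<le> card {1::'a}"
    by (metis dim_UNIV dim_le_card finite.emptyI finite.insertI)
  then have "DIM('a) \<le> Suc 0" by simp
  then have "DIM('a) = 1"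
    using DIM_positive[where 'a='a] by linarith
  with assms show False by simp
qed

lemma dim_adj [simp]: "dim_row (adj M) = dim_col M" "dim_col (adj M) = dim_row M"
  by (simp_all add: adj_def)

lemma index_adj: "i < dim_col M \<Longrightarrow> j < dim_row M \<Longrightarrow> adj M $$ (i, j) = conjugate (M $$ (j, i))"
  by (simp add: adj_def)

lemma adj_carrier [simp]: "adj M \<in> carrier_mat n m \<longleftrightarrow> M \<in> carrier_mat m n"
  by (metis carrier_matD(1,2) carrier_matI dim_adj(1,2))

lemma adj_adj [simp]: "adj (adj M) = M"
  by (rule eq_matI) (auto simp: index_adj)

lemma adj_zero [simp]: "adj (0\<^sub>m n m :: 'a::conj_div_algebra mat) = 0\<^sub>m m n"
  by (rule eq_matI) (auto simp: index_adj)

lemma adj_one [simp]: "adj (1\<^sub>m n :: 'a::conj_div_algebra mat) = 1\<^sub>m n"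
  by (rule eq_matI) (auto simp: index_adj)

lemma adj_add: "dim_row M = dim_row N \<Longrightarrow> dim_col M = dim_col N \<Longrightarrow>
    adj (M + N) = adj M + adj (N::'a::conj_div_algebra mat)"
  by (rule eq_matI) (auto simp: index_adj conjugate_add)

lemma adj_uminus: "adj (- M) = - adj (M::'a::conj_div_algebra mat)"
  by (rule eq_matI) (auto simp: index_adj conjugate_uminus)

lemma index_mult_mat_sum:
  "i < dim_row M \<Longrightarrow> j < dim_col N \<Longrightarrow> dim_col M = dim_row N \<Longrightarrow>
    (M * N) $$ (i, j) = (\<Sum>l<dim_row N. M $$ (i, l) * N $$ (l, j))"
  by (auto simp: scalar_prod_def lessThan_atLeast0)

lemma adj_mult: "dim_col M = dim_row N \<Longrightarrow>
    adj (M * N) = adj N * adj (M::'a::conj_div_algebra mat)"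
  by (rule eq_matI)
    (auto simp: index_adj index_mult_mat_sum conjugate_sum conjugate_mult simp del: index_mult_mat(1))

text \<open>Rewrite rules of matrix algebra whose side conditions concern dimensions only. The simplifier
  decides these conditions on compound terms, whereas membership in a set of matrices of given size leaves the
  inner dimension to be guessed.\<close>

lemma minus_mat_conv: "dim_row M = dim_row N \<Longrightarrow> dim_col M = dim_col N \<Longrightarrow> M - N = M + - (N::'a::group_add mat)"
  by (rule eq_matI) auto

lemma mult_assoc_dim: "dim_col L = dim_row M \<Longrightarrow> dim_col M = dim_row N \<Longrightarrow>
    L * M * N = L * (M * (N::'a::semiring_0 mat))"
  by (rule assoc_mult_mat) auto

lemma mult_add_dim: "dim_col L = dim_row M \<Longrightarrow> dim_row M = dim_row N \<Longrightarrow> dim_col M = dim_col N \<Longrightarrow>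
    L * (M + N) = L * M + L * (N::'a::semiring_0 mat)"
  by (rule mult_add_distrib_mat) auto

lemma add_mult_dim: "dim_col M = dim_row L \<Longrightarrow> dim_row M = dim_row N \<Longrightarrow> dim_col M = dim_col N \<Longrightarrow>
    (M + N) * L = M * L + N * (L::'a::semiring_0 mat)"
  by (rule add_mult_distrib_mat) auto

lemma uminus_mult_dim: "dim_col M = dim_row N \<Longrightarrow> - M * N = - (M * (N::'a::ring mat))"
    "dim_col M = dim_row N \<Longrightarrow> M * - N = - (M * (N::'a::ring mat))"
  by simp_all

lemmas mat_ring = minus_mat_conv mult_assoc_dim mult_add_dim add_mult_dim uminus_mult_dim
  adj_mult adj_add adj_uminus

lemma add_zero_mat_dim [simp]:
  "dim_row M = r \<Longrightarrow> dim_col M = c \<Longrightarrow> 0\<^sub>m r c + M = (M::'a::monoid_add mat)"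
  "dim_row M = r \<Longrightarrow> dim_col M = c \<Longrightarrow> M + 0\<^sub>m r c = M"
  by (auto intro!: eq_matI)

lemma uminus_zero_mat' [simp]: "- 0\<^sub>m r c = (0\<^sub>m r c :: 'a::group_add mat)"
  by (rule eq_matI) auto

lemma mult_carrier_iff [simp]: "M * N \<in> carrier_mat r c \<longleftrightarrow> dim_row M = r \<and> dim_col N = c"
  by (metis carrier_matD carrier_matI index_mult_mat(2,3))

lemma add_carrier_iff [simp]: "M + N \<in> carrier_mat r c \<longleftrightarrow> N \<in> carrier_mat r c"
  by (metis carrier_matD carrier_matI index_add_mat(2,3))

text \<open>The diagonal entries of \<open>M\<^sup>* M\<close> are the squared norms of the columns of
  \<open>M\<close>. The doubled form is the one that arises when an equation is added to its adjoint.\<close>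

lemma add_adj_mult_self_eq_0: 
  fixes M :: "'a::conj_div_algebra mat"
  assumes "adj M * M + adj M * M = 0\<^sub>m (dim_col M) (dim_col M)"
  shows "M = 0\<^sub>m (dim_row M) (dim_col M)"
proof (rule eq_matI)
  fix i j assume "i < dim_row (0\<^sub>m (dim_row M) (dim_col M) :: 'a mat)" 
    "j < dim_col (0\<^sub>m (dim_row M) (dim_col M) :: 'a mat)"
  then have ij: "i < dim_row M" "j < dim_col M" by auto
  have "(adj M * M) $$ (j, j) + (adj M * M) $$ (j, j) = 0"
    using arg_cong[OF assms, of "\<lambda>B. B $$ (j, j)"] ij by (simp del: index_mult_mat(1))
  then have "2 *\<^sub>R ((adj M * M) $$ (j, j)) = 0" by (simp only: scaleR_2)
  then have "(adj M * M) $$ (j, j) = 0" by simp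
  then have "of_real (\<Sum>l<dim_row M. (norm (M $$ (l, j)))\<^sup>2) = (0::'a)"
    using ij by (simp add: index_mult_mat_sum index_adj conjugate_mult_self scaleR_conv_of_real
        del: index_mult_mat(1))
  then have "(\<Sum>l<dim_row M. (norm (M $$ (l, j)))\<^sup>2) = 0"
    by (simp only: of_real_eq_0_iff)
  then have "\<forall>l<dim_row M. (norm (M $$ (l, j)))\<^sup>2 = 0"
    by (subst (asm) sum_nonneg_eq_0_iff) auto
  then show "M $$ (i, j) = 0\<^sub>m (dim_row M) (dim_col M) $$ (i, j)"
    using ij by simp
qed auto

section \<open>Square matrices over a division ring\<close>

text \<open>Gaussian elimination. A pivot in the last column eliminates the last unknown and one equation;
  without a pivot the last unit vector is a solution. Coefficients act from the left and unknowns stand on the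
  right, which makes elimination work over a division ring.\<close>

lemma underdetermined_system_nontrivial:
  fixes a :: "nat \<Rightarrow> nat \<Rightarrow> 'a::division_ring"
  shows "\<exists>x. (\<exists>j\<le>m. x j \<noteq> 0) \<and> (\<forall>i<m. (\<Sum>j\<le>m. a i j * x j) = 0)"
proof (induction m arbitrary: a)
  case 0
  show ?case by (intro exI[of _ "\<lambda>_. 1"]) auto
next
  case (Suc m)
  show ?case
  proof (cases "\<exists>i<Suc m. a i (Suc m) \<noteq> 0")
    case False
    let ?x = "\<lambda>j. if j = Suc m then 1 else 0 :: 'a"
    have "(\<Sum>j\<le>Suc m. a i j * ?x j) = 0" if "i < Suc m" for i
      using False that by (simp add: if_distrib sum.neutral cong: if_cong)
    then show ?thesis by (intro exI[of _ ?x]) auto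
  next
    case True
    then obtain p where p: "p < Suc m" "a p (Suc m) \<noteq> 0" by blast
    \<comment> \<open>The equations other than the pivot equation, and the multiples of the latter to be subtracted.\<close>
    define f where "f i = (if i < p then i else Suc i)" for i
    define c where "c i = a i (Suc m) * inverse (a p (Suc m))" for i
    obtain x j0 where x: "j0 \<le> m" "x j0 \<noteq> 0"
      and eq: "\<And>i. i < m \<Longrightarrow> (\<Sum>j\<le>m. (a (f i) j - c (f i) * a p j) * x j) = 0"
      using Suc.IH[of "\<lambda>i j. a (f i) j - c (f i) * a p j"] by blast
    \<comment> \<open>The last unknown is determined by the pivot equation.\<close>
    define y where "y j = (if j = Suc m then - (inverse (a p (Suc m)) * (\<Sum>j\<le>m. a p j * x j)) else x j)" for j
    have y: "(\<Sum>j\<le>Suc m. a i j * y j) = (\<Sum>j\<le>m. (a i j - c i * a p j) * x j)" for i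
    proof -
      have "(\<Sum>j\<le>Suc m. a i j * y j) = (\<Sum>j\<le>m. a i j * x j) - c i * (\<Sum>j\<le>m. a p j * x j)"
        by (simp add: y_def c_def mult.assoc)
      then show ?thesis
        by (simp add: left_diff_distrib sum_subtractf sum_distrib_left mult.assoc)
    qed
    have "(\<Sum>j\<le>Suc m. a i j * y j) = 0" if i: "i < Suc m" for i
    proof (cases "i = p")
      case True
      then show ?thesis unfolding y using p by (simp add: c_def)
    next
      case False
      then obtain i' where "i' < m" "i = f i'"
      proof (cases "i < p")
        case True
        then show ?thesis using p by (intro that[of i]) (auto simp: f_def)
      next
        case False
        then have "p < i" using \<open>i \<noteq> p\<close> by simp
        then obtain i' where "i = Suc i'" by (cases i) auto
        then show ?thesis using \<open>i < Suc m\<close> \<open>p < i\<close> by (intro that[of i']) (auto simp: f_def)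
      qed
      then show ?thesis unfolding y using eq by simp
    qed
    moreover have "y j0 \<noteq> 0" using x by (simp add: y_def)
    ultimately show ?thesis using x(1) by (intro exI[of _ y]) (auto intro: exI[of _ j0])
  qed
qed

lemma wide_matrix_kernel:
  fixes M :: "'a::division_ring mat"
  assumes "M \<in> carrier_mat m n" "m < n"
  obtains v where "v \<in> carrier_mat n 1" "v \<noteq> 0\<^sub>m n 1" "M * v = 0\<^sub>m m 1"
proof -
  define a where "a i j = (if i < m then M $$ (i, j) else 0)" for i j
  obtain x j0 where x: "j0 \<le> n - 1" "x j0 \<noteq> 0" and eq: "\<And>i. i < n - 1 \<Longrightarrow> (\<Sum>j\<le>n - 1. a i j * x j) = 0"
    using underdetermined_system_nontrivial[of "n - 1" a] by blast
  define v where "v = Matrix.mat n 1 (\<lambda>(i, j). x i)"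
  have v: "v \<in> carrier_mat n 1" by (simp add: v_def)
  have n: "{..n - 1} = {..<n}" using assms(2) by auto
  have "v $$ (j0, 0) \<noteq> 0" using x assms(2) by (simp add: v_def)
  then have "v \<noteq> 0\<^sub>m n 1" using x assms(2) by auto
  moreover have "M * v = 0\<^sub>m m 1"
  proof (rule eq_matI)
    fix i j assume "i < dim_row (0\<^sub>m m 1 :: 'a mat)" "j < dim_col (0\<^sub>m m 1 :: 'a mat)"
    then have ij: "i < m" "j = 0" by auto
    have "(M * v) $$ (i, 0) = (\<Sum>l<n. a i l * x l)"
      using assms v ij by (subst index_mult_mat_sum) (auto simp: v_def a_def)
    also have "\<dots> = 0" using eq[of i] ij assms(2) n by simp
    finally show "(M * v) $$ (i, j) = 0\<^sub>m m 1 $$ (i, j)" using ij by simp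
  qed (use assms v in auto)
  ultimately show thesis using that v by blast
qed

text \<open>A matrix with trivial kernel is left cancellable: apply the hypothesis to each column.\<close>

lemma mult_col_eq_0:
  fixes M :: "'a::division_ring mat"
  assumes "M \<in> carrier_mat m n" "B \<in> carrier_mat n r" "M * B = 0\<^sub>m m r"
    and "\<And>v. v \<in> carrier_mat n 1 \<Longrightarrow> M * v = 0\<^sub>m m 1 \<Longrightarrow> v = 0\<^sub>m n 1"
  shows "B = 0\<^sub>m n r"
proof (rule eq_matI)
  fix i j assume "i < dim_row (0\<^sub>m n r :: 'a mat)" "j < dim_col (0\<^sub>m n r :: 'a mat)"
  then have ij: "i < n" "j < r" by auto
  define v where "v = Matrix.mat n 1 (\<lambda>(l, _). B $$ (l, j))"
  have v: "v \<in> carrier_mat n 1" by (simp add: v_def)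
  have "M * v = 0\<^sub>m m 1"
  proof (rule eq_matI)
    fix a b assume "a < dim_row (0\<^sub>m m 1 :: 'a mat)" "b < dim_col (0\<^sub>m m 1 :: 'a mat)"
    then have ab: "a < m" "b = 0" by auto
    have "(M * v) $$ (a, 0) = (M * B) $$ (a, j)"
      using assms(1,2) v ab ij
      by (subst (1 2) index_mult_mat_sum) (auto simp: v_def)
    then show "(M * v) $$ (a, b) = 0\<^sub>m m 1 $$ (a, b)" using assms(3) ab ij by simp
  qed (use assms v in auto)
  then have "v = 0\<^sub>m n 1" using assms(4) v by blast
  from arg_cong[OF this, of "\<lambda>v. v $$ (i, 0)"] show "B $$ (i, j) = 0\<^sub>m n r $$ (i, j)"
    using ij by (simp add: v_def)
qed (use assms in auto)

lemma mat_eq_of_add_uminus: 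
  assumes "(M::'a::group_add mat) \<in> carrier_mat m n" "N \<in> carrier_mat m n" "M + - N = 0\<^sub>m m n"
  shows "M = N"
proof (rule eq_matI)
  fix i j assume "i < dim_row N" "j < dim_col N"
  then show "M $$ (i, j) = N $$ (i, j)"
    using arg_cong[OF assms(3), of "\<lambda>B. B $$ (i, j)"] assms(1,2) by (auto simp: eq_neg_iff_add_eq_0)
qed (use assms in auto)

text \<open>To solve \<open>M x = b\<close>, take a nontrivial solution of the homogeneous system with the
  matrix \<open>(M, - b)\<close>. Its last component is nonzero because \<open>M\<close> is injective, and
  dividing by it on the right gives \<open>x\<close>. The right inverse so obtained is also a left inverse by
  cancellation.\<close>

lemma invertible_of_inj:
  fixes M :: "'a::division_ring mat"
  assumes M: "M \<in> carrier_mat n n"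
    and inj: "\<And>v. v \<in> carrier_mat n 1 \<Longrightarrow> M * v = 0\<^sub>m n 1 \<Longrightarrow> v = 0\<^sub>m n 1"
  shows "invertible_mat M"
proof -
  have "\<exists>x\<in>carrier_mat n 1. M * x = b" if b: "b \<in> carrier_mat n 1" for b
  proof -
    define E where "E = Matrix.mat n (Suc n) (\<lambda>(i, j). if j < n then M $$ (i, j) else - b $$ (i, 0))"
    have "E \<in> carrier_mat n (Suc n)" by (simp add: E_def)
    then obtain w where w: "w \<in> carrier_mat (Suc n) 1" "w \<noteq> 0\<^sub>m (Suc n) 1" "E * w = 0\<^sub>m n 1"
      by (rule wide_matrix_kernel) auto
    define c where "c = w $$ (n, 0)"
    define y where "y = Matrix.mat n 1 (\<lambda>(i, _). w $$ (i, 0))"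
    have y: "y \<in> carrier_mat n 1" by (simp add: y_def)
    have sum: "(\<Sum>l<n. M $$ (i, l) * w $$ (l, 0)) = b $$ (i, 0) * c" if "i < n" for i
    proof -
      have "0 = (E * w) $$ (i, 0)" using w that by simp
      also have "\<dots> = (\<Sum>l<Suc n. E $$ (i, l) * w $$ (l, 0))"
        using w that by (subst index_mult_mat_sum) (auto simp: E_def)
      also have "\<dots> = (\<Sum>l<n. M $$ (i, l) * w $$ (l, 0)) - b $$ (i, 0) * c"
        using that by (simp add: E_def c_def)
      finally show ?thesis by simp
    qed
    \<comment> \<open>Otherwise the other components would be in the kernel of \<open>M\<close>.\<close>
    have "c \<noteq> 0"
    proof
      assume c: "c = 0"
      have "M * y = 0\<^sub>m n 1"
      proof (rule eq_matI)
        fix i j assume "i < dim_row (0\<^sub>m n 1 :: 'a mat)" "j < dim_col (0\<^sub>m n 1 :: 'a mat)"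
        then show "(M * y) $$ (i, j) = 0\<^sub>m n 1 $$ (i, j)" using M y sum[of i] c
          by (subst index_mult_mat_sum) (auto simp: y_def)
      qed (use M y in auto)
      then have y0: "y = 0\<^sub>m n 1" using inj y by blast
      have "w = 0\<^sub>m (Suc n) 1"
      proof (rule eq_matI)
        fix i j assume "i < dim_row (0\<^sub>m (Suc n) 1 :: 'a mat)" "j < dim_col (0\<^sub>m (Suc n) 1 :: 'a mat)"
        then show "w $$ (i, j) = 0\<^sub>m (Suc n) 1 $$ (i, j)"
          using arg_cong[OF y0, of "\<lambda>v. v $$ (i, 0)"] c
          by (cases "i = n") (auto simp: y_def c_def)
      qed (use w in auto)
      with w show False by simp
    qed
    define x where "x = Matrix.mat n 1 (\<lambda>(i, _). w $$ (i, 0) * inverse c)"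
    have "x \<in> carrier_mat n 1" by (simp add: x_def)
    moreover have "M * x = b"
    proof (rule eq_matI)
      fix i j assume ij: "i < dim_row b" "j < dim_col b"
      have "(M * x) $$ (i, 0) = (\<Sum>l<n. M $$ (i, l) * w $$ (l, 0)) * inverse c"
        using M ij b by (subst index_mult_mat_sum) (auto simp: x_def sum_distrib_right mult.assoc)
      then show "(M * x) $$ (i, j) = b $$ (i, j)" using sum[of i] ij b \<open>c \<noteq> 0\<close>
        by (auto simp: mult.assoc)
    qed (use M b in \<open>auto simp: x_def\<close>)
    ultimately show ?thesis by blast
  qed
  then have "\<forall>j. \<exists>x\<in>carrier_mat n 1. M * x = Matrix.mat n 1 (\<lambda>(i, _). if i = j then 1 else 0)"
    by simp
  then obtain x where x: "\<And>j. x j \<in> carrier_mat n 1"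
    and Mx: "\<And>j. M * x j = Matrix.mat n 1 (\<lambda>(i, _). if i = j then 1 else 0)" by metis
  define N where "N = Matrix.mat n n (\<lambda>(i, j). x j $$ (i, 0))"
  have N: "N \<in> carrier_mat n n" by (simp add: N_def)
  have MN: "M * N = 1\<^sub>m n"
  proof (rule eq_matI)
    fix i j assume "i < dim_row (1\<^sub>m n :: 'a mat)" "j < dim_col (1\<^sub>m n :: 'a mat)"
    then have ij: "i < n" "j < n" by auto
    have "(M * N) $$ (i, j) = (M * x j) $$ (i, 0)"
      using M N x[of j] ij by (subst (1 2) index_mult_mat_sum) (auto simp: N_def)
    then show "(M * N) $$ (i, j) = 1\<^sub>m n $$ (i, j)" using Mx[of j] ij by simp
  qed (use M N in auto)
  have "M * (N * M + - 1\<^sub>m n) = M * N * M + - M"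
    using M N by (simp add: mult_add_dim mult_assoc_dim uminus_mult_dim)
  also have "\<dots> = 0\<^sub>m n n" using M by (intro eq_matI) (auto simp: MN)
  finally have "N * M + - 1\<^sub>m n = 0\<^sub>m n n"
    by (rule mult_col_eq_0[OF M _ _ inj, rotated]) (use M N in auto)
  then have "N * M = 1\<^sub>m n"
    by (rule mat_eq_of_add_uminus[rotated 2]) (use M N in auto)
  then show ?thesis using M N MN unfolding invertible_mat_def inverts_mat_def by auto
qed

lemma mat_inv:
  fixes M :: "'a::ring_1 mat"
  assumes "invertible_mat M" "M \<in> carrier_mat n n"
  shows "mat_inv M \<in> carrier_mat n n" "M * mat_inv M = 1\<^sub>m n" "mat_inv M * M = 1\<^sub>m n"
proof -
  obtain N where N: "M * N = 1\<^sub>m n" "N * M = 1\<^sub>m (dim_row N)"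
    using assms by (auto simp: invertible_mat_def inverts_mat_def)
  from arg_cong[OF N(1), of dim_col] arg_cong[OF N(2), of dim_col] 
  have N': "N \<in> carrier_mat n n" using assms by auto
  then have "mat_inv M = N"
    using N assms by (intro mat_inv_eqI[of _ n]) auto
  with N N' show "mat_inv M \<in> carrier_mat n n" "M * mat_inv M = 1\<^sub>m n" "mat_inv M * M = 1\<^sub>m n"
    by auto
qed

lemma invertible_matI:
  "M \<in> carrier_mat n n \<Longrightarrow> N \<in> carrier_mat n n \<Longrightarrow> M * N = 1\<^sub>m n \<Longrightarrow> N * M = 1\<^sub>m n \<Longrightarrow> invertible_mat M"
  by (auto simp: invertible_mat_def inverts_mat_def)

lemma left_inverse_cancel:
  fixes M :: "'a::semiring_1 mat"
  assumes "N \<in> carrier_mat n m" "M \<in> carrier_mat m n" "N * M = 1\<^sub>m n" "B \<in> carrier_mat n r" "M * B = 0\<^sub>m m r"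
  shows "B = 0\<^sub>m n r"
proof -
  have "B = N * M * B" using assms by simp
  also have "\<dots> = N * (M * B)" using assms(1,2,4) by (simp add: mult_assoc_dim)
  finally show ?thesis using assms by simp
qed

lemma one_sided_inverse:
  fixes M :: "'a::division_ring mat"
  assumes "M \<in> carrier_mat n n" "N \<in> carrier_mat n n" "M * N = 1\<^sub>m n"
  shows "N * M = 1\<^sub>m n"
proof -
  have "invertible_mat N"
    by (rule invertible_of_inj[OF assms(2)]) (rule left_inverse_cancel[OF assms])
  note N' = mat_inv[OF this assms(2)]
  have "M = M * (N * mat_inv N)" using N' assms by simp
  also have "\<dots> = M * N * mat_inv N" using N'(1) assms(1,2) by (simp add: mult_assoc_dim)
  finally have "M = mat_inv N" using N' assms by simp
  with N' show ?thesis by simp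
qed

lemma invertible_adj:
  fixes M :: "'a::conj_div_algebra mat"
  assumes "M \<in> carrier_mat n n" "invertible_mat M"
  shows "invertible_mat (adj M)"
proof -
  note N = mat_inv[OF assms(2,1)]
  show ?thesis
  proof (rule invertible_matI)
    show "adj M * adj (mat_inv M) = 1\<^sub>m n" "adj (mat_inv M) * adj M = 1\<^sub>m n"
      using N assms(1) by (metis adj_mult adj_one carrier_matD)+
  qed (use N assms in auto)
qed

section \<open>The topology of matrices\<close>

text \<open>The topology of matrices is that of their entries, so continuity can be checked entrywise.\<close>

lemma continuous_map_mat_topology:
  "continuous_map T (mat_topology r c) f \<longleftrightarrow>
    (\<forall>x\<in>topspace T. f x \<in> carrier_mat r c) \<and>
    (\<forall>i<r. \<forall>j<c. continuous_map T euclidean (\<lambda>x. f x $$ (i, j)))"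
proof -
  let ?e = "\<lambda>M. restrict (index_mat M) ({..<r} \<times> {..<c})"
  have "continuous_map T (mat_topology r c) f \<longleftrightarrow>
      f \<in> topspace T \<rightarrow> carrier_mat r c \<and>
      continuous_map T (product_topology (\<lambda>_. euclidean) ({..<r} \<times> {..<c})) (?e \<circ> f)"
    unfolding mat_topology_def
  proof (intro iffI conjI)
    let ?T = "product_topology (\<lambda>_. euclidean) ({..<r} \<times> {..<c})"
    assume *: "continuous_map T (pullback_topology (carrier_mat r c) ?e ?T) f"
    show "f \<in> topspace T \<rightarrow> carrier_mat r c"
      using continuous_map_funspace[OF *] by (auto simp: topspace_pullback_topology)
    show "continuous_map T ?T (?e \<circ> f)"
      by (rule continuous_map_compose[OF *])
        (use continuous_map_pullback[OF continuous_map_id, of "carrier_mat r c" ?e ?T] in simp)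
  qed (auto intro!: continuous_map_pullback')
  then show ?thesis
    by (auto simp: continuous_map_componentwise image_subset_iff)
qed

lemma topspace_mat_topology [simp]: "topspace (mat_topology r c) = carrier_mat r c"
  by (auto simp: mat_topology_def topspace_pullback_topology)

lemma continuous_map_index_mat:
  "i < r \<Longrightarrow> j < c \<Longrightarrow> continuous_map (mat_topology r c) euclidean (\<lambda>M. M $$ (i, j))"
  using continuous_map_mat_topology[of "mat_topology r c" r c "\<lambda>M. M"] by (simp, blast)

text \<open>Entrywise convergence along a filter. It serves both continuity, along neighbourhoods of a matrix,
  and difference quotients, along real parameters near 0.\<close>

definition mat_tendsto :: "nat \<Rightarrow> nat \<Rightarrow> ('b \<Rightarrow> 'a::topological_space mat) \<Rightarrow> 'a mat \<Rightarrow> 'b filter \<Rightarrow> bool" where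
  "mat_tendsto r c f M F \<longleftrightarrow> (\<forall>i<r. \<forall>j<c. ((\<lambda>x. f x $$ (i, j)) \<longlongrightarrow> M $$ (i, j)) F)"

lemma continuous_map_mat_tendsto:
  "continuous_map T (mat_topology r c) f \<longleftrightarrow>
    (\<forall>x\<in>topspace T. f x \<in> carrier_mat r c \<and> mat_tendsto r c f (f x) (atin T x))"
  unfolding continuous_map_mat_topology continuous_map_atin[of _ euclidean] limitin_canonical_iff mat_tendsto_def
  by blast

lemma continuous_map_matI:
  assumes "\<And>x. x \<in> topspace T \<Longrightarrow> f x \<in> carrier_mat r c"
    "\<And>x. x \<in> topspace T \<Longrightarrow> \<forall>\<^sub>F y in atin T x. y \<in> topspace T \<Longrightarrow> mat_tendsto r c f (f x) (atin T x)"
  shows "continuous_map T (mat_topology r c) f"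
  unfolding continuous_map_mat_tendsto
  using assms openin_topspace by (metis (mono_tags, lifting) DiffD1 eventually_atin)

lemma mat_tendsto_add:
  fixes f g :: "'b \<Rightarrow> 'a::real_normed_vector mat"
  assumes "mat_tendsto r c f M F" "mat_tendsto r c g N F"
    "\<forall>\<^sub>F x in F. f x \<in> carrier_mat r c" "\<forall>\<^sub>F x in F. g x \<in> carrier_mat r c"
    "M \<in> carrier_mat r c" "N \<in> carrier_mat r c"
  shows "mat_tendsto r c (\<lambda>x. f x + g x) (M + N) F"
  unfolding mat_tendsto_def
proof (intro allI impI)
  fix i j assume ij: "i < r" "j < c"
  have "((\<lambda>x. f x $$ (i, j) + g x $$ (i, j)) \<longlongrightarrow> M $$ (i, j) + N $$ (i, j)) F"
    using assms(1,2) ij by (intro tendsto_add) (auto simp: mat_tendsto_def)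
  also have "M $$ (i, j) + N $$ (i, j) = (M + N) $$ (i, j)"
    using assms(5,6) ij by auto
  finally show "((\<lambda>x. (f x + g x) $$ (i, j)) \<longlongrightarrow> (M + N) $$ (i, j)) F"
  proof (rule tendsto_cong[THEN iffD1, rotated])
    show "\<forall>\<^sub>F x in F. f x $$ (i, j) + g x $$ (i, j) = (f x + g x) $$ (i, j)"
      using assms(3,4) by eventually_elim (use ij in auto)
  qed
qed

lemma mat_tendsto_adj:
  fixes f :: "'b \<Rightarrow> 'a::conj_div_algebra mat"
  assumes "mat_tendsto r c f M F" "\<forall>\<^sub>F x in F. f x \<in> carrier_mat r c" "M \<in> carrier_mat r c"
  shows "mat_tendsto c r (\<lambda>x. adj (f x)) (adj M) F"
  unfolding mat_tendsto_def
proof (intro allI impI)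
  fix i j assume ij: "i < c" "j < r"
  have "((\<lambda>x. conjugate (f x $$ (j, i))) \<longlongrightarrow> conjugate (M $$ (j, i))) F"
    using assms(1) ij by (intro bounded_linear.tendsto[OF bounded_linear_conjugate]) (auto simp: mat_tendsto_def)
  also have "conjugate (M $$ (j, i)) = adj M $$ (i, j)"
    using assms(3) ij by (auto simp: index_adj)
  finally show "((\<lambda>x. adj (f x) $$ (i, j)) \<longlongrightarrow> adj M $$ (i, j)) F"
  proof (rule tendsto_cong[THEN iffD1, rotated])
    show "\<forall>\<^sub>F x in F. conjugate (f x $$ (j, i)) = adj (f x) $$ (i, j)"
      using assms(2) by eventually_elim (use ij in \<open>auto simp: index_adj\<close>)
  qed
qed

lemma mat_tendsto_mult:
  fixes f g :: "'b \<Rightarrow> 'a::real_normed_algebra mat"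
  assumes "mat_tendsto r l f M F" "mat_tendsto l c g N F"
    "\<forall>\<^sub>F x in F. f x \<in> carrier_mat r l" "\<forall>\<^sub>F x in F. g x \<in> carrier_mat l c"
    "M \<in> carrier_mat r l" "N \<in> carrier_mat l c"
  shows "mat_tendsto r c (\<lambda>x. f x * g x) (M * N) F"
  unfolding mat_tendsto_def
proof (intro allI impI)
  fix i j assume ij: "i < r" "j < c"
  have "((\<lambda>x. \<Sum>a<l. f x $$ (i, a) * g x $$ (a, j)) \<longlongrightarrow> (\<Sum>a<l. M $$ (i, a) * N $$ (a, j))) F"
    using assms(1,2) ij by (intro tendsto_sum tendsto_mult) (auto simp: mat_tendsto_def)
  also have "(\<Sum>a<l. M $$ (i, a) * N $$ (a, j)) = (M * N) $$ (i, j)"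
    using assms(5,6) ij by (subst index_mult_mat_sum) auto
  finally show "((\<lambda>x. (f x * g x) $$ (i, j)) \<longlongrightarrow> (M * N) $$ (i, j)) F"
  proof (rule tendsto_cong[THEN iffD1, rotated])
    show "\<forall>\<^sub>F x in F. (\<Sum>a<l. f x $$ (i, a) * g x $$ (a, j)) = (f x * g x) $$ (i, j)"
      using assms(3,4) by eventually_elim (use ij in \<open>subst index_mult_mat_sum; auto\<close>)
  qed
qed

lemma mat_tendsto_cong:
  assumes "\<forall>\<^sub>F x in F. f x = g x" "mat_tendsto r c f M F"
  shows "mat_tendsto r c g M F"
  unfolding mat_tendsto_def
proof (intro allI impI)
  fix i j assume ij: "i < r" "j < c"
  then have "((\<lambda>x. f x $$ (i, j)) \<longlongrightarrow> M $$ (i, j)) F" using assms(2) by (simp add: mat_tendsto_def)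
  then show "((\<lambda>x. g x $$ (i, j)) \<longlongrightarrow> M $$ (i, j)) F"
    by (rule tendsto_cong[THEN iffD1, rotated]) (use assms(1) in \<open>auto elim: eventually_mono\<close>)
qed

section \<open>Continuity of matrix inversion\<close>

text \<open>A submultiplicative norm that is available for matrices of every size.\<close>

definition entry_norm :: "'a::real_normed_vector mat \<Rightarrow> real" where
  "entry_norm M = (\<Sum>i<dim_row M. \<Sum>j<dim_col M. norm (M $$ (i, j)))"

lemma entry_norm_nonneg: "0 \<le> entry_norm M"
  by (auto simp: entry_norm_def intro!: sum_nonneg)

lemma norm_index_le_entry_norm:
  assumes "i < dim_row M" "j < dim_col M"
  shows "norm (M $$ (i, j)) \<le> entry_norm M"
proof -
  have "norm (M $$ (i, j)) \<le> (\<Sum>j<dim_col M. norm (M $$ (i, j)))"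
    using assms(2) by (intro member_le_sum) auto
  also have "\<dots> \<le> entry_norm M" unfolding entry_norm_def
    using assms(1) by (intro member_le_sum[of i _ "\<lambda>i. \<Sum>j<dim_col M. norm (M $$ (i, j))"] sum_nonneg) auto
  finally show ?thesis .
qed

lemma entry_norm_eq_0: "entry_norm M = 0 \<Longrightarrow> M = 0\<^sub>m (dim_row M) (dim_col M)"
  using norm_index_le_entry_norm[of _ M] by (intro eq_matI) auto

lemma entry_norm_uminus [simp]: "entry_norm (- M) = entry_norm M"
  by (simp add: entry_norm_def)

lemma entry_norm_add:
  "dim_row M = dim_row N \<Longrightarrow> dim_col M = dim_col N \<Longrightarrow> entry_norm (M + N) \<le> entry_norm M + entry_norm N"
  by (auto simp: entry_norm_def sum.distrib[symmetric] intro!: sum_mono norm_triangle_ineq)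

lemma entry_norm_mult:
  fixes M N :: "'a::real_normed_algebra mat"
  assumes "dim_col M = dim_row N"
  shows "entry_norm (M * N) \<le> entry_norm M * entry_norm N"
proof -
  have "entry_norm (M * N) = (\<Sum>i<dim_row M. \<Sum>j<dim_col N. norm (\<Sum>l<dim_row N. M $$ (i, l) * N $$ (l, j)))"
    using assms by (simp add: entry_norm_def index_mult_mat_sum del: index_mult_mat(1))
  also have "\<dots> \<le> (\<Sum>i<dim_row M. \<Sum>j<dim_col N. \<Sum>l<dim_row N. norm (M $$ (i, l)) * norm (N $$ (l, j)))"
    by (intro sum_mono sum_norm_le norm_mult_ineq)
  also have "\<dots> = (\<Sum>i<dim_row M. \<Sum>l<dim_row N. norm (M $$ (i, l)) * (\<Sum>j<dim_col N. norm (N $$ (l, j))))"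
    by (subst sum.swap) (simp add: sum_distrib_left)
  also have "\<dots> \<le> (\<Sum>i<dim_row M. \<Sum>l<dim_row N. norm (M $$ (i, l)) * entry_norm N)"
    unfolding entry_norm_def
    by (intro sum_mono mult_left_mono member_le_sum[where f = "\<lambda>l. \<Sum>j<dim_col N. norm (N $$ (l, j))"] sum_nonneg) auto
  also have "\<dots> = entry_norm M * entry_norm N"
    using assms by (simp add: entry_norm_def[of M] sum_distrib_right)
  finally show ?thesis .
qed

text \<open>From \<open>v = - M\<inverse> (N - M) v\<close> for \<open>N v = 0\<close> one gets
  \<open>\<bar>v\<bar> \<le> \<bar>v\<bar> / 2\<close>, hence \<open>v = 0\<close>. The bound follows from
  \<open>M\<inverse> - N\<inverse> = N\<inverse> (N - M) M\<inverse>\<close>, which first yields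
  \<open>\<bar>N\<inverse>\<bar> \<le> 2 \<bar>M\<inverse>\<bar>\<close>.\<close>

lemma mat_inv_perturbation:
  fixes M N :: "'a::real_normed_div_algebra mat"
  assumes M: "M \<in> carrier_mat n n" "invertible_mat M" and N: "N \<in> carrier_mat n n"
    and small: "2 * (entry_norm (mat_inv M) * entry_norm (N + - M)) < 1"
  shows "invertible_mat N"
    and "entry_norm (mat_inv N + - mat_inv M) \<le> 2 * (entry_norm (mat_inv M))\<^sup>2 * entry_norm (N + - M)"
proof -
  note I = mat_inv[OF M(2,1)]
  let ?a = "entry_norm (mat_inv M)" and ?d = "entry_norm (N + - M)"
  show inv: "invertible_mat N"
  proof (rule invertible_of_inj[OF N])
    fix v :: "'a mat" assume v: "v \<in> carrier_mat n 1" "N * v = 0\<^sub>m n 1"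
    have "mat_inv M * ((N + - M) * v) = - (mat_inv M * M * v)"
      using v N M I(1) by (simp add: add_mult_dim mult_assoc_dim uminus_mult_dim)
    then have "v = - (mat_inv M * ((N + - M) * v))" using I v by simp
    then have "entry_norm v = entry_norm (mat_inv M * ((N + - M) * v))" by (metis entry_norm_uminus)
    also have "\<dots> \<le> ?a * entry_norm ((N + - M) * v)"
      using I M N v by (intro entry_norm_mult) auto
    also have "\<dots> \<le> ?a * (?d * entry_norm v)"
      using M N v by (intro mult_left_mono entry_norm_mult entry_norm_nonneg) auto
    also have "\<dots> = (?a * ?d) * entry_norm v" by simp
    also have "\<dots> \<le> (1/2) * entry_norm v"
      using small by (intro mult_right_mono entry_norm_nonneg) auto
    finally have "entry_norm v = 0" using entry_norm_nonneg[of v] by simp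
    then show "v = 0\<^sub>m n 1" using entry_norm_eq_0[of v] v by simp
  qed
  note J = mat_inv[OF inv N]
  have "mat_inv N * ((N + - M) * mat_inv M) = mat_inv N * N * mat_inv M + - (mat_inv N * (M * mat_inv M))"
    using M(1) N I(1) J(1) by (simp add: add_mult_dim mult_add_dim mult_assoc_dim uminus_mult_dim)
  also have "\<dots> = mat_inv M + - mat_inv N" using I J by simp
  finally have eq: "mat_inv M + - mat_inv N = mat_inv N * ((N + - M) * mat_inv M)" ..
  have "mat_inv N + - mat_inv M = - (mat_inv M + - mat_inv N)"
    using I(1) J(1) by (intro eq_matI) auto
  then have "entry_norm (mat_inv N + - mat_inv M) = entry_norm (mat_inv N * ((N + - M) * mat_inv M))"
    using eq by (metis entry_norm_uminus)
  also have "\<dots> \<le> entry_norm (mat_inv N) * entry_norm ((N + - M) * mat_inv M)"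
    using I J M N by (intro entry_norm_mult) auto
  also have "\<dots> \<le> entry_norm (mat_inv N) * (?d * ?a)"
    using I M N by (intro mult_left_mono entry_norm_mult entry_norm_nonneg) auto
  finally have diff: "entry_norm (mat_inv N + - mat_inv M) \<le> entry_norm (mat_inv N) * (?a * ?d)"
    by (simp add: mult.commute)
  have "mat_inv N = mat_inv M + (mat_inv N + - mat_inv M)"
    using I(1) J(1) by (intro eq_matI) auto
  then have "entry_norm (mat_inv N) \<le> ?a + entry_norm (mat_inv N + - mat_inv M)"
    using I(1) J(1) entry_norm_add[of "mat_inv M" "mat_inv N + - mat_inv M"] by auto
  also have "\<dots> \<le> ?a + entry_norm (mat_inv N) * (1/2)"
    using diff small mult_left_mono[of "?a * ?d" "1/2" "entry_norm (mat_inv N)"] entry_norm_nonneg[of "mat_inv N"]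
    by simp
  finally have "entry_norm (mat_inv N) \<le> 2 * ?a" by simp
  then have "entry_norm (mat_inv N) * (?a * ?d) \<le> 2 * ?a * (?a * ?d)"
    by (intro mult_right_mono mult_nonneg_nonneg entry_norm_nonneg)
  with diff show "entry_norm (mat_inv N + - mat_inv M) \<le> 2 * ?a\<^sup>2 * ?d"
    by (simp add: power2_eq_square mult.assoc)
qed

lemma entry_norm_tendsto_0:
  fixes f :: "'b \<Rightarrow> 'a::real_normed_vector mat"
  assumes "mat_tendsto r c f M F" "\<forall>\<^sub>F x in F. f x \<in> carrier_mat r c" "M \<in> carrier_mat r c"
  shows "((\<lambda>x. entry_norm (f x + - M)) \<longlongrightarrow> 0) F"
proof -
  have "((\<lambda>x. \<Sum>i<r. \<Sum>j<c. norm (f x $$ (i, j) - M $$ (i, j))) \<longlongrightarrow> (\<Sum>i<r. \<Sum>j<c. norm (M $$ (i, j) - M $$ (i, j)))) F"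
    using assms(1) by (intro tendsto_intros) (auto simp: mat_tendsto_def)
  then have "((\<lambda>x. \<Sum>i<r. \<Sum>j<c. norm (f x $$ (i, j) - M $$ (i, j))) \<longlongrightarrow> 0) F" by simp
  then show ?thesis
  proof (rule tendsto_cong[THEN iffD1, rotated])
    show "\<forall>\<^sub>F x in F. (\<Sum>i<r. \<Sum>j<c. norm (f x $$ (i, j) - M $$ (i, j))) = entry_norm (f x + - M)"
      using assms(2) by eventually_elim (use assms(3) in \<open>auto simp: entry_norm_def\<close>)
  qed
qed

lemma mat_tendsto_inv:
  fixes f :: "'b \<Rightarrow> 'a::real_normed_div_algebra mat"
  assumes f: "mat_tendsto n n f M F" "\<forall>\<^sub>F x in F. f x \<in> carrier_mat n n"
    and M: "M \<in> carrier_mat n n" "invertible_mat M"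
  shows "\<forall>\<^sub>F x in F. invertible_mat (f x)"
    and "mat_tendsto n n (\<lambda>x. mat_inv (f x)) (mat_inv M) F"
proof -
  let ?a = "entry_norm (mat_inv M)"
  have lim: "((\<lambda>x. entry_norm (f x + - M)) \<longlongrightarrow> 0) F"
    by (rule entry_norm_tendsto_0[OF f M(1)])
  then have "((\<lambda>x. 2 * (?a * entry_norm (f x + - M))) \<longlongrightarrow> 2 * (?a * 0)) F"
    by (intro tendsto_intros)
  then have small: "\<forall>\<^sub>F x in F. 2 * (?a * entry_norm (f x + - M)) < 1"
    by (rule order_tendstoD) simp
  show inv: "\<forall>\<^sub>F x in F. invertible_mat (f x)"
    using small f(2) by eventually_elim (rule mat_inv_perturbation(1)[OF M])
  have "((\<lambda>x. 2 * ?a\<^sup>2 * entry_norm (f x + - M)) \<longlongrightarrow> 2 * ?a\<^sup>2 * 0) F"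
    using lim by (intro tendsto_intros)
  then have lim': "((\<lambda>x. 2 * ?a\<^sup>2 * entry_norm (f x + - M)) \<longlongrightarrow> 0) F" by simp
  show "mat_tendsto n n (\<lambda>x. mat_inv (f x)) (mat_inv M) F"
    unfolding mat_tendsto_def
  proof (intro allI impI)
    fix i j assume ij: "i < n" "j < n"
    show "((\<lambda>x. mat_inv (f x) $$ (i, j)) \<longlongrightarrow> mat_inv M $$ (i, j)) F"
    proof (rule LIM_zero_cancel, rule Lim_null_comparison[OF _ lim'])
      show "\<forall>\<^sub>F x in F. norm (mat_inv (f x) $$ (i, j) - mat_inv M $$ (i, j)) \<le> 2 * ?a\<^sup>2 * entry_norm (f x + - M)"
        using small f(2) inv
      proof eventually_elim
        case (elim x)
        have "norm ((mat_inv (f x) + - mat_inv M) $$ (i, j)) \<le> entry_norm (mat_inv (f x) + - mat_inv M)"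
          using mat_inv(1)[OF elim(3,2)] mat_inv(1)[OF M(2,1)] ij by (intro norm_index_le_entry_norm) auto
        also have "\<dots> \<le> 2 * ?a\<^sup>2 * entry_norm (f x + - M)"
          by (rule mat_inv_perturbation(2)[OF M elim(2,1)])
        finally show ?case
          using mat_inv(1)[OF elim(3,2)] mat_inv(1)[OF M(2,1)] ij by simp
      qed
    qed
  qed
qed

lemma openin_invertible:
  "openin (mat_topology n n) {M \<in> carrier_mat n n. invertible_mat (M::'a::real_normed_div_algebra mat)}"
proof (subst openin_subopen, intro ballI)
  let ?G = "{M \<in> carrier_mat n n. invertible_mat (M::'a mat)}"
  fix M assume M: "M \<in> ?G"
  let ?a = "entry_norm (mat_inv M)"
  let ?h = "\<lambda>N. 2 * (?a * (\<Sum>i<n. \<Sum>j<n. norm (N $$ (i, j) - M $$ (i, j))))"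
  have cont: "continuous_map (mat_topology n n) euclidean ?h"
    unfolding continuous_map_atin limitin_canonical_iff
  proof (intro ballI tendsto_intros)
    fix N i j assume "N \<in> topspace (mat_topology n n)" "i \<in> {..<n}" "j \<in> {..<n}"
    then show "((\<lambda>N. N $$ (i, j)) \<longlongrightarrow> N $$ (i, j)) (atin (mat_topology n n) N)"
      using continuous_map_index_mat[of i n j n] by (auto simp: continuous_map_atin)
  qed
  have h: "?h N = 2 * (?a * entry_norm (N + - M))" if "N \<in> carrier_mat n n" for N
    using that M by (auto simp: entry_norm_def)
  have "openin (mat_topology n n) {N \<in> topspace (mat_topology n n). ?h N \<in> {..<1}}"
    by (rule openin_continuous_map_preimage[OF cont]) simp
  moreover have "M \<in> {N \<in> topspace (mat_topology n n). ?h N \<in> {..<1}}"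
    using M by simp
  moreover have "{N \<in> topspace (mat_topology n n). ?h N \<in> {..<1}} \<subseteq> ?G"
  proof
    fix N assume N: "N \<in> {N \<in> topspace (mat_topology n n). ?h N \<in> {..<1}}"
    then have Nc: "N \<in> carrier_mat n n" by simp
    have "?h N < 1" using N by blast
    then show "N \<in> ?G"
      using M Nc mat_inv_perturbation(1)[of M n N] unfolding h[OF Nc] by blast
  qed
  ultimately show "\<exists>T. openin (mat_topology n n) T \<and> M \<in> T \<and> T \<subseteq> ?G" by blast
qed

lemma continuous_map_mat_add:
  fixes f g :: "'b \<Rightarrow> 'a::real_normed_vector mat"
  assumes "continuous_map T (mat_topology r c) f" "continuous_map T (mat_topology r c) g"
  shows "continuous_map T (mat_topology r c) (\<lambda>x. f x + g x)"
  using assms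
  by (intro continuous_map_matI mat_tendsto_add) (auto simp: continuous_map_mat_tendsto elim: eventually_mono)

lemma continuous_map_mat_mult:
  fixes f g :: "'b \<Rightarrow> 'a::real_normed_algebra mat"
  assumes "continuous_map T (mat_topology r l) f" "continuous_map T (mat_topology l c) g"
  shows "continuous_map T (mat_topology r c) (\<lambda>x. f x * g x)"
  using assms
  by (intro continuous_map_matI mat_tendsto_mult[where l = l])
    (auto simp: continuous_map_mat_tendsto elim: eventually_mono)

lemma continuous_map_adj:
  fixes f :: "'b \<Rightarrow> 'a::conj_div_algebra mat"
  assumes "continuous_map T (mat_topology r c) f"
  shows "continuous_map T (mat_topology c r) (\<lambda>x. adj (f x))"
  using assms
  by (intro continuous_map_matI mat_tendsto_adj) (auto simp: continuous_map_mat_tendsto elim: eventually_mono)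

lemma continuous_map_mat_inv:
  fixes f :: "'b \<Rightarrow> 'a::real_normed_div_algebra mat"
  assumes "continuous_map T (mat_topology n n) f" "\<And>x. x \<in> topspace T \<Longrightarrow> invertible_mat (f x)"
  shows "continuous_map T (mat_topology n n) (\<lambda>x. mat_inv (f x))"
  using assms
  by (intro continuous_map_matI mat_tendsto_inv mat_inv) (auto simp: continuous_map_mat_tendsto elim: eventually_mono)

lemma openin_invertible_preimage:
  fixes f :: "'a::real_normed_div_algebra mat \<Rightarrow> 'a mat"
  assumes "continuous_map T (mat_topology n n) f"
  shows "openin T {M \<in> topspace T. invertible_mat (f M)}"
proof -
  have "f M \<in> carrier_mat n n" if "M \<in> topspace T" for M
    using assms that by (simp add: continuous_map_mat_topology)
  then have "{M \<in> topspace T. invertible_mat (f M)} = {M \<in> topspace T. f M \<in> {M \<in> carrier_mat n n. invertible_mat M}}"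
    by auto
  then show ?thesis using openin_continuous_map_preimage[OF assms openin_invertible] by simp
qed

section \<open>Closure properties of smooth maps between sets of matrices\<close>

lemma of_real_smult_mult:
  fixes B C :: "'a::real_algebra_1 mat"
  assumes "dim_col C = dim_row B"
  shows "C * (of_real r \<cdot>\<^sub>m B) = of_real r \<cdot>\<^sub>m (C * B)"
  using assms
  by (intro eq_matI) (auto simp: index_mult_mat_sum sum_distrib_left simp flip: scaleR_conv_of_real simp del: index_mult_mat(1))

lemma of_real_mult_smult:
  fixes B C :: "'a::real_algebra_1 mat"
  assumes "dim_col B = dim_row C"
  shows "(of_real r \<cdot>\<^sub>m B) * C = of_real r \<cdot>\<^sub>m (B * C)"
  using assms
  by (intro eq_matI) (auto simp: index_mult_mat_sum sum_distrib_left mult.assoc simp del: index_mult_mat(1))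

lemma Ck_on_Suc_imp: "Ck_on (Suc m) r c r' c' U f \<Longrightarrow> Ck_on m r c r' c' U f"
  by (induction m arbitrary: f) (simp, metis Ck_on.simps(2))

lemma Ck_on_imp_continuous:
  "Ck_on m r c r' c' U f \<Longrightarrow> continuous_map (subtopology (mat_topology r c) U) (mat_topology r' c') f"
  by (cases m) auto

lemma Ck_on_carrier:
  assumes "Ck_on m r c r' c' U f" "U \<subseteq> carrier_mat r c" "M \<in> U"
  shows "f M \<in> carrier_mat r' c'"
  using Ck_on_imp_continuous[OF assms(1)] assms(2,3) by (auto simp: continuous_map_mat_topology)

text \<open>The directional derivatives in \<open>Ck_on\<close> are those of the curves \<open>f (M + t H)\<close>.\<close>

definition mat_deriv :: "nat \<Rightarrow> nat \<Rightarrow> (real \<Rightarrow> 'a::real_normed_vector mat) \<Rightarrow> 'a mat \<Rightarrow> bool" where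
  "mat_deriv r c f D \<longleftrightarrow> (\<forall>i<r. \<forall>j<c. ((\<lambda>t. f t $$ (i, j)) has_vector_derivative D $$ (i, j)) (at 0))"

lemma Ck_on_Suc_deriv:
  "Ck_on (Suc m) r c r' c' U f \<longleftrightarrow>
     continuous_map (subtopology (mat_topology r c) U) (mat_topology r' c') f \<and>
     (\<forall>H\<in>carrier_mat r c. \<exists>g. (\<forall>M\<in>U. mat_deriv r' c' (\<lambda>t. f (M + of_real t \<cdot>\<^sub>m H)) (g M)) \<and>
        Ck_on m r c r' c' U g)"
  by (simp add: mat_deriv_def)

lemma line_at_0: "M \<in> carrier_mat r c \<Longrightarrow> H \<in> carrier_mat r c \<Longrightarrow> 
    M + of_real 0 \<cdot>\<^sub>m H = (M::'a::real_algebra_1 mat)"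
  by (intro eq_matI) auto

lemma open_line:
  fixes M :: "'a::real_normed_algebra_1 mat"
  assumes "openin (mat_topology r c) U" "M \<in> carrier_mat r c" "H \<in> carrier_mat r c"
  shows "open {t::real. M + of_real t \<cdot>\<^sub>m H \<in> U}"
proof -
  have "continuous_map euclidean (mat_topology r c) (\<lambda>t::real. M + of_real t \<cdot>\<^sub>m H)"
    unfolding continuous_map_mat_topology
  proof (intro conjI allI impI ballI)
    fix i j assume "i < r" "j < c"
    then have "(M + of_real t \<cdot>\<^sub>m H) $$ (i, j) = M $$ (i, j) + of_real t * H $$ (i, j)" for t :: real
      using assms by auto
    then show "continuous_map euclidean euclidean (\<lambda>t::real. (M + of_real t \<cdot>\<^sub>m H) $$ (i, j))"
      by (simp, intro continuous_intros)
  qed (use assms in auto)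
  from openin_continuous_map_preimage[OF this assms(1)] show ?thesis by simp
qed

lemma eventually_line:
  fixes M :: "'a::real_normed_algebra_1 mat"
  assumes "openin (mat_topology r c) U" "M \<in> U" "H \<in> carrier_mat r c"
  shows "\<forall>\<^sub>F t::real in nhds 0. M + of_real t \<cdot>\<^sub>m H \<in> U"
proof -
  have "M \<in> carrier_mat r c" using openin_subset[OF assms(1)] assms(2) by auto
  then show ?thesis
    using open_line[OF assms(1) _ assms(3)] line_at_0[OF _ assms(3)] assms(2)
    by (intro eventually_nhds_in_open[of "{t. M + of_real t \<cdot>\<^sub>m H \<in> U}" "0::real", simplified]) auto
qed

lemma mat_deriv_cong:
  assumes "mat_deriv r c f D" "\<forall>\<^sub>F t in nhds 0. f t = g t"
  shows "mat_deriv r c g D"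
  unfolding mat_deriv_def
proof (intro allI impI)
  fix i j assume "i < r" "j < c"
  obtain S where S: "open S" "0 \<in> S" "\<And>t. t \<in> S \<Longrightarrow> f t = g t"
    using assms(2) by (auto simp: eventually_nhds)
  show "((\<lambda>t. g t $$ (i, j)) has_vector_derivative D $$ (i, j)) (at 0)"
  proof (rule has_vector_derivative_transform_within_open[OF _ S(1,2)])
    show "((\<lambda>t. f t $$ (i, j)) has_vector_derivative D $$ (i, j)) (at 0)"
      using assms(1) \<open>i < r\<close> \<open>j < c\<close> unfolding mat_deriv_def by blast
    show "f t $$ (i, j) = g t $$ (i, j)" if "t \<in> S" for t
      using S(3)[OF that] by simp
  qed
qed

lemma mat_deriv_tendsto:
  "mat_deriv r c f D \<Longrightarrow> mat_tendsto r c f (f 0) (at 0)"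
  by (auto simp: mat_deriv_def mat_tendsto_def dest!: has_vector_derivative_continuous continuous_within[THEN iffD1])

text \<open>The form as a limit of a difference quotient allows the algebra of matrices to be applied to the
  quotient as a whole.\<close>

lemma mat_deriv_iff_tendsto:
  assumes "\<forall>\<^sub>F t in at 0. f t \<in> carrier_mat r c" "f 0 \<in> carrier_mat r c"
  shows "mat_deriv r c f D \<longleftrightarrow>
    mat_tendsto r c (\<lambda>t. of_real (inverse t) \<cdot>\<^sub>m (f t + - f 0)) (D::'a::real_normed_algebra_1 mat) (at 0)"
  unfolding mat_deriv_def mat_tendsto_def
proof (intro all_cong imp_cong refl)
  fix i j assume ij: "i < r" "j < c"
  have "((\<lambda>t. f t $$ (i, j)) has_vector_derivative D $$ (i, j)) (at 0) \<longleftrightarrow>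
      ((\<lambda>t. inverse t *\<^sub>R (f t $$ (i, j) - f 0 $$ (i, j))) \<longlongrightarrow> D $$ (i, j)) (at 0)"
    unfolding has_vector_derivative_def has_derivative_at
  proof -
    let ?f = "\<lambda>t. f t $$ (i, j)" and ?D = "D $$ (i, j)"
    have "((\<lambda>h. norm (?f (0 + h) - ?f 0 - h *\<^sub>R ?D) / norm h) \<longlongrightarrow> 0) (at 0) \<longleftrightarrow>
      ((\<lambda>h. norm (inverse h *\<^sub>R (?f h - ?f 0) - ?D)) \<longlongrightarrow> 0) (at 0)"
    proof (rule tendsto_cong)
      show "\<forall>\<^sub>F h in at 0. norm (?f (0 + h) - ?f 0 - h *\<^sub>R ?D) / norm h = norm (inverse h *\<^sub>R (?f h - ?f 0) - ?D)"
        unfolding eventually_at_filter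
      proof (intro always_eventually allI impI)
        fix h :: real assume "h \<noteq> 0"
        then have "inverse h *\<^sub>R (?f h - ?f 0) - ?D = inverse h *\<^sub>R (?f (0 + h) - ?f 0 - h *\<^sub>R ?D)"
          by (simp add: scaleR_diff_right)
        then show "norm (?f (0 + h) - ?f 0 - h *\<^sub>R ?D) / norm h = norm (inverse h *\<^sub>R (?f h - ?f 0) - ?D)"
          by (simp only: norm_scaleR) (simp add: divide_inverse)
      qed
    qed
    then show "(bounded_linear (\<lambda>x. x *\<^sub>R ?D) \<and> ((\<lambda>h. norm (?f (0 + h) - ?f 0 - h *\<^sub>R ?D) / norm h) \<longlongrightarrow> 0) (at 0)) \<longleftrightarrow>
      ((\<lambda>t. inverse t *\<^sub>R (?f t - ?f 0)) \<longlongrightarrow> ?D) (at 0)"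
      by (simp add: bounded_linear_scaleR_left tendsto_norm_zero_iff LIM_zero_iff)
  qed
  also have "\<dots> \<longleftrightarrow> ((\<lambda>t. (of_real (inverse t) \<cdot>\<^sub>m (f t + - f 0)) $$ (i, j)) \<longlongrightarrow> D $$ (i, j)) (at 0)"
  proof (rule tendsto_cong)
    show "\<forall>\<^sub>F t in at 0. inverse t *\<^sub>R (f t $$ (i, j) - f 0 $$ (i, j)) = (of_real (inverse t) \<cdot>\<^sub>m (f t + - f 0)) $$ (i, j)"
      using assms(1) by eventually_elim (use assms(2) ij in \<open>auto simp: scaleR_conv_of_real\<close>)
  qed
  finally show "((\<lambda>t. f t $$ (i, j)) has_vector_derivative D $$ (i, j)) (at 0) \<longleftrightarrow>
      ((\<lambda>t. (of_real (inverse t) \<cdot>\<^sub>m (f t + - f 0)) $$ (i, j)) \<longlongrightarrow> D $$ (i, j)) (at 0)" .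
qed

lemma mat_deriv_add:
  assumes "mat_deriv r c f D" "mat_deriv r c g E"
    "\<forall>\<^sub>F t in nhds 0. f t \<in> carrier_mat r c" "\<forall>\<^sub>F t in nhds 0. g t \<in> carrier_mat r c"
    "D \<in> carrier_mat r c" "E \<in> carrier_mat r c"
  shows "mat_deriv r c (\<lambda>t. f t + g t) (D + E)"
proof (rule mat_deriv_cong)
  show "mat_deriv r c (\<lambda>t. Matrix.mat r c (\<lambda>(i, j). f t $$ (i, j) + g t $$ (i, j))) (D + E)"
    using assms(1,2,5,6) by (auto simp: mat_deriv_def intro!: has_vector_derivative_add)
  show "\<forall>\<^sub>F t in nhds 0. Matrix.mat r c (\<lambda>(i, j). f t $$ (i, j) + g t $$ (i, j)) = f t + g t"
    using assms(3,4) by eventually_elim (intro eq_matI, auto)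
qed

lemma mat_deriv_mult:
  fixes f g :: "real \<Rightarrow> 'a::real_normed_algebra mat"
  assumes "mat_deriv r l f D" "mat_deriv l c g E"
    "\<forall>\<^sub>F t in nhds 0. f t \<in> carrier_mat r l" "\<forall>\<^sub>F t in nhds 0. g t \<in> carrier_mat l c"
    "D \<in> carrier_mat r l" "E \<in> carrier_mat l c"
  shows "mat_deriv r c (\<lambda>t. f t * g t) (f 0 * E + D * g 0)"
proof (rule mat_deriv_cong)
  have f0: "f 0 \<in> carrier_mat r l" "g 0 \<in> carrier_mat l c"
    using assms(3,4) by (auto dest: eventually_nhds_x_imp_x)
  show "mat_deriv r c (\<lambda>t. Matrix.mat r c (\<lambda>(i, j). \<Sum>a<l. f t $$ (i, a) * g t $$ (a, j))) (f 0 * E + D * g 0)"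
    unfolding mat_deriv_def
  proof (intro allI impI)
    fix i j assume ij: "i < r" "j < c"
    have "((\<lambda>t. \<Sum>a<l. f t $$ (i, a) * g t $$ (a, j)) has_vector_derivative
        (\<Sum>a<l. f 0 $$ (i, a) * E $$ (a, j) + D $$ (i, a) * g 0 $$ (a, j))) (at 0)"
      using assms(1,2) ij by (intro has_vector_derivative_sum has_vector_derivative_mult) (auto simp: mat_deriv_def)
    also have "(\<Sum>a<l. f 0 $$ (i, a) * E $$ (a, j) + D $$ (i, a) * g 0 $$ (a, j)) = (f 0 * E + D * g 0) $$ (i, j)"
      using ij assms(5,6) f0 
      by (auto simp: sum.distrib index_mult_mat_sum simp del: index_mult_mat(1))
    finally show "((\<lambda>t. Matrix.mat r c (\<lambda>(i, j). \<Sum>a<l. f t $$ (i, a) * g t $$ (a, j)) $$ (i, j)) has_vector_derivative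
        (f 0 * E + D * g 0) $$ (i, j)) (at 0)"
      using ij by simp
  qed
  show "\<forall>\<^sub>F t in nhds 0. Matrix.mat r c (\<lambda>(i, j). \<Sum>a<l. f t $$ (i, a) * g t $$ (a, j)) = f t * g t"
    using assms(3,4)
    by eventually_elim (intro eq_matI, auto simp: index_mult_mat_sum simp del: index_mult_mat(1))
qed

lemma mat_deriv_adj:
  fixes f :: "real \<Rightarrow> 'a::conj_div_algebra mat"
  assumes "mat_deriv r c f D" "\<forall>\<^sub>F t in nhds 0. f t \<in> carrier_mat r c" "D \<in> carrier_mat r c"
  shows "mat_deriv c r (\<lambda>t. adj (f t)) (adj D)"
proof (rule mat_deriv_cong)
  show "mat_deriv c r (\<lambda>t. Matrix.mat c r (\<lambda>(i, j). conjugate (f t $$ (j, i)))) (adj D)"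
    using assms(1,3)
    by (auto simp: mat_deriv_def index_adj intro!: bounded_linear.has_vector_derivative[OF bounded_linear_conjugate])
  show "\<forall>\<^sub>F t in nhds 0. Matrix.mat c r (\<lambda>(i, j). conjugate (f t $$ (j, i))) = adj (f t)"
    using assms(2) by eventually_elim (intro eq_matI, auto simp: index_adj)
qed

text \<open>This is \<open>(f\<inverse>)' = - f\<inverse> f' f\<inverse>\<close>. It is the limit of
  \<open>f(t)\<inverse> - f(0)\<inverse> = - f(t)\<inverse> (f(t) - f(0)) f(0)\<inverse>\<close>, divided by
  \<open>t\<close>.\<close>

lemma mat_deriv_inv:
  fixes f :: "real \<Rightarrow> 'a::real_normed_div_algebra mat"
  assumes f: "mat_deriv n n f D" "\<forall>\<^sub>F t in nhds 0. f t \<in> carrier_mat n n"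
    and D: "D \<in> carrier_mat n n" and inv: "\<forall>\<^sub>F t in nhds 0. invertible_mat (f t)"
  shows "mat_deriv n n (\<lambda>t. mat_inv (f t)) (- (mat_inv (f 0) * (D * mat_inv (f 0))))"
proof -
  have c0: "f 0 \<in> carrier_mat n n" and i0: "invertible_mat (f 0)"
    using f(2) inv by (auto dest: eventually_nhds_x_imp_x)
  note I0 = mat_inv[OF i0 c0]
  have ca: "\<forall>\<^sub>F t in at 0. f t \<in> carrier_mat n n" and ia: "\<forall>\<^sub>F t in at 0. invertible_mat (f t)"
    using f(2) inv by (auto simp: eventually_at_filter elim: eventually_mono)
  define q where "q t = of_real (inverse t) \<cdot>\<^sub>m (f t + - f 0)" for t
  have q: "mat_tendsto n n q D (at 0)"
    using f(1) mat_deriv_iff_tendsto[OF ca c0] by (simp add: q_def [abs_def])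
  have ica: "\<forall>\<^sub>F t in at 0. mat_inv (f t) \<in> carrier_mat n n"
    using ca ia by eventually_elim (rule mat_inv)
  have qc: "q t \<in> carrier_mat n n" for t using c0 by (auto simp: q_def)
  have "mat_tendsto n n (\<lambda>t. mat_inv (f t)) (mat_inv (f 0)) (at 0)"
    by (rule mat_tendsto_inv(2)[OF mat_deriv_tendsto[OF f(1)] ca c0 i0])
  moreover have "mat_tendsto n n (\<lambda>t. - (q t * mat_inv (f 0))) (- (D * mat_inv (f 0))) (at 0)"
  proof -
    have "mat_tendsto n n (\<lambda>t. q t * mat_inv (f 0)) (D * mat_inv (f 0)) (at 0)"
      by (rule mat_tendsto_mult[OF q]) (use qc D I0 in \<open>auto simp: mat_tendsto_def intro!: always_eventually\<close>)
    then show ?thesis using qc D I0(1)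
      by (auto simp: mat_tendsto_def carrier_matD[OF qc] intro!: tendsto_minus simp del: index_mult_mat(1))
  qed
  ultimately have "mat_tendsto n n (\<lambda>t. mat_inv (f t) * - (q t * mat_inv (f 0))) (mat_inv (f 0) * - (D * mat_inv (f 0))) (at 0)"
    by (rule mat_tendsto_mult)
      (use ica D I0 mult_carrier_mat[OF qc I0(1)] in \<open>auto intro!: always_eventually\<close>)
  then have "mat_tendsto n n (\<lambda>t. of_real (inverse t) \<cdot>\<^sub>m (mat_inv (f t) + - mat_inv (f 0)))
      (mat_inv (f 0) * - (D * mat_inv (f 0))) (at 0)"
  proof (rule mat_tendsto_cong[rotated])
    show "\<forall>\<^sub>F t in at 0. mat_inv (f t) * - (q t * mat_inv (f 0)) = of_real (inverse t) \<cdot>\<^sub>m (mat_inv (f t) + - mat_inv (f 0))"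
      using ca ia
    proof eventually_elim
      case (elim t)
      note I = mat_inv[OF elim(2,1)]
      have "(f t + - f 0) * mat_inv (f 0) = f t * mat_inv (f 0) + - 1\<^sub>m n"
        using elim(1) c0 I0 by (simp add: add_mult_dim uminus_mult_dim)
      then have "mat_inv (f t) * ((f t + - f 0) * mat_inv (f 0)) = mat_inv (f t) * f t * mat_inv (f 0) + - mat_inv (f t)"
        using elim(1) c0 I0(1) I(1) by (simp add: mult_add_dim mult_assoc_dim uminus_mult_dim)
      then have *: "mat_inv (f t) * ((f t + - f 0) * mat_inv (f 0)) = mat_inv (f 0) + - mat_inv (f t)"
        using I I0 by simp
      have "q t * mat_inv (f 0) = of_real (inverse t) \<cdot>\<^sub>m ((f t + - f 0) * mat_inv (f 0))"
        unfolding q_def using elim(1) c0 I0(1) by (intro of_real_mult_smult) auto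
      then have "mat_inv (f t) * (q t * mat_inv (f 0)) = of_real (inverse t) \<cdot>\<^sub>m (mat_inv (f 0) + - mat_inv (f t))"
        using of_real_smult_mult[of "mat_inv (f t)" "(f t + - f 0) * mat_inv (f 0)" "inverse t"]
          elim(1) c0 I0(1) I(1) * by simp
      moreover have "- (of_real (inverse t) \<cdot>\<^sub>m (mat_inv (f 0) + - mat_inv (f t)))
          = of_real (inverse t) \<cdot>\<^sub>m (mat_inv (f t) + - mat_inv (f 0))"
        using I(1) I0(1) by (intro eq_matI) (auto simp: algebra_simps)
      ultimately show ?case
        using I(1) I0(1) qc[of t] by (simp add: uminus_mult_dim)
    qed
  qed
  then show ?thesis
    using mat_deriv_iff_tendsto[OF ica I0(1)] D I0(1) by (simp add: uminus_mult_dim)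
qed

context
  fixes r c :: nat and U :: "'a::conj_div_algebra mat set"
  assumes U: "openin (mat_topology r c) U"
begin

lemma U_subset: "U \<subseteq> carrier_mat r c"
  using openin_subset[OF U] by simp

lemma eventually_line_carrier:
  assumes "Ck_on m r c r' c' U f" "M \<in> U" "H \<in> carrier_mat r c"
  shows "\<forall>\<^sub>F t::real in nhds 0. f (M + of_real t \<cdot>\<^sub>m H) \<in> carrier_mat r' c'"
  using eventually_line[OF U assms(2,3)]
  by eventually_elim (rule Ck_on_carrier[OF assms(1) U_subset])

lemma Ck_on_const: "C \<in> carrier_mat r' c' \<Longrightarrow> Ck_on m r c r' c' U (\<lambda>_. C)"
proof (induction m arbitrary: C)
  case (Suc m)
  have "mat_deriv r' c' (\<lambda>t. C) (0\<^sub>m r' c')"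
    by (auto simp: mat_deriv_def)
  with Suc show ?case unfolding Ck_on_Suc_deriv
    by (auto simp: continuous_map_mat_topology intro!: exI[of _ "\<lambda>_. 0\<^sub>m r' c'"])
qed (auto simp: continuous_map_mat_topology)

lemma Ck_on_id: "Ck_on m r c r c U (\<lambda>M. M)"
proof (cases m)
  case 0
  then show ?thesis by (simp add: continuous_map_from_subtopology)
next
  case (Suc m')
  have "mat_deriv r c (\<lambda>t. M + of_real t \<cdot>\<^sub>m H) H" if "M \<in> U" "H \<in> carrier_mat r c" for M H
  proof -
    have "M \<in> carrier_mat r c" using that U_subset by auto
    then show ?thesis using that(2)
      by (auto simp: mat_deriv_def intro!: derivative_eq_intros simp flip: scaleR_conv_of_real)
  qed
  then show ?thesis unfolding Suc Ck_on_Suc_deriv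
    by (auto simp: continuous_map_from_subtopology intro!: Ck_on_const exI[of _ "\<lambda>_. _"])
qed

text \<open>The derivative at a point of \<open>U\<close> only depends on values in \<open>U\<close>, because
  \<open>U\<close> is open.\<close>

lemma Ck_on_cong:
  assumes "\<And>M. M \<in> U \<Longrightarrow> f M = g M" "Ck_on m r c r' c' U f"
  shows "Ck_on m r c r' c' U g"
proof -
  have cont: "continuous_map (subtopology (mat_topology r c) U) (mat_topology r' c') g"
    by (rule continuous_map_eq[OF Ck_on_imp_continuous[OF assms(2)]]) (use assms(1) in auto)
  show ?thesis
  proof (cases m)
    case 0
    with cont show ?thesis by simp
  next
    case (Suc m')
    show ?thesis unfolding Suc Ck_on_Suc_deriv
    proof (intro conjI cont ballI)
      fix H :: "'a mat" assume H: "H \<in> carrier_mat r c"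
      obtain h where h: "\<And>M. M \<in> U \<Longrightarrow> mat_deriv r' c' (\<lambda>t. f (M + of_real t \<cdot>\<^sub>m H)) (h M)"
        "Ck_on m' r c r' c' U h"
        using assms(2) H unfolding Suc Ck_on_Suc_deriv by blast
      have "mat_deriv r' c' (\<lambda>t. g (M + of_real t \<cdot>\<^sub>m H)) (h M)" if "M \<in> U" for M
        by (rule mat_deriv_cong[OF h(1)[OF that]])
          (use eventually_line[OF U that H] in eventually_elim, rule assms(1))
      with h(2) show "\<exists>h. (\<forall>M\<in>U. mat_deriv r' c' (\<lambda>t. g (M + of_real t \<cdot>\<^sub>m H)) (h M)) \<and> Ck_on m' r c r' c' U h"
        by blast
    qed
  qed
qed

lemma Ck_on_add:
  "Ck_on m r c r' c' U f \<Longrightarrow> Ck_on m r c r' c' U g \<Longrightarrow> Ck_on m r c r' c' U (\<lambda>M. f M + g M)"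
proof (induction m arbitrary: f g)
  case (Suc m)
  show ?case unfolding Ck_on_Suc_deriv
  proof (intro conjI ballI)
    fix H :: "'a mat" assume H: "H \<in> carrier_mat r c"
    obtain f' where f': "\<And>M. M \<in> U \<Longrightarrow> mat_deriv r' c' (\<lambda>t. f (M + of_real t \<cdot>\<^sub>m H)) (f' M)" "Ck_on m r c r' c' U f'"
      using Suc.prems(1) H unfolding Ck_on_Suc_deriv by blast
    obtain g' where g': "\<And>M. M \<in> U \<Longrightarrow> mat_deriv r' c' (\<lambda>t. g (M + of_real t \<cdot>\<^sub>m H)) (g' M)" "Ck_on m r c r' c' U g'"
      using Suc.prems(2) H unfolding Ck_on_Suc_deriv by blast
    have deriv: "mat_deriv r' c' (\<lambda>t. f (M + of_real t \<cdot>\<^sub>m H) + g (M + of_real t \<cdot>\<^sub>m H)) (f' M + g' M)" if M: "M \<in> U" for M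
      by (rule mat_deriv_add[OF f'(1)[OF M] g'(1)[OF M]])
        (rule eventually_line_carrier[OF Suc.prems(1) M H] eventually_line_carrier[OF Suc.prems(2) M H]
          Ck_on_carrier[OF f'(2) U_subset M] Ck_on_carrier[OF g'(2) U_subset M])+
    show "\<exists>h. (\<forall>M\<in>U. mat_deriv r' c' (\<lambda>t. f (M + of_real t \<cdot>\<^sub>m H) + g (M + of_real t \<cdot>\<^sub>m H)) (h M)) \<and> Ck_on m r c r' c' U h"
      by (intro exI[of _ "\<lambda>M. f' M + g' M"] conjI ballI deriv Suc.IH f'(2) g'(2))
  qed (intro continuous_map_mat_add Ck_on_imp_continuous[OF Suc.prems(1)] Ck_on_imp_continuous[OF Suc.prems(2)])
qed (simp add: continuous_map_mat_add)

text \<open>Induction on the order by the product rule: the derivative is built from the factors, which are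
  also of the lower order, and from their derivatives.\<close>

lemma Ck_on_mult:
  "Ck_on m r c r' l U f \<Longrightarrow> Ck_on m r c l c' U g \<Longrightarrow> Ck_on m r c r' c' U (\<lambda>M. f M * g M)"
proof (induction m arbitrary: f g)
  case (Suc m)
  note f = Ck_on_Suc_imp[OF Suc.prems(1)] and g = Ck_on_Suc_imp[OF Suc.prems(2)]
  show ?case unfolding Ck_on_Suc_deriv
  proof (intro conjI ballI)
    fix H :: "'a mat" assume H: "H \<in> carrier_mat r c"
    obtain f' where f': "\<And>M. M \<in> U \<Longrightarrow> mat_deriv r' l (\<lambda>t. f (M + of_real t \<cdot>\<^sub>m H)) (f' M)" "Ck_on m r c r' l U f'"
      using Suc.prems(1) H unfolding Ck_on_Suc_deriv by blast
    obtain g' where g': "\<And>M. M \<in> U \<Longrightarrow> mat_deriv l c' (\<lambda>t. g (M + of_real t \<cdot>\<^sub>m H)) (g' M)" "Ck_on m r c l c' U g'"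
      using Suc.prems(2) H unfolding Ck_on_Suc_deriv by blast
    have deriv: "mat_deriv r' c' (\<lambda>t. f (M + of_real t \<cdot>\<^sub>m H) * g (M + of_real t \<cdot>\<^sub>m H)) (f M * g' M + f' M * g M)"
      if M: "M \<in> U" for M
    proof -
      have "M + of_real 0 \<cdot>\<^sub>m H = M" using line_at_0[OF _ H] M U_subset by blast
      then show ?thesis
        using mat_deriv_mult[OF f'(1)[OF M] g'(1)[OF M] eventually_line_carrier[OF f M H]
          eventually_line_carrier[OF g M H] Ck_on_carrier[OF f'(2) U_subset M] Ck_on_carrier[OF g'(2) U_subset M]]
        by simp
    qed
    show "\<exists>h. (\<forall>M\<in>U. mat_deriv r' c' (\<lambda>t. f (M + of_real t \<cdot>\<^sub>m H) * g (M + of_real t \<cdot>\<^sub>m H)) (h M)) \<and> Ck_on m r c r' c' U h"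
      by (intro exI[of _ "\<lambda>M. f M * g' M + f' M * g M"] conjI ballI deriv Ck_on_add Suc.IH f g f'(2) g'(2))
  qed (intro continuous_map_mat_mult[where l = l] Ck_on_imp_continuous[OF Suc.prems(1)] Ck_on_imp_continuous[OF Suc.prems(2)])
qed (simp add: continuous_map_mat_mult)

lemma Ck_on_uminus:
  assumes "Ck_on m r c r' c' U f"
  shows "Ck_on m r c r' c' U (\<lambda>M. - f M)"
proof (rule Ck_on_cong)
  show "Ck_on m r c r' c' U (\<lambda>M. - 1\<^sub>m r' * f M)"
    by (intro Ck_on_mult[where l = r'] assms Ck_on_const) simp
  show "- 1\<^sub>m r' * f M = - f M" if "M \<in> U" for M
    using Ck_on_carrier[OF assms U_subset that] by (simp add: uminus_mult_dim)
qed

lemma Ck_on_adj: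
  "Ck_on m r c r' c' U f \<Longrightarrow> Ck_on m r c c' r' U (\<lambda>M. adj (f M))"
proof (induction m arbitrary: f)
  case (Suc m)
  show ?case unfolding Ck_on_Suc_deriv
  proof (intro conjI ballI)
    fix H :: "'a mat" assume H: "H \<in> carrier_mat r c"
    obtain f' where f': "\<And>M. M \<in> U \<Longrightarrow> mat_deriv r' c' (\<lambda>t. f (M + of_real t \<cdot>\<^sub>m H)) (f' M)" "Ck_on m r c r' c' U f'"
      using Suc.prems(1) H unfolding Ck_on_Suc_deriv by blast
    have deriv: "mat_deriv c' r' (\<lambda>t. adj (f (M + of_real t \<cdot>\<^sub>m H))) (adj (f' M))" if M: "M \<in> U" for M
      by (rule mat_deriv_adj[OF f'(1)[OF M] eventually_line_carrier[OF Suc.prems M H] Ck_on_carrier[OF f'(2) U_subset M]])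
    show "\<exists>h. (\<forall>M\<in>U. mat_deriv c' r' (\<lambda>t. adj (f (M + of_real t \<cdot>\<^sub>m H))) (h M)) \<and> Ck_on m r c c' r' U h"
      by (intro exI[of _ "\<lambda>M. adj (f' M)"] conjI ballI deriv Suc.IH f'(2))
  qed (intro continuous_map_adj Ck_on_imp_continuous[OF Suc.prems(1)])
qed (simp add: continuous_map_adj)

text \<open>By \<open>mat_deriv_inv\<close>, the derivative of the inverse is a product of the inverse and of
  the derivative of \<open>f\<close>. So one order of differentiability for \<open>f\<close> lifts that of the
  inverse by one order, starting from continuity.\<close>

lemma Ck_on_mat_inv:
  assumes inv: "\<And>M. M \<in> U \<Longrightarrow> invertible_mat (f M)"
  shows "Ck_on m r c n n U f \<Longrightarrow> Ck_on m r c n n U (\<lambda>M. mat_inv (f M))"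
proof (induction m)
  case 0
  then show ?case using inv by (simp, intro continuous_map_mat_inv) auto
next
  case (Suc m)
  note f = Ck_on_Suc_imp[OF Suc.prems]
  show ?case unfolding Ck_on_Suc_deriv
  proof (intro conjI ballI)
    show "continuous_map (subtopology (mat_topology r c) U) (mat_topology n n) (\<lambda>M. mat_inv (f M))"
      using inv by (intro continuous_map_mat_inv Ck_on_imp_continuous[OF Suc.prems]) auto
    fix H :: "'a mat" assume H: "H \<in> carrier_mat r c"
    obtain f' where f': "\<And>M. M \<in> U \<Longrightarrow> mat_deriv n n (\<lambda>t. f (M + of_real t \<cdot>\<^sub>m H)) (f' M)" "Ck_on m r c n n U f'"
      using Suc.prems(1) H unfolding Ck_on_Suc_deriv by blast
    have deriv: "mat_deriv n n (\<lambda>t. mat_inv (f (M + of_real t \<cdot>\<^sub>m H))) (- (mat_inv (f M) * (f' M * mat_inv (f M))))"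
      if M: "M \<in> U" for M
    proof -
      have M0: "M + of_real 0 \<cdot>\<^sub>m H = M" using line_at_0[OF _ H] M U_subset by blast
      have "\<forall>\<^sub>F t::real in nhds 0. invertible_mat (f (M + of_real t \<cdot>\<^sub>m H))"
        using eventually_line[OF U M H] by eventually_elim (rule inv)
      from mat_deriv_inv[OF f'(1)[OF M] eventually_line_carrier[OF f M H] Ck_on_carrier[OF f'(2) U_subset M] this]
      show ?thesis unfolding M0 .
    qed
    show "\<exists>h. (\<forall>M\<in>U. mat_deriv n n (\<lambda>t. mat_inv (f (M + of_real t \<cdot>\<^sub>m H))) (h M)) \<and> Ck_on m r c n n U h"
      by (intro exI[of _ "\<lambda>M. - (mat_inv (f M) * (f' M * mat_inv (f M)))"] conjI ballI deriv
          Ck_on_uminus Ck_on_mult[where l = n] Suc.IH f f'(2))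
  qed
qed

end

section \<open>Block matrices\<close>

definition top_incl :: "nat \<Rightarrow> nat \<Rightarrow> 'a::{zero,one} mat" where
  "top_incl n k = Matrix.mat n (n - k) (\<lambda>(i, j). if i = j then 1 else 0)"

definition bot_incl :: "nat \<Rightarrow> nat \<Rightarrow> 'a::{zero,one} mat" where
  "bot_incl n k = Matrix.mat n k (\<lambda>(i, j). if i = n - k + j then 1 else 0)"

lemma sum_delta_left:
  "(\<Sum>l<m. (if l = i then 1 else 0) * f l) = (if i < (m::nat) then f i else (0::'a::semiring_1))"
  "(\<Sum>l<m. (if i = l then 1 else 0) * f l) = (if i < (m::nat) then f i else (0::'a::semiring_1))"
  "(\<Sum>l<m. f l * (if l = i then 1 else 0)) = (if i < (m::nat) then f i else (0::'a::semiring_1))"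
  by (simp_all add: if_distrib[of "\<lambda>x. x * _"] if_distrib[of "\<lambda>x. _ * x"] cong: if_cong)

lemma adj_smult: "adj (of_real r \<cdot>\<^sub>m B) = of_real r \<cdot>\<^sub>m adj (B::'a::conj_div_algebra mat)"
  by (intro eq_matI) (auto simp: index_adj conjugate_scaleR simp flip: scaleR_conv_of_real)

text \<open>For a column \<open>q \<noteq> 0\<close>, the only entry of \<open>q\<^sup>* q\<close> is
  nonzero.\<close>

lemma mult_adj_self_cancel:
  fixes q :: "'a::conj_div_algebra mat"
  assumes q: "q \<in> carrier_mat k 1" "q \<noteq> 0\<^sub>m k 1"
    and B: "B \<in> carrier_mat m 1" "B * (adj q * q) = 0\<^sub>m m 1"
  shows "B = 0\<^sub>m m 1"
proof -
  let ?r = "(adj q * q) $$ (0, 0)"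
  have "?r \<noteq> 0"
  proof
    assume "?r = 0"
    then have "adj q * q + adj q * q = 0\<^sub>m (dim_col q) (dim_col q)"
      using q by (intro eq_matI) (auto simp del: index_mult_mat(1))
    with q show False using add_adj_mult_self_eq_0[of q] by simp
  qed
  show ?thesis
  proof (rule eq_matI)
    fix i j assume "i < dim_row (0\<^sub>m m 1 :: 'a mat)" "j < dim_col (0\<^sub>m m 1 :: 'a mat)"
    then have ij: "i < m" "j = 0" by auto
    have "B $$ (i, 0) * ?r = (B * (adj q * q)) $$ (i, 0)"
      using B q ij by (subst (2) index_mult_mat_sum) (auto simp del: index_mult_mat(1))
    then show "B $$ (i, j) = 0\<^sub>m m 1 $$ (i, j)" using B(2) ij \<open>?r \<noteq> 0\<close> by simp
  qed (use B in auto)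
qed

lemma double_eq_0:
  fixes M :: "'a::real_vector mat"
  assumes "M + M = 0\<^sub>m r c" "M \<in> carrier_mat r c"
  shows "M = 0\<^sub>m r c"
proof (rule eq_matI)
  fix i j assume ij: "i < dim_row (0\<^sub>m r c :: 'a mat)" "j < dim_col (0\<^sub>m r c :: 'a mat)"
  then have "M $$ (i, j) + M $$ (i, j) = 0"
    using arg_cong[OF assms(1), of "\<lambda>M. M $$ (i, j)"] assms(2) by auto
  then have "2 *\<^sub>R M $$ (i, j) = 0" by (simp only: scaleR_2)
  then show "M $$ (i, j) = 0\<^sub>m r c $$ (i, j)" using ij by simp
qed (use assms in auto)

lemma invertible_iff_kernel:
  fixes M :: "'a::division_ring mat"
  assumes "M \<in> carrier_mat n n"
  shows "invertible_mat M \<longleftrightarrow> (\<forall>c\<in>carrier_mat n 1. M * c = 0\<^sub>m n 1 \<longrightarrow> c = 0\<^sub>m n 1)"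
  using invertible_of_inj[OF assms] mat_inv[OF _ assms] left_inverse_cancel[OF _ assms] by metis

lemma kernel_of_not_invertible:
  fixes M :: "'a::division_ring mat"
  assumes "M \<in> carrier_mat m m" "\<not> invertible_mat M"
  obtains q where "q \<in> carrier_mat m 1" "q \<noteq> 0\<^sub>m m 1" "M * q = 0\<^sub>m m 1"
  using assms invertible_iff_kernel by blast

text \<open>If \<open>z + W z = 0\<close>, then \<open>z\<^sup>* z + z\<^sup>* W z = 0\<close>; adding the
  adjoint of this equation cancels the skew term and gives \<open>2 z\<^sup>* z = 0\<close>.\<close>

lemma skew_plus_one_invertible:
  fixes W :: "'a::conj_div_algebra mat"
  assumes W: "W \<in> carrier_mat n n" and skew: "adj W = - W"
  shows "invertible_mat (1\<^sub>m n + W)"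
proof (rule invertible_of_inj)
  fix z :: "'a mat" assume z: "z \<in> carrier_mat n 1" and "(1\<^sub>m n + W) * z = 0\<^sub>m n 1"
  then have 0: "z + W * z = 0\<^sub>m n 1" using W by (simp add: add_mult_dim)
  have "adj z * (z + W * z) = 0\<^sub>m 1 1" unfolding 0 using z by simp
  then have a: "adj z * z + adj z * (W * z) = 0\<^sub>m 1 1" using z W by (simp add: mult_add_dim)
  then have "adj (adj z * z + adj z * (W * z)) = 0\<^sub>m 1 1" by simp
  then have b: "adj z * z + - (adj z * (W * z)) = 0\<^sub>m 1 1"
    using z W skew by (simp add: mat_ring)
  have "adj z * z + adj z * z = (adj z * z + adj z * (W * z)) + (adj z * z + - (adj z * (W * z)))"
    using z W by (intro eq_matI) (auto simp del: index_mult_mat(1))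
  also have "\<dots> = 0\<^sub>m 1 1" unfolding a b by simp
  finally show "z = 0\<^sub>m n 1" using add_adj_mult_self_eq_0[of z] z by simp
qed (use W in auto)

text \<open>With the two coordinate inclusions \<open>J\<^sub>1\<close> and \<open>J\<^sub>2\<close>, taking
  and assembling blocks becomes multiplication by fixed matrices, so that the identities between blocks and
  the smoothness of block operations reduce to those of products.\<close>

locale frame_blocks =
  fixes n k :: nat
  assumes kn: "k \<le> n"
begin

abbreviation J\<^sub>1 :: "'a::{zero,one} mat" where "J\<^sub>1 \<equiv> top_incl n k"
abbreviation J\<^sub>2 :: "'a::{zero,one} mat" where "J\<^sub>2 \<equiv> bot_incl n k"

lemma incl_carrier [simp]: "J\<^sub>1 \<in> carrier_mat n (n - k)" "J\<^sub>2 \<in> carrier_mat n k"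
  by (simp_all add: top_incl_def bot_incl_def)

lemma incl_dim [simp]: "dim_row J\<^sub>1 = n" "dim_col J\<^sub>1 = n - k" "dim_row J\<^sub>2 = n" "dim_col J\<^sub>2 = k"
  by (simp_all add: top_incl_def bot_incl_def)

lemma index_incl_left:
  fixes M :: "'a::conj_div_algebra mat"
  shows "M \<in> carrier_mat (n - k) c \<Longrightarrow> i < n \<Longrightarrow> j < c \<Longrightarrow> (J\<^sub>1 * M) $$ (i, j) = (if i < n - k then M $$ (i, j) else 0)"
    and "M \<in> carrier_mat k c \<Longrightarrow> i < n \<Longrightarrow> j < c \<Longrightarrow> (J\<^sub>2 * M) $$ (i, j) = (if i < n - k then 0 else M $$ (i - (n - k), j))"
    and "M \<in> carrier_mat n c \<Longrightarrow> i < n - k \<Longrightarrow> j < c \<Longrightarrow> (adj J\<^sub>1 * M) $$ (i, j) = M $$ (i, j)"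
    and "M \<in> carrier_mat n c \<Longrightarrow> i < k \<Longrightarrow> j < c \<Longrightarrow> (adj J\<^sub>2 * M) $$ (i, j) = M $$ (n - k + i, j)"
proof -
  show "(J\<^sub>1 * M) $$ (i, j) = (if i < n - k then M $$ (i, j) else 0)" if "M \<in> carrier_mat (n - k) c" "i < n" "j < c"
    using that by (subst index_mult_mat_sum) (auto simp: top_incl_def sum_delta_left)
  show "(adj J\<^sub>1 * M) $$ (i, j) = M $$ (i, j)" if "M \<in> carrier_mat n c" "i < n - k" "j < c"
    using that kn by (subst index_mult_mat_sum)
      (auto simp: top_incl_def index_adj if_distrib[of conjugate] sum_delta_left cong: if_cong)
  show "(adj J\<^sub>2 * M) $$ (i, j) = M $$ (n - k + i, j)" if "M \<in> carrier_mat n c" "i < k" "j < c"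
    using that kn by (subst index_mult_mat_sum)
      (auto simp: bot_incl_def index_adj if_distrib[of conjugate] sum_delta_left cong: if_cong)
  show "(J\<^sub>2 * M) $$ (i, j) = (if i < n - k then 0 else M $$ (i - (n - k), j))" if "M \<in> carrier_mat k c" "i < n" "j < c"
  proof -
    have "(J\<^sub>2 * M) $$ (i, j) = (\<Sum>l<k. (if i = n - k + l then 1 else 0) * M $$ (l, j))"
      using that by (subst index_mult_mat_sum) (auto simp: bot_incl_def)
    also have "\<dots> = (if i < n - k then 0 else \<Sum>l<k. (if l = i - (n - k) then 1 else 0) * M $$ (l, j))"
      by (auto intro!: sum.cong sum.neutral)
    finally show ?thesis using that by (auto simp: sum_delta_left)
  qed
qed

lemma index_incl_right:
  fixes M :: "'a::conj_div_algebra mat"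
  shows "M \<in> carrier_mat r n \<Longrightarrow> i < r \<Longrightarrow> j < n - k \<Longrightarrow> (M * J\<^sub>1) $$ (i, j) = M $$ (i, j)"
    and "M \<in> carrier_mat r n \<Longrightarrow> i < r \<Longrightarrow> j < k \<Longrightarrow> (M * J\<^sub>2) $$ (i, j) = M $$ (i, n - k + j)"
  using kn by (subst index_mult_mat_sum; auto simp: top_incl_def bot_incl_def sum_delta_left)+

lemma incl_orth [simp]:
  shows "adj J\<^sub>1 * J\<^sub>1 = (1\<^sub>m (n - k) :: 'a::conj_div_algebra mat)" "adj J\<^sub>2 * J\<^sub>2 = (1\<^sub>m k :: 'a mat)"
    "adj J\<^sub>1 * J\<^sub>2 = (0\<^sub>m (n - k) k :: 'a mat)" "adj J\<^sub>2 * J\<^sub>1 = (0\<^sub>m k (n - k) :: 'a mat)"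
  using kn
  by (intro eq_matI; simp add: index_incl_left(3,4)[OF incl_carrier(1)] index_incl_left(3,4)[OF incl_carrier(2)] del: index_mult_mat(1);
      auto simp: top_incl_def bot_incl_def)+

lemma incl_orth_mult [simp]:
  fixes M :: "'a::conj_div_algebra mat"
  shows "dim_row M = n - k \<Longrightarrow> adj J\<^sub>1 * (J\<^sub>1 * M) = M" "dim_row M = k \<Longrightarrow> adj J\<^sub>2 * (J\<^sub>2 * M) = M"
    "dim_row M = k \<Longrightarrow> adj J\<^sub>1 * (J\<^sub>2 * M) = 0\<^sub>m (n - k) (dim_col M)"
    "dim_row M = n - k \<Longrightarrow> adj J\<^sub>2 * (J\<^sub>1 * M) = 0\<^sub>m k (dim_col M)"
  by (simp_all flip: mult_assoc_dim)

lemma block_decomp: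
  fixes M :: "'a::conj_div_algebra mat"
  assumes "M \<in> carrier_mat n c"
  shows "J\<^sub>1 * (adj J\<^sub>1 * M) + J\<^sub>2 * (adj J\<^sub>2 * M) = M"
proof (rule eq_matI)
  have c: "adj J\<^sub>1 * M \<in> carrier_mat (n - k) c" "adj J\<^sub>2 * M \<in> carrier_mat k c" using assms by auto
  fix i j assume ij: "i < dim_row M" "j < dim_col M"
  then show "(J\<^sub>1 * (adj J\<^sub>1 * M) + J\<^sub>2 * (adj J\<^sub>2 * M)) $$ (i, j) = M $$ (i, j)"
    using assms kn index_incl_left(1)[OF c(1)] index_incl_left(2)[OF c(2)] index_incl_left(3,4)[OF assms]
    by (auto simp del: index_mult_mat(1))
qed (use assms in auto)

lemma block_eqI:
  fixes M N :: "'a::conj_div_algebra mat"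
  assumes "M \<in> carrier_mat n c" "N \<in> carrier_mat n c"
    "adj J\<^sub>1 * M = adj J\<^sub>1 * N" "adj J\<^sub>2 * M = adj J\<^sub>2 * N"
  shows "M = N"
  using block_decomp[OF assms(1)] block_decomp[OF assms(2)] unfolding assms(3,4) by (rule trans[OF sym])

lemma rho_eq: "M \<in> carrier_mat n n \<Longrightarrow> rho n k M = M * (J\<^sub>2 :: 'a::conj_div_algebra mat)"
  by (rule eq_matI) (auto simp: rho_def index_incl_right simp del: index_mult_mat(1))

lemma append_rows_eq:
  fixes X Y :: "'a::conj_div_algebra mat"
  assumes "X \<in> carrier_mat (n - k) c" "Y \<in> carrier_mat k c"
  shows "X @\<^sub>r Y = J\<^sub>1 * X + J\<^sub>2 * Y"
proof (rule eq_matI)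
  fix i j assume "i < dim_row (J\<^sub>1 * X + J\<^sub>2 * Y)" "j < dim_col (J\<^sub>1 * X + J\<^sub>2 * Y)"
  then have "i < n" "j < c" using assms by auto
  then show "(X @\<^sub>r Y) $$ (i, j) = (J\<^sub>1 * X + J\<^sub>2 * Y) $$ (i, j)"
    using assms index_incl_left(1)[OF assms(1)] index_incl_left(2)[OF assms(2)] kn
    by (auto simp: append_rows_def simp del: index_mult_mat(1))
qed (use assms kn in \<open>auto simp: append_rows_def\<close>)

lemma split_block_eq:
  fixes M :: "'a::conj_div_algebra mat"
  assumes "M \<in> carrier_mat n n"
  shows "split_block M (n - k) (n - k) =
    (adj J\<^sub>1 * (M * J\<^sub>1), adj J\<^sub>1 * (M * J\<^sub>2), adj J\<^sub>2 * (M * J\<^sub>1), adj J\<^sub>2 * (M * J\<^sub>2))"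
proof -
  have c: "M * J\<^sub>1 \<in> carrier_mat n (n - k)" "M * J\<^sub>2 \<in> carrier_mat n k" using assms by auto
  show ?thesis unfolding split_block_def Let_def prod.inject
    by (intro conjI eq_matI; use assms kn in \<open>auto simp: index_incl_left(3,4)[OF c(1)] index_incl_left(3,4)[OF c(2)]
      index_incl_right[OF assms] add.commute simp del: index_mult_mat(1)\<close>)
qed

end

section \<open>The Cayley transform of a skew-adjoint matrix, applied to a frame\<close>

context frame_blocks
begin

text \<open>The block matrix \<open>(0, X; - X\<^sup>*, Y)\<close>, skew-adjoint if \<open>Y\<close> is. With
  such \<open>Y\<close>, these are the matrices \<open>A\<^sup>* Z\<close> for the horizontal vectors
  \<open>Z\<close>.\<close>

definition skew_lift :: "'a::conj_div_algebra mat \<Rightarrow> 'a mat \<Rightarrow> 'a mat" where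
  "skew_lift X Y = J\<^sub>1 * (X * adj J\<^sub>2) + (- (J\<^sub>2 * (adj X * adj J\<^sub>1)) + J\<^sub>2 * (Y * adj J\<^sub>2))"

lemma skew_lift_carrier [simp]: "skew_lift X Y \<in> carrier_mat n n"
  by (rule carrier_matI) (simp_all add: skew_lift_def)

lemma skew_lift_dim [simp]: "dim_row (skew_lift X Y) = n" "dim_col (skew_lift X Y) = n"
  by (simp_all add: skew_lift_def)

lemma adj_skew_lift:
  fixes X Y :: "'a::conj_div_algebra mat"
  assumes "X \<in> carrier_mat (n - k) k" "Y \<in> carrier_mat k k" "adj Y = - Y"
  shows "adj (skew_lift X Y) = - skew_lift X Y"
proof -
  have "adj (skew_lift X Y) = J\<^sub>2 * (adj X * adj J\<^sub>1) + (- (J\<^sub>1 * (X * adj J\<^sub>2)) + - (J\<^sub>2 * (Y * adj J\<^sub>2)))"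
    using assms by (simp add: skew_lift_def mat_ring)
  also have "\<dots> = - skew_lift X Y"
    unfolding skew_lift_def using assms(1,2) by (intro eq_matI) (auto simp del: index_mult_mat(1))
  finally show ?thesis .
qed

lemma skew_lift_mult_blocks:
  fixes X Y z :: "'a::conj_div_algebra mat"
  assumes "X \<in> carrier_mat (n - k) k" "Y \<in> carrier_mat k k" "z \<in> carrier_mat n c"
  shows "adj J\<^sub>1 * (skew_lift X Y * z) = X * (adj J\<^sub>2 * z)"
    and "adj J\<^sub>2 * (skew_lift X Y * z) = - (adj X * (adj J\<^sub>1 * z)) + Y * (adj J\<^sub>2 * z)"
  using assms by (simp_all add: skew_lift_def mat_ring)

text \<open>The matrix of scalar products of the columns splits along \<open>J\<^sub>1 J\<^sub>1\<^sup>* +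
  J\<^sub>2 J\<^sub>2\<^sup>* = 1\<close>.\<close>

lemma inner_blocks:
  fixes M N :: "'a::conj_div_algebra mat"
  assumes "M \<in> carrier_mat n c" "N \<in> carrier_mat n d"
  shows "adj (adj J\<^sub>1 * M) * (adj J\<^sub>1 * N) + adj (adj J\<^sub>2 * M) * (adj J\<^sub>2 * N) = adj M * N"
proof -
  have "adj M * (J\<^sub>1 * (adj J\<^sub>1 * N) + J\<^sub>2 * (adj J\<^sub>2 * N)) =
      adj (adj J\<^sub>1 * M) * (adj J\<^sub>1 * N) + adj (adj J\<^sub>2 * M) * (adj J\<^sub>2 * N)"
    using assms by (simp add: mat_ring)
  then show ?thesis unfolding block_decomp[OF assms(2)] ..
qed

lemma skew_lift_add:
  fixes X Y :: "'a::conj_div_algebra mat"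
  assumes "X \<in> carrier_mat (n - k) k" "Y \<in> carrier_mat k k" "X' \<in> carrier_mat (n - k) k" "Y' \<in> carrier_mat k k"
  shows "skew_lift (X + X') (Y + Y') = skew_lift X Y + skew_lift X' Y'"
proof -
  have "skew_lift (X + X') (Y + Y') = (J\<^sub>1 * (X * adj J\<^sub>2) + J\<^sub>1 * (X' * adj J\<^sub>2)) +
      (- (J\<^sub>2 * (adj X * adj J\<^sub>1) + J\<^sub>2 * (adj X' * adj J\<^sub>1)) + (J\<^sub>2 * (Y * adj J\<^sub>2) + J\<^sub>2 * (Y' * adj J\<^sub>2)))"
    using assms by (simp add: skew_lift_def mat_ring)
  also have "\<dots> = skew_lift X Y + skew_lift X' Y'"
    unfolding skew_lift_def using assms by (intro eq_matI) (auto simp del: index_mult_mat(1))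
  finally show ?thesis .
qed

end

text \<open>The fixed frame \<open>e\<close> is \<open>A\<^sup>* J\<^sub>2\<close> in the application. The
  matrix \<open>A\<close> enters the analysis of the transform only through \<open>e\<close>.\<close>

locale frame_cayley = frame_blocks +
  fixes e :: "'a::conj_div_algebra mat"
  assumes e: "e \<in> carrier_mat n k" and e_orth: "adj e * e = 1\<^sub>m k"
begin

lemma e_dim [simp]: "dim_row e = n" "dim_col e = k"
  using e by auto

text \<open>The midpoint of \<open>e\<close> and its transform, which determines both
  (\<open>transform_sum\<close>, \<open>transform_diff\<close>).\<close>

definition half_sum :: "'a mat \<Rightarrow> 'a mat" where
  "half_sum W = mat_inv (1\<^sub>m n + W) * e"

definition transform :: "'a mat \<Rightarrow> 'a mat" where
  "transform W = (1\<^sub>m n + - W) * half_sum W"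

context
  fixes W :: "'a mat"
  assumes W: "W \<in> carrier_mat n n" and skew: "adj W = - W"
begin

lemmas skew_inv = mat_inv[OF skew_plus_one_invertible[OF W skew], of n]

lemma half_sum_carrier: "half_sum W \<in> carrier_mat n k"
  using skew_inv W e by (auto simp: half_sum_def)

lemma half_sum_eq: "half_sum W + W * half_sum W = e"
proof -
  have c: "1\<^sub>m n + W \<in> carrier_mat n n" using W by simp
  have "half_sum W + W * half_sum W = (1\<^sub>m n + W) * half_sum W"
    using W half_sum_carrier by (simp add: add_mult_dim)
  also have "\<dots> = (1\<^sub>m n + W) * mat_inv (1\<^sub>m n + W) * e"
    unfolding half_sum_def using skew_inv(1)[OF c] W by (simp add: mult_assoc_dim)
  finally show ?thesis using skew_inv(2)[OF c] by simp
qed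

text \<open>The factor \<open>C\<close> allows linear combinations of the columns of \<open>e\<close>, as
  needed for the comparison of kernels.\<close>

lemma half_sum_unique:
  assumes "s \<in> carrier_mat n c" "C \<in> carrier_mat k c" "s + W * s = e * C"
  shows "s = half_sum W * C"
proof -
  have c: "1\<^sub>m n + W \<in> carrier_mat n n" using W by simp
  have "s = mat_inv (1\<^sub>m n + W) * (1\<^sub>m n + W) * s"
    using skew_inv(3)[OF c] assms by simp
  also have "\<dots> = mat_inv (1\<^sub>m n + W) * ((1\<^sub>m n + W) * s)"
    using skew_inv(1)[OF c] W assms by (intro mult_assoc_dim) auto
  also have "(1\<^sub>m n + W) * s = e * C"
    using W assms by (simp add: add_mult_dim)
  also have "mat_inv (1\<^sub>m n + W) * (e * C) = half_sum W * C"
    unfolding half_sum_def using skew_inv(1)[OF c] assms by (simp add: mult_assoc_dim)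
  finally show ?thesis .
qed

lemma transform_eq: "transform W = half_sum W + - (W * half_sum W)"
  using W half_sum_carrier by (simp add: transform_def add_mult_dim uminus_mult_dim)

lemma transform_carrier: "transform W \<in> carrier_mat n k"
  using W half_sum_carrier by (simp add: transform_eq)

lemma transform_sum: "transform W + e = half_sum W + half_sum W"
proof -
  have "transform W + (half_sum W + W * half_sum W) = half_sum W + half_sum W"
    unfolding transform_eq using W half_sum_carrier by (intro eq_matI) (auto simp del: index_mult_mat(1))
  then show ?thesis unfolding half_sum_eq .
qed

lemma transform_diff: "e + - transform W = W * half_sum W + W * half_sum W"
proof -
  have "(half_sum W + W * half_sum W) + - transform W = W * half_sum W + W * half_sum W"
    unfolding transform_eq using W half_sum_carrier by (intro eq_matI) (auto simp del: index_mult_mat(1))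
  then show ?thesis unfolding half_sum_eq .
qed

text \<open>With \<open>z\<close> the midpoint and \<open>d = W z\<close>, the transform is \<open>z -
  d\<close> and \<open>e = z + d\<close>. Since \<open>z\<^sup>* d\<close> is skew-adjoint, the mixed terms
  cancel in both products, which therefore agree.\<close>

lemma transform_orth: "adj (transform W) * transform W = 1\<^sub>m k"
proof -
  let ?z = "half_sum W" and ?d = "W * half_sum W"
  have dims: "dim_row W = n" "dim_col W = n" "dim_row ?z = n" "dim_col ?z = k"
    using W half_sum_carrier by auto
  have cross: "adj ?d * ?z = - (adj ?z * ?d)"
    using dims by (simp add: adj_mult skew mult_assoc_dim uminus_mult_dim)
  have "adj (transform W) * transform W = (adj ?z * ?z + - (adj ?z * ?d)) + - (adj ?d * ?z + - (adj ?d * ?d))"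
    unfolding transform_eq using dims
    by (simp add: adj_add adj_uminus mult_add_dim add_mult_dim uminus_mult_dim
      del: assoc_mult_mat) (intro eq_matI; auto simp del: index_mult_mat(1))
  also have "\<dots> = (adj ?z * ?z + adj ?z * ?d) + (adj ?d * ?z + adj ?d * ?d)"
    unfolding cross using dims by (intro eq_matI) (auto simp del: index_mult_mat(1))
  also have "\<dots> = adj (?z + ?d) * (?z + ?d)"
    using dims by (simp add: adj_add mult_add_dim add_mult_dim del: assoc_mult_mat)
      (intro eq_matI; auto simp del: index_mult_mat(1))
  also have "\<dots> = 1\<^sub>m k" unfolding half_sum_eq by (rule e_orth)
  finally show ?thesis .
qed

lemma transform_stiefel: "transform W \<in> stiefel n k"
  using transform_carrier transform_orth by (simp add: stiefel_def)

end

text \<open>For \<open>e = A\<^sup>* J\<^sub>2\<close> this is \<open>(\<beta> X + P)\<^sup>*\<close>.\<close>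

definition denom :: "'a mat \<Rightarrow> 'a mat" where
  "denom X = adj X * (adj J\<^sub>1 * e) + adj J\<^sub>2 * e"

text \<open>Let \<open>z\<close> be the midpoint. Both conditions say that \<open>s = J\<^sub>1
  J\<^sub>1\<^sup>* e c\<close> solves \<open>s + W s = e c\<close>. Indeed, \<open>z c\<close> is the only
  solution; if its lower block vanishes, the upper block of the equation determines it to be \<open>s\<close>,
  and the lower block of the equation for \<open>s\<close> reads \<open>- X\<^sup>* J\<^sub>1\<^sup>* e c =
  J\<^sub>2\<^sup>* e c\<close>.\<close>

lemma half_sum_bottom_kernel:
  assumes X: "X \<in> carrier_mat (n - k) k" and Y: "Y \<in> carrier_mat k k" "adj Y = - Y" and c: "c \<in> carrier_mat k 1"
  shows "adj J\<^sub>2 * half_sum (skew_lift X Y) * c = 0\<^sub>m k 1 \<longleftrightarrow> denom X * c = 0\<^sub>m k 1"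
proof -
  note L = skew_lift_carrier adj_skew_lift[OF X Y]
  let ?W = "skew_lift X Y" and ?z = "half_sum (skew_lift X Y)"
  have z: "?z \<in> carrier_mat n k" by (rule half_sum_carrier[OF L])
  have dims: "dim_row X = n - k" "dim_col X = k" "dim_row Y = k" "dim_col Y = k"
    "dim_row c = k" "dim_col c = 1" "dim_row ?z = n" "dim_col ?z = k" using X Y c z by auto
  have D: "denom X * c = adj X * (adj J\<^sub>1 * (e * c)) + adj J\<^sub>2 * (e * c)"
    using dims by (simp add: denom_def add_mult_dim mult_assoc_dim)
  have assoc: "adj J\<^sub>2 * ?z * c = adj J\<^sub>2 * (?z * c)"
    using dims by (simp add: mult_assoc_dim)
  have ec: "e * c \<in> carrier_mat n 1" using e c by simp
  show ?thesis
  proof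
    assume "adj J\<^sub>2 * ?z * c = 0\<^sub>m k 1"
    then have s2: "adj J\<^sub>2 * (?z * c) = 0\<^sub>m k 1" unfolding assoc .
    have s: "?z * c \<in> carrier_mat n 1" using z c by simp
    have eq: "?z * c + ?W * (?z * c) = e * c"
      using dims by (subst (3) half_sum_eq[OF L, symmetric]) (simp add: add_mult_dim mult_assoc_dim)
    have "adj J\<^sub>1 * (e * c) = adj J\<^sub>1 * (?z * c)"
      unfolding eq[symmetric] using dims X by (simp add: mult_add_dim skew_lift_mult_blocks[OF X Y(1) s] s2)
    moreover have "adj J\<^sub>2 * (e * c) = - (adj X * (adj J\<^sub>1 * (?z * c)))"
      unfolding eq[symmetric] using dims X Y by (simp add: mult_add_dim skew_lift_mult_blocks[OF X Y(1) s] s2)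
    ultimately show "denom X * c = 0\<^sub>m k 1"
      unfolding D using dims by (intro eq_matI) (auto simp del: index_mult_mat(1))
  next
    assume 0: "denom X * c = 0\<^sub>m k 1"
    let ?s = "J\<^sub>1 * (adj J\<^sub>1 * (e * c))"
    have s: "?s \<in> carrier_mat n 1" using ec by simp
    have J: "adj J\<^sub>2 * (e * c) = - (adj X * (adj J\<^sub>1 * (e * c)))"
    proof -
      have "adj J\<^sub>2 * (e * c) = - (adj X * (adj J\<^sub>1 * (e * c))) + (adj X * (adj J\<^sub>1 * (e * c)) + adj J\<^sub>2 * (e * c))"
        using dims by (intro eq_matI) (auto simp del: index_mult_mat(1))
      also have "\<dots> = - (adj X * (adj J\<^sub>1 * (e * c)))"
        unfolding 0[unfolded D] using dims by (intro eq_matI) (auto simp del: index_mult_mat(1))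
      finally show ?thesis .
    qed
    have "?s + ?W * ?s = e * c"
    proof (rule block_eqI)
      show "adj J\<^sub>1 * (?s + ?W * ?s) = adj J\<^sub>1 * (e * c)"
        using dims X by (simp add: mult_add_dim skew_lift_mult_blocks[OF X Y(1) s])
      show "adj J\<^sub>2 * (?s + ?W * ?s) = adj J\<^sub>2 * (e * c)"
        unfolding J using dims X Y by (simp add: mult_add_dim skew_lift_mult_blocks[OF X Y(1) s])
    qed (use s ec in auto)
    from half_sum_unique[OF L s c this] have "?s = ?z * c" .
    then have "adj J\<^sub>2 * ?z * c = adj J\<^sub>2 * ?s" unfolding assoc by simp
    also have "\<dots> = 0\<^sub>m k 1" using dims by simp
    finally show "adj J\<^sub>2 * ?z * c = 0\<^sub>m k 1" .
  qed
qed

lemma denom_carrier: "X \<in> carrier_mat (n - k) k \<Longrightarrow> denom X \<in> carrier_mat k k"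
  by (rule carrier_matI) (simp_all add: denom_def)

lemma invertible_half_sum_bottom_iff:
  assumes X: "X \<in> carrier_mat (n - k) k" and Y: "Y \<in> carrier_mat k k" "adj Y = - Y"
  shows "invertible_mat (adj J\<^sub>2 * half_sum (skew_lift X Y)) \<longleftrightarrow> invertible_mat (denom X)"
proof -
  have "adj J\<^sub>2 * half_sum (skew_lift X Y) \<in> carrier_mat k k"
    using half_sum_carrier[OF skew_lift_carrier adj_skew_lift[OF X Y]] by (intro carrier_matI) simp_all
  then show ?thesis
    using half_sum_bottom_kernel[OF X Y] denom_carrier[OF X] by (simp add: invertible_iff_kernel)
qed

lemma invertible_double:
  fixes M :: "'a mat"
  assumes "M \<in> carrier_mat k k"
  shows "invertible_mat (M + M) \<longleftrightarrow> invertible_mat M"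
proof -
  have "(M + M) * c = 0\<^sub>m k 1 \<longleftrightarrow> M * c = 0\<^sub>m k 1" if "c \<in> carrier_mat k 1" for c
    using assms that double_eq_0[of "M * c" k 1] by (auto simp: add_mult_dim)
  then show ?thesis
    unfolding invertible_iff_kernel[OF assms] invertible_iff_kernel[OF add_carrier_mat[OF assms]] by blast
qed

text \<open>The condition is that of \<open>Omega_set\<close>, as \<open>J\<^sub>2\<^sup>* y = \<pi>\<close>
  and \<open>J\<^sub>2\<^sup>* e = P\<^sup>*\<close>.\<close>

definition omega :: "'a mat set" where
  "omega = {y \<in> stiefel n k. invertible_mat (adj J\<^sub>2 * (y + e))}"

lemma transform_in_omega_iff:
  assumes X: "X \<in> carrier_mat (n - k) k" and Y: "Y \<in> carrier_mat k k" "adj Y = - Y"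
  shows "transform (skew_lift X Y) \<in> omega \<longleftrightarrow> invertible_mat (denom X)"
proof -
  note L = skew_lift_carrier adj_skew_lift[OF X Y]
  have z: "half_sum (skew_lift X Y) \<in> carrier_mat n k" by (rule half_sum_carrier[OF L])
  then have "adj J\<^sub>2 * (transform (skew_lift X Y) + e) = adj J\<^sub>2 * half_sum (skew_lift X Y) + adj J\<^sub>2 * half_sum (skew_lift X Y)"
    unfolding transform_sum[OF L] by (simp add: mult_add_dim)
  then show ?thesis
    using z transform_stiefel[OF L] invertible_double[of "adj J\<^sub>2 * half_sum (skew_lift X Y)"] invertible_half_sum_bottom_iff[OF X Y]
    by (simp add: omega_def)
qed

text \<open>The solution \<open>(X, Y)\<close> of \<open>W (y + e) = e - y\<close>, block by block. Working
  with \<open>y + e\<close> and \<open>e - y\<close> instead of their halves avoids scalar factors.\<close>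

definition inv_X :: "'a mat \<Rightarrow> 'a mat" where
  "inv_X y = adj J\<^sub>1 * (e + - y) * mat_inv (adj J\<^sub>2 * (y + e))"

definition inv_Y :: "'a mat \<Rightarrow> 'a mat" where
  "inv_Y y = (adj J\<^sub>2 * (e + - y) + adj (inv_X y) * (adj J\<^sub>1 * (y + e))) * mat_inv (adj J\<^sub>2 * (y + e))"

context
  fixes y :: "'a mat"
  assumes y: "y \<in> omega"
begin

lemma omega_facts:
  "y \<in> carrier_mat n k" "adj y * y = 1\<^sub>m k" "invertible_mat (adj J\<^sub>2 * (y + e))"
  using y by (auto simp: omega_def stiefel_def)

lemma y_dim: "dim_row y = n" "dim_col y = k" using omega_facts(1) by auto

lemma bottom_carrier: "adj J\<^sub>2 * (y + e) \<in> carrier_mat k k"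
  by (simp add: y_dim)

lemmas bottom_inv = mat_inv[OF omega_facts(3) bottom_carrier]

lemma inv_X_carrier: "inv_X y \<in> carrier_mat (n - k) k"
  using bottom_inv by (simp add: inv_X_def y_dim)

lemma inv_Y_carrier: "inv_Y y \<in> carrier_mat k k"
  using bottom_inv inv_X_carrier by (simp add: inv_Y_def y_dim)

lemma mult_bottom_iff:
  assumes "M \<in> carrier_mat r k" "N \<in> carrier_mat r k"
  shows "M * (adj J\<^sub>2 * (y + e)) = N \<longleftrightarrow> M = N * mat_inv (adj J\<^sub>2 * (y + e))"
proof
  let ?w = "adj J\<^sub>2 * (y + e)"
  have dims: "dim_row ?w = k" "dim_col ?w = k" "dim_row (mat_inv ?w) = k" "dim_col (mat_inv ?w) = k"
    using bottom_carrier bottom_inv(1) by auto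
  show "M = N * mat_inv ?w" if "M * ?w = N"
  proof -
    have "N * mat_inv ?w = M * (?w * mat_inv ?w)"
      unfolding that[symmetric] using dims assms(1) by (intro mult_assoc_dim) auto
    then show ?thesis using bottom_inv assms by simp
  qed
  show "M * ?w = N" if "M = N * mat_inv ?w"
  proof -
    have "M * ?w = N * (mat_inv ?w * ?w)"
      unfolding that using dims assms(2) by (intro mult_assoc_dim) auto
    then show ?thesis using bottom_inv assms by simp
  qed
qed

lemma skew_lift_mult_iff:
  assumes X: "X \<in> carrier_mat (n - k) k" and Y: "Y \<in> carrier_mat k k"
  shows "skew_lift X Y * (y + e) = e + - y \<longleftrightarrow> X = inv_X y \<and> Y = inv_Y y"
proof -
  have c: "y + e \<in> carrier_mat n k" "e + - y \<in> carrier_mat n k" using omega_facts(1) e by auto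
  have dims: "dim_row X = n - k" "dim_col X = k" "dim_row Y = k" "dim_col Y = k"
    using X Y by auto
  let ?w = "adj J\<^sub>2 * (y + e)" and ?u = "adj J\<^sub>1 * (y + e)" and ?d = "e + - y"
  have uc: "?u \<in> carrier_mat (n - k) k" using c(1) by simp
  have "skew_lift X Y * (y + e) = ?d \<longleftrightarrow>
      adj J\<^sub>1 * (skew_lift X Y * (y + e)) = adj J\<^sub>1 * ?d \<and> adj J\<^sub>2 * (skew_lift X Y * (y + e)) = adj J\<^sub>2 * ?d"
    using block_eqI[of "skew_lift X Y * (y + e)" k ?d] mult_carrier_mat[OF skew_lift_carrier c(1)] c(2) by metis
  also have "\<dots> \<longleftrightarrow> X * ?w = adj J\<^sub>1 * ?d \<and> - (adj X * ?u) + Y * ?w = adj J\<^sub>2 * ?d"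
    unfolding skew_lift_mult_blocks[OF X Y c(1)] ..
  also have "- (adj X * ?u) + Y * ?w = adj J\<^sub>2 * ?d \<longleftrightarrow> Y * ?w = adj J\<^sub>2 * ?d + adj X * ?u"
  proof
    assume *: "- (adj X * ?u) + Y * ?w = adj J\<^sub>2 * ?d"
    show "Y * ?w = adj J\<^sub>2 * ?d + adj X * ?u"
      unfolding *[symmetric] using dims y_dim by (intro eq_matI) (auto simp del: index_mult_mat(1))
  next
    assume *: "Y * ?w = adj J\<^sub>2 * ?d + adj X * ?u"
    show "- (adj X * ?u) + Y * ?w = adj J\<^sub>2 * ?d"
      unfolding * using dims y_dim by (intro eq_matI) (auto simp del: index_mult_mat(1))
  qed
  also have "X * ?w = adj J\<^sub>1 * ?d \<longleftrightarrow> X = inv_X y"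
    unfolding inv_X_def by (rule mult_bottom_iff[OF X]) (use c in simp)
  also have "Y * ?w = adj J\<^sub>2 * ?d + adj X * ?u \<longleftrightarrow>
      Y = (adj J\<^sub>2 * ?d + adj X * ?u) * mat_inv ?w"
    by (rule mult_bottom_iff[OF Y]) (use c uc X in simp)
  finally show ?thesis unfolding inv_Y_def by blast
qed

text \<open>Let \<open>z = y + e\<close> and \<open>d = e - y\<close>. From \<open>y\<^sup>* y = e\<^sup>*
  e\<close> one gets \<open>z\<^sup>* d + d\<^sup>* z = 0\<close>. By the two equations that define
  \<open>X\<close> and \<open>Y\<close>, the left-hand side is \<open>w\<^sup>* (Y + Y\<^sup>*) w\<close>,
  because the terms with \<open>X\<close> match the upper blocks; and \<open>w\<close> is invertible.\<close>

lemma inv_Y_skew: "adj (inv_Y y) = - inv_Y y"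
proof -
  let ?X = "inv_X y" and ?Y = "inv_Y y"
  let ?z = "y + e" and ?d = "e + - y"
  let ?u = "adj J\<^sub>1 * ?z" and ?w = "adj J\<^sub>2 * ?z" and ?i = "mat_inv (adj J\<^sub>2 * (y + e))"
  let ?d1 = "adj J\<^sub>1 * ?d" and ?d2 = "adj J\<^sub>2 * ?d"
  have dims: "dim_row ?X = n - k" "dim_col ?X = k" "dim_row ?Y = k" "dim_col ?Y = k"
    "dim_row ?i = k" "dim_col ?i = k"
    using inv_X_carrier inv_Y_carrier bottom_inv(1) by auto
  have zc: "?z \<in> carrier_mat n k" and dc: "?d \<in> carrier_mat n k" using omega_facts(1) e by auto
  have Xw: "?X * ?w = ?d1"
    by (subst mult_bottom_iff[OF inv_X_carrier]) (use dc in \<open>auto simp: inv_X_def\<close>)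
  have Yw: "?Y * ?w = ?d2 + adj ?X * ?u"
    by (subst mult_bottom_iff[OF inv_Y_carrier]) (use dc zc inv_X_carrier in \<open>auto simp: inv_Y_def\<close>)
  have zd: "adj ?z * ?d + adj ?d * ?z = 0\<^sub>m k k"
  proof -
    have "adj ?z * ?d + adj ?d * ?z = (adj e * e + adj e * e) + - (adj y * y + adj y * y)"
      by (simp add: mat_ring y_dim) (intro eq_matI; auto simp: y_dim simp del: index_mult_mat(1))
    also have "\<dots> = 0\<^sub>m k k" unfolding e_orth omega_facts(2) by (intro eq_matI) auto
    finally show ?thesis .
  qed
  have wYw: "adj ?w * (?Y * ?w) = adj ?w * ?d2 + adj ?d1 * ?u"
  proof -
    have "adj ?w * (?Y * ?w) = adj ?w * ?d2 + adj ?w * (adj ?X * ?u)"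
      unfolding Yw by (rule mult_add_dim) (use dims y_dim in auto)
    also have "adj ?w * (adj ?X * ?u) = adj ?w * adj ?X * ?u"
      by (rule mult_assoc_dim[symmetric]) (use dims y_dim in auto)
    also have "adj ?w * adj ?X = adj ?d1"
      unfolding Xw[symmetric] by (rule adj_mult[symmetric]) (use dims y_dim in auto)
    finally show ?thesis .
  qed
  have "adj (adj ?w * (?Y * ?w)) = adj ?d2 * ?w + adj ?u * ?d1"
    unfolding wYw by (subst adj_add; (subst adj_mult)?; (subst adj_mult)?) (use y_dim in auto)
  moreover have "adj (adj ?w * (?Y * ?w)) = adj ?w * (adj ?Y * ?w)"
  proof -
    have "adj (adj ?w * (?Y * ?w)) = adj (?Y * ?w) * ?w"
      by (subst adj_mult) (use dims y_dim in auto)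
    also have "adj (?Y * ?w) = adj ?w * adj ?Y"
      by (rule adj_mult) (use dims y_dim in auto)
    also have "\<dots> * ?w = adj ?w * (adj ?Y * ?w)"
      by (rule mult_assoc_dim) (use dims y_dim in auto)
    finally show ?thesis .
  qed
  ultimately have wYw': "adj ?w * (adj ?Y * ?w) = adj ?d2 * ?w + adj ?u * ?d1" by simp
  have "adj ?w * ((?Y + adj ?Y) * ?w) = adj ?w * (?Y * ?w) + adj ?w * (adj ?Y * ?w)"
    by (subst add_mult_dim; (subst mult_add_dim)?) (use dims y_dim in auto)
  also have "\<dots> = (adj ?u * ?d1 + adj ?w * ?d2) + (adj ?d1 * ?u + adj ?d2 * ?w)"
    unfolding wYw wYw' using y_dim by (intro eq_matI) (auto simp del: index_mult_mat(1))
  also have "\<dots> = adj ?z * ?d + adj ?d * ?z"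
    using inner_blocks[OF zc dc] inner_blocks[OF dc zc] by simp
  finally have 0: "adj ?w * ((?Y + adj ?Y) * ?w) = 0\<^sub>m k k" unfolding zd .
  have c: "(?Y + adj ?Y) * ?w \<in> carrier_mat k k" "?Y + adj ?Y \<in> carrier_mat k k"
    using inv_Y_carrier bottom_carrier by auto
  have i: "adj ?i * adj ?w = 1\<^sub>m k"
    using adj_mult[of ?w ?i] bottom_inv dims y_dim by simp
  have "(?Y + adj ?Y) * ?w = 0\<^sub>m k k"
    by (rule left_inverse_cancel[OF _ _ i c(1) 0]) (use bottom_inv bottom_carrier in auto)
  then have "?Y + adj ?Y = 0\<^sub>m k k * ?i"
    using mult_bottom_iff[OF c(2), of "0\<^sub>m k k"] by simp
  then have 1: "?Y + adj ?Y = 0\<^sub>m k k" using dims by simp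
  have "adj ?Y = - ?Y + (?Y + adj ?Y)"
    using dims by (intro eq_matI) auto
  then show ?thesis unfolding 1 using dims by (simp)
qed

text \<open>As \<open>(1 + W) (y + e) = 2 e\<close>, the matrix \<open>y + e\<close> is twice the
  midpoint.\<close>

lemma transform_inv: "transform (skew_lift (inv_X y) (inv_Y y)) = y"
proof -
  note L = skew_lift_carrier adj_skew_lift[OF inv_X_carrier inv_Y_carrier inv_Y_skew]
  let ?W = "skew_lift (inv_X y) (inv_Y y)"
  have zc: "y + e \<in> carrier_mat n k" using omega_facts(1) e by auto
  have zW: "half_sum ?W \<in> carrier_mat n k" by (rule half_sum_carrier[OF L])
  have Wz: "?W * (y + e) = e + - y" using skew_lift_mult_iff[OF inv_X_carrier inv_Y_carrier] by blast
  have "(y + e) + ?W * (y + e) = e * (1\<^sub>m k + 1\<^sub>m k)"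
    unfolding Wz by (simp add: mult_add_dim) (intro eq_matI; auto simp: y_dim)
  from half_sum_unique[OF L zc _ this] have "y + e = half_sum ?W * (1\<^sub>m k + 1\<^sub>m k)" by simp
  then have "y + e = half_sum ?W + half_sum ?W" using zW by (simp add: mult_add_dim)
  then have "y + e = transform ?W + e" unfolding transform_sum[OF L] .
  then have *: "y + e + - e = transform ?W + e + - e" by (rule arg_cong)
  have "M = M + e + - e" if "M \<in> carrier_mat n k" for M
    using that by (intro eq_matI) auto
  from this[OF omega_facts(1)] this[OF transform_carrier[OF L]] * show ?thesis by metis
qed

end

lemma inv_transform:
  assumes X: "X \<in> carrier_mat (n - k) k" and Y: "Y \<in> carrier_mat k k" "adj Y = - Y"
    and \<Omega>: "transform (skew_lift X Y) \<in> omega"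
  shows "inv_X (transform (skew_lift X Y)) = X" "inv_Y (transform (skew_lift X Y)) = Y"
proof -
  note L = skew_lift_carrier adj_skew_lift[OF X Y]
  have "half_sum (skew_lift X Y) \<in> carrier_mat n k" by (rule half_sum_carrier[OF L])
  then have "skew_lift X Y * (transform (skew_lift X Y) + e) = e + - transform (skew_lift X Y)"
    unfolding transform_sum[OF L] transform_diff[OF L] by (intro mult_add_dim) auto
  then show "inv_X (transform (skew_lift X Y)) = X" "inv_Y (transform (skew_lift X Y)) = Y"
    using skew_lift_mult_iff[OF \<Omega> X Y(1)] by auto
qed

end

section \<open>The Cayley transform of the Stiefel manifold\<close>

lemma invertible_adj_iff:
  fixes M :: "'a::conj_div_algebra mat"
  assumes "M \<in> carrier_mat n n"
  shows "invertible_mat (adj M) \<longleftrightarrow> invertible_mat M"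
  using invertible_adj[of M n] invertible_adj[of "adj M" n] assms by auto

lemma tangent_stiefel_iff:
  fixes x v :: "'a::conj_div_algebra mat"
  assumes "x \<in> carrier_mat n k"
  shows "v \<in> tangent_stiefel n k x \<longleftrightarrow> v \<in> carrier_mat n k \<and> adj (adj x * v) = - (adj x * v)"
proof -
  have "adj v * x + adj x * v = 0\<^sub>m k k \<longleftrightarrow> adj (adj x * v) = - (adj x * v)" if v: "v \<in> carrier_mat n k"
  proof -
    have "adj (adj x * v) = adj v * x" using v assms by (simp add: adj_mult)
    moreover have "adj v * x + adj x * v = 0\<^sub>m k k \<longleftrightarrow> adj v * x = - (adj x * v)"
    proof
      assume *: "adj v * x + adj x * v = 0\<^sub>m k k"
      show "adj v * x = - (adj x * v)"
        by (rule mat_eq_of_add_uminus[of _ k k]) (use * v assms in auto)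
    next
      assume "adj v * x = - (adj x * v)"
      then show "adj v * x + adj x * v = 0\<^sub>m k k"
        using v assms by (intro eq_matI) (auto simp del: index_mult_mat(1))
    qed
    ultimately show ?thesis by simp
  qed
  then show ?thesis by (auto simp: tangent_stiefel_def)
qed

locale unitary_frame = frame_blocks +
  fixes A :: "'a::conj_div_algebra mat"
  assumes A: "A \<in> unitary_grp n"
begin

lemma A_carrier: "A \<in> carrier_mat n n" and A_adj: "A * adj A = 1\<^sub>m n"
  using A by (auto simp: unitary_grp_def)

lemma A_dim [simp]: "dim_row A = n" "dim_col A = n"
  using A_carrier by auto

lemma adj_A: "adj A * A = 1\<^sub>m n"
  by (rule one_sided_inverse[OF A_carrier _ A_adj]) (simp add: A_carrier)

lemma A_mult [simp]:
  "dim_row M = n \<Longrightarrow> A * (adj A * M) = M" "dim_row M = n \<Longrightarrow> adj A * (A * M) = M"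
  using A_adj adj_A by (simp_all flip: mult_assoc_dim)

sublocale frame_cayley n k "adj A * J\<^sub>2"
proof
  show "adj (adj A * J\<^sub>2) * (adj A * J\<^sub>2) = 1\<^sub>m k"
    by (simp add: adj_mult mult_assoc_dim)
qed simp

text \<open>The coordinates \<open>X\<close>, \<open>Y\<close> of \<open>v = A (X; Y)\<close>.\<close>

definition coord_X :: "'a mat \<Rightarrow> 'a mat" where "coord_X v = adj J\<^sub>1 * (adj A * v)"
definition coord_Y :: "'a mat \<Rightarrow> 'a mat" where "coord_Y v = adj J\<^sub>2 * (adj A * v)"
definition of_coord :: "'a mat \<Rightarrow> 'a mat \<Rightarrow> 'a mat" where "of_coord X Y = A * (J\<^sub>1 * X + J\<^sub>2 * Y)"
definition gamma :: "'a mat \<Rightarrow> 'a mat" where "gamma v = transform (skew_lift (coord_X v) (coord_Y v))"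

lemma coord_carrier:
  assumes "v \<in> carrier_mat n k"
  shows "coord_X v \<in> carrier_mat (n - k) k" "coord_Y v \<in> carrier_mat k k"
  using assms by (auto simp: coord_X_def coord_Y_def)

lemma of_coord_carrier: "Y \<in> carrier_mat k k \<Longrightarrow> of_coord X Y \<in> carrier_mat n k"
  by (auto simp: of_coord_def)

lemma of_coord_coord: "v \<in> carrier_mat n k \<Longrightarrow> of_coord (coord_X v) (coord_Y v) = v"
  using block_decomp[of "adj A * v" k] by (simp add: of_coord_def coord_X_def coord_Y_def)

lemma coord_of_coord:
  assumes "X \<in> carrier_mat (n - k) k" "Y \<in> carrier_mat k k"
  shows "coord_X (of_coord X Y) = X" "coord_Y (of_coord X Y) = Y"
  using assms by (simp_all add: of_coord_def coord_X_def coord_Y_def mult_add_dim)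

lemma tangent_iff:
  "v \<in> tangent_stiefel n k (A * J\<^sub>2) \<longleftrightarrow> v \<in> carrier_mat n k \<and> adj (coord_Y v) = - coord_Y v"
proof -
  have "adj (A * J\<^sub>2) * v = coord_Y v" if "v \<in> carrier_mat n k"
    using that by (simp add: coord_Y_def adj_mult mult_assoc_dim)
  then show ?thesis using tangent_stiefel_iff[of "A * J\<^sub>2" n k v] by auto
qed

lemma of_coord_tangent:
  assumes "X \<in> carrier_mat (n - k) k" "Y \<in> carrier_mat k k" "adj Y = - Y"
  shows "of_coord X Y \<in> tangent_stiefel n k (A * J\<^sub>2)"
  unfolding tangent_iff using assms by (simp add: of_coord_carrier coord_of_coord)

lemma gamma_stiefel: "v \<in> tangent_stiefel n k (A * J\<^sub>2) \<Longrightarrow> gamma v \<in> stiefel n k"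
  unfolding gamma_def tangent_iff
  by (intro transform_stiefel skew_lift_carrier adj_skew_lift) (auto simp: coord_carrier)

text \<open>For \<open>V = A\<^sup>* Z\<close>, skewness and the vanishing upper left block force
  \<open>V\<close> to be the skew lift of the coordinates of \<open>Z J\<^sub>2\<close>; and \<open>(A +
  Z)\<inverse> = (1 + V)\<inverse> A\<^sup>*\<close>.\<close>

lemma gamma_horizontal:
  assumes "Z \<in> horizontal_space n k A"
  shows "gamma (rho_diff n k A Z) = rho n k (cayley n A Z)"
proof -
  define V where "V = adj A * Z"
  have Z: "Z \<in> carrier_mat n n" and tang: "adj A * Z + adj Z * A = 0\<^sub>m n n"
    and hor: "fst (split_block V (n - k) (n - k)) = 0\<^sub>m (n - k) (n - k)"
    using assms by (auto simp: horizontal_space_def tangent_grp_def V_def)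
  have Zd: "dim_row Z = n" "dim_col Z = n" using Z by auto
  have V: "V \<in> carrier_mat n n" using Zd by (simp add: V_def)
  have Vd: "dim_row V = n" "dim_col V = n" using V by auto
  have adjV: "adj V = adj Z * A" using Zd by (simp add: V_def adj_mult)
  have skew: "adj V = - V"
  proof -
    have "adj Z * A = - V + (V + adj Z * A)"
      using Vd Zd by (intro eq_matI) (auto simp del: index_mult_mat(1))
    then show ?thesis unfolding adjV V_def[symmetric] tang[folded V_def] using Vd by simp
  qed
  have V11: "adj J\<^sub>1 * (V * J\<^sub>1) = 0\<^sub>m (n - k) (n - k)"
    using hor by (simp add: split_block_eq[OF V])
  have X: "coord_X (Z * J\<^sub>2) = adj J\<^sub>1 * (V * J\<^sub>2)" and Y: "coord_Y (Z * J\<^sub>2) = adj J\<^sub>2 * (V * J\<^sub>2)"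
    using Zd by (simp_all add: coord_X_def coord_Y_def V_def mult_assoc_dim)
  have "V = (V * J\<^sub>1) * adj J\<^sub>1 + (V * J\<^sub>2) * adj J\<^sub>2"
  proof -
    have "adj (J\<^sub>1 * (adj J\<^sub>1 * adj V) + J\<^sub>2 * (adj J\<^sub>2 * adj V)) = adj (adj V)"
      by (subst block_decomp[of _ n]) (use Vd in auto)
    then show ?thesis using Vd by (simp add: adj_add adj_mult)
  qed
  moreover have "V * J\<^sub>1 = J\<^sub>2 * (adj J\<^sub>2 * (V * J\<^sub>1))"
    using block_decomp[of "V * J\<^sub>1" "n - k"] V11 Vd by simp
  moreover have "V * J\<^sub>2 = J\<^sub>1 * (adj J\<^sub>1 * (V * J\<^sub>2)) + J\<^sub>2 * (adj J\<^sub>2 * (V * J\<^sub>2))"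
    using block_decomp[of "V * J\<^sub>2" k] Vd by simp
  ultimately have "V = (J\<^sub>2 * (adj J\<^sub>2 * (V * J\<^sub>1))) * adj J\<^sub>1
      + (J\<^sub>1 * (adj J\<^sub>1 * (V * J\<^sub>2)) + J\<^sub>2 * (adj J\<^sub>2 * (V * J\<^sub>2))) * adj J\<^sub>2"
    by metis
  also have "\<dots> = skew_lift (adj J\<^sub>1 * (V * J\<^sub>2)) (adj J\<^sub>2 * (V * J\<^sub>2))"
    unfolding skew_lift_def using Vd skew
    by (simp add: mat_ring) (intro eq_matI; auto simp del: index_mult_mat(1))
  finally have skew_lift: "skew_lift (coord_X (Z * J\<^sub>2)) (coord_Y (Z * J\<^sub>2)) = V" unfolding X Y ..
  have 1: "1\<^sub>m n + V \<in> carrier_mat n n" using V by simp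
  note I = mat_inv[OF skew_plus_one_invertible[OF V skew] 1]
  have Id: "dim_row (mat_inv (1\<^sub>m n + V)) = n" "dim_col (mat_inv (1\<^sub>m n + V)) = n" using I(1) by auto
  have AZ: "A + Z = A * (1\<^sub>m n + V)"
    using Vd Zd by (simp add: mult_add_dim V_def)
  have "mat_inv (A + Z) = mat_inv (1\<^sub>m n + V) * adj A"
  proof (rule mat_inv_eqI[of _ n])
    have "A * (1\<^sub>m n + V) * (mat_inv (1\<^sub>m n + V) * adj A) = A * ((1\<^sub>m n + V) * mat_inv (1\<^sub>m n + V) * adj A)"
      using Vd Id by (simp add: mult_assoc_dim)
    then show "(A + Z) * (mat_inv (1\<^sub>m n + V) * adj A) = 1\<^sub>m n"
      unfolding AZ I(2) using A_adj by simp
    have "mat_inv (1\<^sub>m n + V) * adj A * (A * (1\<^sub>m n + V)) = mat_inv (1\<^sub>m n + V) * (1\<^sub>m n + V)"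
      using Vd Id by (simp add: mult_assoc_dim)
    then show "mat_inv (1\<^sub>m n + V) * adj A * (A + Z) = 1\<^sub>m n"
      unfolding AZ I(3) .
  qed (use Z Id in auto)
  then have cay: "cayley n A Z = (1\<^sub>m n + - V) * (mat_inv (1\<^sub>m n + V) * adj A)"
    using Vd by (simp add: cayley_def minus_mat_conv V_def Zd)
  then have "rho n k (cayley n A Z) = transform V"
    using Vd Id by (simp add: rho_eq transform_def half_sum_def mult_assoc_dim)
  moreover have "rho_diff n k A Z = Z * J\<^sub>2"
    using rho_diff_eq[OF kn A_carrier Z] rho_eq[OF Z] by simp
  ultimately show ?thesis by (simp add: gamma_def skew_lift)
qed

text \<open>The right-hand side contains \<open>A\<close> only through \<open>x = A J\<^sub>2\<close>: use
  \<open>J\<^sub>1 J\<^sub>1\<^sup>* = 1 - J\<^sub>2 J\<^sub>2\<^sup>*\<close> in \<open>v\<^sup>* A J\<^sub>1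
  J\<^sub>1\<^sup>* A\<^sup>* J\<^sub>2\<close>.\<close>

lemma denom_coord:
  assumes v: "v \<in> carrier_mat n k"
  shows "denom (coord_X v) = (adj v * J\<^sub>2 + - (adj v * (A * J\<^sub>2) * (adj (A * J\<^sub>2) * J\<^sub>2))) + adj (A * J\<^sub>2) * J\<^sub>2"
proof -
  have vd: "dim_row v = n" "dim_col v = k" using v by auto
  let ?N = "adj A * J\<^sub>2"
  have "J\<^sub>1 * (adj J\<^sub>1 * ?N) = (J\<^sub>1 * (adj J\<^sub>1 * ?N) + J\<^sub>2 * (adj J\<^sub>2 * ?N)) + - (J\<^sub>2 * (adj J\<^sub>2 * ?N))"
    by (intro eq_matI) (auto simp del: index_mult_mat(1))
  then have J: "J\<^sub>1 * (adj J\<^sub>1 * ?N) = ?N + - (J\<^sub>2 * (adj J\<^sub>2 * ?N))"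
    using block_decomp[of ?N k] by simp
  have "denom (coord_X v) = adj v * (A * (J\<^sub>1 * (adj J\<^sub>1 * ?N))) + adj J\<^sub>2 * ?N"
    unfolding denom_def coord_X_def using vd by (simp add: adj_mult mult_assoc_dim)
  also have "\<dots> = (adj v * J\<^sub>2 + - (adj v * (A * J\<^sub>2) * (adj (A * J\<^sub>2) * J\<^sub>2))) + adj (A * J\<^sub>2) * J\<^sub>2"
    unfolding J using vd by (simp add: adj_mult mult_assoc_dim mult_add_dim uminus_mult_dim)
  finally show ?thesis .
qed

lemma Gamma_set_eq:
  "Gamma_set n k A = {v \<in> tangent_stiefel n k (A * J\<^sub>2). invertible_mat (denom (coord_X v))}"
proof -
  have inv: "invertible_mat (adj J\<^sub>2 * (A * J\<^sub>1) * X + adj J\<^sub>2 * (A * J\<^sub>2)) \<longleftrightarrow> invertible_mat (denom X)"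
    if X: "X \<in> carrier_mat (n - k) k" for X
  proof -
    have "adj (denom X) = adj J\<^sub>2 * (A * J\<^sub>1) * X + adj J\<^sub>2 * (A * J\<^sub>2)"
      unfolding denom_def using X by (simp add: mat_ring)
    then show ?thesis using invertible_adj_iff[OF denom_carrier[OF X]] by simp
  qed
  have ex: "(\<exists>X\<in>carrier_mat (n - k) k. \<exists>Y\<in>carrier_mat k k. v = A * (X @\<^sub>r Y) \<and>
      invertible_mat (adj J\<^sub>2 * (A * J\<^sub>1) * X + adj J\<^sub>2 * (A * J\<^sub>2))) \<longleftrightarrow> invertible_mat (denom (coord_X v))"
    if v: "v \<in> carrier_mat n k" for v
  proof
    assume "\<exists>X\<in>carrier_mat (n - k) k. \<exists>Y\<in>carrier_mat k k. v = A * (X @\<^sub>r Y) \<and>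
      invertible_mat (adj J\<^sub>2 * (A * J\<^sub>1) * X + adj J\<^sub>2 * (A * J\<^sub>2))"
    then obtain X Y where XY: "X \<in> carrier_mat (n - k) k" "Y \<in> carrier_mat k k" "v = of_coord X Y"
      "invertible_mat (denom X)"
      using inv append_rows_eq unfolding of_coord_def by metis
    then show "invertible_mat (denom (coord_X v))" by (simp add: coord_of_coord)
  next
    assume i: "invertible_mat (denom (coord_X v))"
    have "v = A * (coord_X v @\<^sub>r coord_Y v)"
      using of_coord_coord[OF v] append_rows_eq[OF coord_carrier[OF v]] by (simp add: of_coord_def)
    with i inv[OF coord_carrier(1)[OF v]] coord_carrier[OF v]
    show "\<exists>X\<in>carrier_mat (n - k) k. \<exists>Y\<in>carrier_mat k k. v = A * (X @\<^sub>r Y) \<and>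
      invertible_mat (adj J\<^sub>2 * (A * J\<^sub>1) * X + adj J\<^sub>2 * (A * J\<^sub>2))" by blast
  qed
  have "v \<in> carrier_mat n k" if "v \<in> tangent_stiefel n k (A * J\<^sub>2)" for v
    using that by (simp add: tangent_iff)
  then show ?thesis
    unfolding Gamma_set_def split_block_eq[OF A_carrier] prod.case rho_eq[OF A_carrier]
    using ex by blast
qed

lemma Gamma_set_eq_preimage:
  "Gamma_set n k A = {v \<in> tangent_stiefel n k (A * J\<^sub>2). gamma v \<in> omega}"
  unfolding Gamma_set_eq gamma_def using transform_in_omega_iff coord_carrier tangent_iff by blast

lemma Omega_set_eq: "Omega_set n k (adj J\<^sub>2 * (A * J\<^sub>2)) = omega"
proof -
  have "(\<exists>\<tau>\<in>carrier_mat (n - k) k. \<exists>\<pi>\<in>carrier_mat k k. y = \<tau> @\<^sub>r \<pi> \<and> invertible_mat (\<pi> + adj (adj J\<^sub>2 * (A * J\<^sub>2))))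
      \<longleftrightarrow> invertible_mat (adj J\<^sub>2 * (y + adj A * J\<^sub>2))" if y: "y \<in> carrier_mat n k" for y
  proof -
    have eq: "adj J\<^sub>2 * (y + adj A * J\<^sub>2) = adj J\<^sub>2 * y + adj (adj J\<^sub>2 * (A * J\<^sub>2))"
      using y by (simp add: mat_ring)
    have c: "adj J\<^sub>1 * y \<in> carrier_mat (n - k) k" "adj J\<^sub>2 * y \<in> carrier_mat k k" using y by auto
    have iff: "y = \<tau> @\<^sub>r \<pi> \<longleftrightarrow> \<tau> = adj J\<^sub>1 * y \<and> \<pi> = adj J\<^sub>2 * y"
      if t: "\<tau> \<in> carrier_mat (n - k) k" "\<pi> \<in> carrier_mat k k" for \<tau> \<pi>
      using block_decomp[OF y] t by (auto simp: append_rows_eq[OF t] append_rows_eq[OF c] mult_add_dim)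
    show ?thesis unfolding eq
    proof
      assume "\<exists>\<tau>\<in>carrier_mat (n - k) k. \<exists>\<pi>\<in>carrier_mat k k. y = \<tau> @\<^sub>r \<pi> \<and> invertible_mat (\<pi> + adj (adj J\<^sub>2 * (A * J\<^sub>2)))"
      then obtain \<tau> \<pi> where "\<tau> \<in> carrier_mat (n - k) k" "\<pi> \<in> carrier_mat k k" "y = \<tau> @\<^sub>r \<pi>"
        and i: "invertible_mat (\<pi> + adj (adj J\<^sub>2 * (A * J\<^sub>2)))" by blast
      then have "\<pi> = adj J\<^sub>2 * y" using iff by blast
      with i show "invertible_mat (adj J\<^sub>2 * y + adj (adj J\<^sub>2 * (A * J\<^sub>2)))" by (simp only:)
    next
      assume "invertible_mat (adj J\<^sub>2 * y + adj (adj J\<^sub>2 * (A * J\<^sub>2)))"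
      with iff[OF c] c show "\<exists>\<tau>\<in>carrier_mat (n - k) k. \<exists>\<pi>\<in>carrier_mat k k. y = \<tau> @\<^sub>r \<pi> \<and> invertible_mat (\<pi> + adj (adj J\<^sub>2 * (A * J\<^sub>2)))"
        by (intro bexI[of _ "adj J\<^sub>1 * y"] bexI[of _ "adj J\<^sub>2 * y"] conjI) (simp_all only: simp_thms)
    qed
  qed
  then show ?thesis unfolding Omega_set_def omega_def stiefel_def by blast
qed

definition gamma_inv :: "'a mat \<Rightarrow> 'a mat" where
  "gamma_inv y = of_coord (inv_X y) (inv_Y y)"

lemma gamma_inv:
  assumes "y \<in> omega"
  shows "gamma_inv y \<in> Gamma_set n k A" "gamma (gamma_inv y) = y"
proof -
  note c = inv_X_carrier[OF assms] inv_Y_carrier[OF assms]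
  show "gamma (gamma_inv y) = y"
    unfolding gamma_def gamma_inv_def coord_of_coord[OF c] by (rule transform_inv[OF assms])
  then show "gamma_inv y \<in> Gamma_set n k A"
    using of_coord_tangent[OF c inv_Y_skew[OF assms]] assms
    by (simp add: Gamma_set_eq_preimage gamma_inv_def)
qed

lemma gamma_inv_gamma:
  assumes "v \<in> Gamma_set n k A"
  shows "gamma_inv (gamma v) = v"
proof -
  have v: "v \<in> carrier_mat n k" "adj (coord_Y v) = - coord_Y v" "gamma v \<in> omega"
    using assms by (auto simp: Gamma_set_eq_preimage tangent_iff)
  show ?thesis
    using inv_transform[OF coord_carrier[OF v(1)] v(2) v(3)[unfolded gamma_def]] of_coord_coord[OF v(1)]
    by (simp add: gamma_inv_def gamma_def)
qed

lemma bij_gamma: "bij_betw gamma (Gamma_set n k A) omega"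
  by (rule bij_betw_byWitness[where f' = gamma_inv])
    (use gamma_inv gamma_inv_gamma Gamma_set_eq_preimage in auto)

section \<open>Smoothness of the transform and of its inverse\<close>

lemma Ck_on_carrier_mat_continuous:
  fixes f :: "'a mat \<Rightarrow> 'a mat"
  shows "Ck_on m n k r c (carrier_mat n k) f \<Longrightarrow> continuous_map (mat_topology n k) (mat_topology r c) f"
  using Ck_on_imp_continuous[of m n k r c "carrier_mat n k" f]
    subtopology_topspace[of "mat_topology n k :: 'a mat topology"] by simp

context
  fixes U :: "'a mat set"
  assumes U: "openin (mat_topology n k) U"
begin

lemmas Ck_intros = Ck_on_mult[OF U] Ck_on_add[OF U] Ck_on_uminus[OF U] Ck_on_adj[OF U] Ck_on_id[OF U]
lemmas Ck_const = Ck_on_const[OF U]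

lemma Ck_J: "Ck_on m n k n (n - k) U (\<lambda>_. J\<^sub>1)" "Ck_on m n k n k U (\<lambda>_. J\<^sub>2)"
  "Ck_on m n k (n - k) n U (\<lambda>_. adj J\<^sub>1)" "Ck_on m n k k n U (\<lambda>_. adj J\<^sub>2)"
  "Ck_on m n k n n U (\<lambda>_. A)" "Ck_on m n k n n U (\<lambda>_. adj A)" "Ck_on m n k n n U (\<lambda>_. 1\<^sub>m n)"
  "Ck_on m n k n k U (\<lambda>_. adj A * J\<^sub>2)"
  by (rule Ck_const, simp add: A_carrier)+

lemma Ck_coord: "Ck_on m n k (n - k) k U coord_X" "Ck_on m n k k k U coord_Y"
  unfolding coord_X_def [abs_def] coord_Y_def [abs_def] by (rule Ck_J Ck_intros)+

lemma Ck_skew_lift: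
  assumes "Ck_on m n k (n - k) k U f" "Ck_on m n k k k U g"
  shows "Ck_on m n k n n U (\<lambda>v. skew_lift (f v) (g v))"
  unfolding skew_lift_def by (rule assms Ck_J Ck_intros)+

lemma Ck_one_skew_lift: "Ck_on m n k n n U (\<lambda>v. 1\<^sub>m n + skew_lift (coord_X v) (coord_Y v))"
  by (rule Ck_J Ck_coord Ck_skew_lift Ck_intros)+

lemma Ck_gamma:
  assumes "\<And>v. v \<in> U \<Longrightarrow> invertible_mat (1\<^sub>m n + skew_lift (coord_X v) (coord_Y v))"
  shows "Ck_on m n k n k U gamma"
  unfolding gamma_def [abs_def] transform_def half_sum_def
  by (rule Ck_J Ck_coord Ck_skew_lift Ck_on_mat_inv[OF U assms Ck_one_skew_lift] Ck_intros | assumption)+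

lemma Ck_bottom: "Ck_on m n k k k U (\<lambda>y. adj J\<^sub>2 * (y + adj A * J\<^sub>2))"
  by (rule Ck_J Ck_intros)+

lemma Ck_gamma_inv:
  assumes "\<And>y. y \<in> U \<Longrightarrow> invertible_mat (adj J\<^sub>2 * (y + adj A * J\<^sub>2))"
  shows "Ck_on m n k n k U gamma_inv"
proof -
  have i: "Ck_on m n k k k U (\<lambda>y. mat_inv (adj J\<^sub>2 * (y + adj A * J\<^sub>2)))"
    by (rule Ck_on_mat_inv[OF U assms Ck_bottom])
  have X: "Ck_on m n k (n - k) k U inv_X"
    unfolding inv_X_def [abs_def] by (rule i Ck_J Ck_intros)+
  have Y: "Ck_on m n k k k U inv_Y"
    unfolding inv_Y_def [abs_def] by (rule i X Ck_J Ck_intros)+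
  show ?thesis
    unfolding gamma_inv_def [abs_def] of_coord_def by (rule X Y Ck_J Ck_intros)+
qed

end

lemma open_carrier: "openin (mat_topology n k) (carrier_mat n k)"
  using openin_topspace[of "mat_topology n k"] by simp

text \<open>The transform is already smooth on the open set where \<open>1 + W\<close> is invertible, and this
  set contains the tangent space.\<close>

lemma smooth_gamma: "smooth_on_mat n k n k (tangent_stiefel n k (A * J\<^sub>2)) gamma"
  unfolding smooth_on_mat_def
proof
  fix v assume v: "v \<in> tangent_stiefel n k (A * J\<^sub>2)"
  let ?U = "{v \<in> carrier_mat n k. invertible_mat (1\<^sub>m n + skew_lift (coord_X v) (coord_Y v))}"
  have U: "openin (mat_topology n k) ?U"
    using openin_invertible_preimage[OF Ck_on_carrier_mat_continuous[OF Ck_one_skew_lift[OF open_carrier, of 0]]] by simp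
  have "v \<in> ?U" using v coord_carrier
    by (auto simp: tangent_iff intro!: skew_plus_one_invertible adj_skew_lift)
  with U Ck_gamma[OF U] show "\<exists>U F. openin (mat_topology n k) U \<and> v \<in> U \<and> (\<forall>m. Ck_on m n k n k U F) \<and>
      (\<forall>N\<in>U \<inter> tangent_stiefel n k (A * J\<^sub>2). F N = gamma N)" by blast
qed

lemma open_bottom: "openin (mat_topology n k) {y \<in> carrier_mat n k. invertible_mat (adj J\<^sub>2 * (y + adj A * J\<^sub>2))}"
  using openin_invertible_preimage[OF Ck_on_carrier_mat_continuous[OF Ck_bottom[OF open_carrier, of 0]]] by simp

lemma smooth_gamma_inv: "smooth_on_mat n k n k omega gamma_inv"
  unfolding smooth_on_mat_def
proof
  fix y assume "y \<in> omega"
  then have "y \<in> {y \<in> carrier_mat n k. invertible_mat (adj J\<^sub>2 * (y + adj A * J\<^sub>2))}"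
    using omega_facts by blast
  with open_bottom Ck_gamma_inv[OF open_bottom]
  show "\<exists>U F. openin (mat_topology n k) U \<and> y \<in> U \<and> (\<forall>m. Ck_on m n k n k U F) \<and>
      (\<forall>N\<in>U \<inter> omega. F N = gamma_inv N)" by blast
qed

lemma open_omega: "openin (subtopology (mat_topology n k) (stiefel n k)) omega"
proof -
  have "omega = {y \<in> carrier_mat n k. invertible_mat (adj J\<^sub>2 * (y + adj A * J\<^sub>2))} \<inter> stiefel n k"
    by (auto simp: omega_def stiefel_def)
  then show ?thesis using open_bottom by (auto simp: openin_subtopology)
qed

lemma open_Gamma: "openin (subtopology (mat_topology n k) (tangent_stiefel n k (A * J\<^sub>2))) (Gamma_set n k A)"
proof -
  let ?f = "\<lambda>v. denom (coord_X v)"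
  have "Ck_on 0 n k k k (carrier_mat n k) ?f"
    unfolding denom_def by (rule Ck_J[OF open_carrier] Ck_coord[OF open_carrier] Ck_intros[OF open_carrier])+
  from openin_invertible_preimage[OF Ck_on_carrier_mat_continuous[OF this]]
  have "openin (mat_topology n k) {v \<in> carrier_mat n k. invertible_mat (?f v)}" by simp
  moreover have "Gamma_set n k A = {v \<in> carrier_mat n k. invertible_mat (?f v)} \<inter> tangent_stiefel n k (A * J\<^sub>2)"
    by (auto simp: Gamma_set_eq tangent_iff)
  ultimately show ?thesis by (auto simp: openin_subtopology)
qed

lemma smooth_on_mat_restrict:
  assumes "smooth_on_mat r c r' c' S f" "S' \<subseteq> S" "\<And>M. M \<in> S' \<Longrightarrow> f M = g M"
  shows "smooth_on_mat r c r' c' S' g"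
  unfolding smooth_on_mat_def
proof
  fix M assume "M \<in> S'"
  then have "M \<in> S" using assms(2) by blast
  then obtain V F where V: "openin (mat_topology r c) V" "M \<in> V" "\<forall>m. Ck_on m r c r' c' V F"
    and F: "\<forall>N\<in>V \<inter> S. F N = f N"
    using assms(1) unfolding smooth_on_mat_def by blast
  have "F N = g N" if "N \<in> V \<inter> S'" for N
    using F that assms(2,3) by (metis IntD1 IntD2 IntI subsetD)
  with V show "\<exists>U F. openin (mat_topology r c) U \<and> M \<in> U \<and> (\<forall>m. Ck_on m r c r' c' U F) \<and>
      (\<forall>N\<in>U \<inter> S'. F N = g N)" by (intro exI[of _ V] exI[of _ F]) simp
qed

lemma diffeo_gamma: "diffeo_mat n k n k (Gamma_set n k A) omega gamma"
  unfolding diffeo_mat_def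
proof (intro conjI bij_gamma)
  show "smooth_on_mat n k n k (Gamma_set n k A) gamma"
    by (rule smooth_on_mat_restrict[OF smooth_gamma]) (auto simp: Gamma_set_eq)
  have "gamma_inv y = inv_into (Gamma_set n k A) gamma y" if "y \<in> omega" for y
    using inv_into_f_eq[OF bij_betw_imp_inj_on[OF bij_gamma] gamma_inv[OF that]] by simp
  then show "smooth_on_mat n k n k omega (inv_into (Gamma_set n k A) gamma)"
    by (rule smooth_on_mat_restrict[OF smooth_gamma_inv order_refl])
qed

end

section \<open>Maximality of the domain of injectivity\<close>

context frame_blocks
begin

text \<open>The two conditions are the blocks of \<open>W z = 0\<close>.\<close>

lemma skew_lift_annihilatesI:
  fixes X Y z :: "'a::conj_div_algebra mat"
  assumes "X \<in> carrier_mat (n - k) k" "Y \<in> carrier_mat k k" "z \<in> carrier_mat n k"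
    and "X * (adj J\<^sub>2 * z) = 0\<^sub>m (n - k) k" "adj X * (adj J\<^sub>1 * z) = Y * (adj J\<^sub>2 * z)"
  shows "skew_lift X Y * z = 0\<^sub>m n k"
proof (rule block_eqI)
  show "adj J\<^sub>1 * (skew_lift X Y * z) = adj J\<^sub>1 * 0\<^sub>m n k"
    unfolding skew_lift_mult_blocks[OF assms(1-3)] assms(4) by simp
  show "adj J\<^sub>2 * (skew_lift X Y * z) = adj J\<^sub>2 * 0\<^sub>m n k"
    unfolding skew_lift_mult_blocks[OF assms(1-3)] assms(5)
    using assms(1-3) by (intro eq_matI) (auto simp del: index_mult_mat(1))
qed (use assms in auto)

text \<open>Take \<open>X = 0\<close> and \<open>Y = q s q\<^sup>*\<close> with \<open>s\<close> imaginary and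
  \<open>q\<^sup>* w = 0\<close>, where \<open>w\<close> is the lower block of \<open>z\<close>.\<close>

lemma annihilating_skew_lift_imaginary:
  fixes z :: "'a::conj_div_algebra mat"
  assumes z: "z \<in> carrier_mat n k" and sing: "\<not> invertible_mat (adj J\<^sub>2 * z)"
    and dim: "DIM('a) \<noteq> 1"
  shows "\<exists>X Y. X \<in> carrier_mat (n - k) k \<and> Y \<in> carrier_mat k k \<and> adj Y = - Y \<and>
    \<not> (X = 0\<^sub>m (n - k) k \<and> Y = 0\<^sub>m k k) \<and> skew_lift X Y * z = 0\<^sub>m n k"
proof -
  let ?w = "adj J\<^sub>2 * z"
  have w: "?w \<in> carrier_mat k k" using z by simp
  then have "\<not> invertible_mat (adj ?w)" using sing invertible_adj_iff by blast
  then obtain q where q: "q \<in> carrier_mat k 1" "q \<noteq> 0\<^sub>m k 1" "adj ?w * q = 0\<^sub>m k 1"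
    using kernel_of_not_invertible[of "adj ?w" k] w by auto
  have qd: "dim_row q = k" "dim_col q = 1" using q by auto
  have qw: "adj q * ?w = 0\<^sub>m 1 k"
    using arg_cong[OF q(3), of adj] z qd by (simp add: adj_mult mult_assoc_dim)
  obtain s :: 'a where s: "s \<noteq> 0" "conjugate s = - s" using exists_imaginary[OF dim] by blast
  \<comment> \<open>The scalar \<open>s\<close> as a matrix, so that \<open>q s q\<^sup>*\<close> is a matrix product.\<close>
  define S where "S = Matrix.mat 1 1 (\<lambda>_. s)"
  have Sd: "dim_row S = 1" "dim_col S = 1" by (simp_all add: S_def)
  have S: "adj S = - S" using s by (intro eq_matI) (auto simp: S_def index_adj)
  define Y where "Y = q * (S * adj q)"
  have Y: "Y \<in> carrier_mat k k" using qd by (simp add: Y_def)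
  have "adj Y = - Y"
    unfolding Y_def using qd Sd by (simp add: adj_mult mult_assoc_dim S uminus_mult_dim)
  moreover have "Y \<noteq> 0\<^sub>m k k"
  proof
    assume 0: "Y = 0\<^sub>m k k"
    have "q * S * (adj q * q) = Y * q"
      using qd Sd by (simp add: Y_def mult_assoc_dim)
    then have "q * S * (adj q * q) = 0\<^sub>m k 1" using 0 qd by simp
    then have qS: "q * S = 0\<^sub>m k 1"
      by (rule mult_adj_self_cancel[OF q(1,2), rotated]) (use qd Sd in simp)
    have "q $$ (i, 0) = 0" if "i < k" for i
    proof -
      have "(q * S) $$ (i, 0) = q $$ (i, 0) * s"
        using that qd Sd by (subst index_mult_mat_sum) (auto simp: S_def)
      then show ?thesis using qS that s(1) by simp
    qed
    then have "q = 0\<^sub>m k 1" using qd by (intro eq_matI) auto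
    with q(2) show False ..
  qed
  moreover have "skew_lift (0\<^sub>m (n - k) k) Y * z = 0\<^sub>m n k"
  proof (rule skew_lift_annihilatesI)
    have "Y * ?w = q * (S * (adj q * ?w))"
      unfolding Y_def using qd Sd z by (simp add: mult_assoc_dim)
    then have "Y * ?w = 0\<^sub>m k k" unfolding qw using qd Sd by simp
    then show "adj (0\<^sub>m (n - k) k) * (adj J\<^sub>1 * z) = Y * ?w" using z by simp
  qed (use z Y in auto)
  ultimately show ?thesis using Y by (intro exI[of _ "0\<^sub>m (n - k) k"] exI[of _ Y]) auto
qed

text \<open>Let \<open>q\<^sup>* w = 0\<close> for the lower block \<open>w\<close> of \<open>z\<close>. The
  columns of \<open>z\<close> together with \<open>(0; q)\<close> are \<open>k + 1 < n\<close> vectors, so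
  some \<open>g = (a; - b) \<noteq> 0\<close> is orthogonal to all of them. Then \<open>X = a
  q\<^sup>*\<close> and \<open>Y = q b\<^sup>* - b q\<^sup>*\<close> annihilate \<open>z\<close>, as
  \<open>a\<^sup>* u = b\<^sup>* w\<close> for the upper block \<open>u\<close> of \<open>z\<close>.
  Orthogonality to \<open>(0; q)\<close> means \<open>b\<^sup>* q = 0\<close>, so that \<open>X q\<close> and
  \<open>Y q\<close> recover \<open>a\<close> and \<open>b\<close>, and the pair is nonzero.\<close>

lemma annihilating_skew_lift_codim2:
  fixes z :: "'a::conj_div_algebra mat"
  assumes z: "z \<in> carrier_mat n k" and sing: "\<not> invertible_mat (adj J\<^sub>2 * z)"
    and dim: "k + 2 \<le> n"
  shows "\<exists>X Y. X \<in> carrier_mat (n - k) k \<and> Y \<in> carrier_mat k k \<and> adj Y = - Y \<and>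
    \<not> (X = 0\<^sub>m (n - k) k \<and> Y = 0\<^sub>m k k) \<and> skew_lift X Y * z = 0\<^sub>m n k"
proof -
  let ?w = "adj J\<^sub>2 * z"
  have w: "?w \<in> carrier_mat k k" using z by simp
  then have "\<not> invertible_mat (adj ?w)" using sing invertible_adj_iff by blast
  then obtain q where q: "q \<in> carrier_mat k 1" "q \<noteq> 0\<^sub>m k 1" "adj ?w * q = 0\<^sub>m k 1"
    using kernel_of_not_invertible[of "adj ?w" k] w by auto
  have qd: "dim_row q = k" "dim_col q = 1" using q by auto
  have zd: "dim_row z = n" "dim_col z = k" using z by auto
  have qw: "adj q * ?w = 0\<^sub>m 1 k"
    using arg_cong[OF q(3), of adj] zd qd by (simp add: adj_mult mult_assoc_dim)
  \<comment> \<open>The \<open>k + 1\<close> orthogonality conditions, as the rows of one matrix.\<close>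
  obtain g where g: "g \<in> carrier_mat n 1" "g \<noteq> 0\<^sub>m n 1"
    and zg: "adj z * g = 0\<^sub>m k 1" and qg: "adj q * (adj J\<^sub>2 * g) = 0\<^sub>m 1 1"
  proof -
    let ?h = "adj q * adj J\<^sub>2"
    have c: "adj z \<in> carrier_mat k n" "?h \<in> carrier_mat 1 n" using zd qd by auto
    have "adj z @\<^sub>r ?h \<in> carrier_mat (k + 1) n" by (rule carrier_append_rows[OF c])
    then obtain g where g: "g \<in> carrier_mat n 1" "g \<noteq> 0\<^sub>m n 1" "(adj z @\<^sub>r ?h) * g = 0\<^sub>m (k + 1) 1"
      by (rule wide_matrix_kernel) (use dim in auto)
    have gd: "dim_row g = n" "dim_col g = 1" using g by auto
    have entry: "((adj z @\<^sub>r ?h) * g) $$ (i, 0) = (if i < k then (adj z * g) $$ (i, 0) else (?h * g) $$ (i - k, 0))"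
      if "i < k + 1" for i
      using that zd qd gd c carrier_append_rows[OF c]
      by (auto simp: index_mult_mat_sum append_rows_def simp del: index_mult_mat(1))
    have "adj z * g = 0\<^sub>m k 1"
    proof (rule eq_matI)
      fix i j assume "i < dim_row (0\<^sub>m k 1 :: 'a mat)" "j < dim_col (0\<^sub>m k 1 :: 'a mat)"
      then show "(adj z * g) $$ (i, j) = 0\<^sub>m k 1 $$ (i, j)" using entry[of i] unfolding g(3) by simp
    qed (use zd gd in auto)
    moreover have "?h * g = 0\<^sub>m 1 1"
    proof (rule eq_matI)
      fix i j assume "i < dim_row (0\<^sub>m 1 1 :: 'a mat)" "j < dim_col (0\<^sub>m 1 1 :: 'a mat)"
      then show "(?h * g) $$ (i, j) = 0\<^sub>m 1 1 $$ (i, j)" using entry[of k] unfolding g(3) by simp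
    qed (use qd gd in auto)
    ultimately show thesis using that[OF g(1,2)] qd gd by (simp add: mult_assoc_dim)
  qed
  define a b where "a = adj J\<^sub>1 * g" and "b = - (adj J\<^sub>2 * g)"
  define X Y where "X = a * adj q" and "Y = q * adj b + - (b * adj q)"
  have abd: "dim_row a = n - k" "dim_col a = 1" "dim_row b = k" "dim_col b = 1"
    using g by (auto simp: a_def b_def)
  have X: "X \<in> carrier_mat (n - k) k" and Y: "Y \<in> carrier_mat k k"
    using abd qd by (auto simp: X_def Y_def)
  have skew: "adj Y = - Y"
    unfolding Y_def using abd qd
    by (simp add: mat_ring) (intro eq_matI; auto simp del: index_mult_mat(1))
  have bq: "adj b * q = 0\<^sub>m 1 1"
  proof -
    have "adj q * b = 0\<^sub>m 1 1" using qg g qd by (simp add: b_def uminus_mult_dim)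
    from arg_cong[OF this, of adj] show ?thesis using abd qd by (simp add: adj_mult)
  qed
  have ab: "adj a * (adj J\<^sub>1 * z) = adj b * ?w"
  proof -
    have "adj a * (adj J\<^sub>1 * z) + - (adj b * ?w) = adj g * z"
      using inner_blocks[OF g(1) z] zd g(1) unfolding a_def b_def by (simp add: adj_uminus uminus_mult_dim)
    also have "\<dots> = 0\<^sub>m 1 k" using arg_cong[OF zg, of adj] zd g(1) by (simp add: adj_mult)
    finally show ?thesis by (rule mat_eq_of_add_uminus[rotated 2]) (use abd zd in auto)
  qed
  have "\<not> (X = 0\<^sub>m (n - k) k \<and> Y = 0\<^sub>m k k)"
  proof
    assume 0: "X = 0\<^sub>m (n - k) k \<and> Y = 0\<^sub>m k k"
    have "a * (adj q * q) = X * q" using abd qd by (simp add: X_def mult_assoc_dim)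
    then have "a * (adj q * q) = 0\<^sub>m (n - k) 1" using 0 qd by simp
    then have a: "a = 0\<^sub>m (n - k) 1"
      by (rule mult_adj_self_cancel[OF q(1,2), rotated]) (use abd in auto)
    have "Y * q = q * (adj b * q) + - (b * (adj q * q))"
      using abd qd by (simp add: Y_def mat_ring)
    also have "\<dots> = - (b * (adj q * q))" unfolding bq using abd qd by simp
    finally have "- (b * (adj q * q)) = 0\<^sub>m k 1" using 0 qd by simp
    from arg_cong[OF this, of uminus] have "b * (adj q * q) = 0\<^sub>m k 1" by simp
    then have b: "b = 0\<^sub>m k 1"
      by (rule mult_adj_self_cancel[OF q(1,2), rotated]) (use abd in auto)
    then have "adj J\<^sub>2 * g = 0\<^sub>m k 1"
      using mat_eq_of_add_uminus[of "0\<^sub>m k 1" k 1 "adj J\<^sub>2 * g"] g(1) by (simp add: b_def)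
    then have "g = 0\<^sub>m n 1" using block_decomp[OF g(1)] a by (simp add: a_def)
    with g(2) show False ..
  qed
  moreover have "skew_lift X Y * z = 0\<^sub>m n k"
  proof (rule skew_lift_annihilatesI[OF X Y z])
    have "X * ?w = a * (adj q * ?w)" using abd qd zd by (simp add: X_def mult_assoc_dim)
    then show "X * ?w = 0\<^sub>m (n - k) k" unfolding qw using abd by simp
    have "adj X * (adj J\<^sub>1 * z) = q * (adj a * (adj J\<^sub>1 * z))"
      using abd qd zd by (simp add: X_def mat_ring)
    moreover have "Y * ?w = q * (adj b * ?w) + - (b * (adj q * ?w))"
      using abd qd zd by (simp add: Y_def mat_ring)
    then have "Y * ?w = q * (adj b * ?w)"
      unfolding qw using abd qd zd by simp
    ultimately show "adj X * (adj J\<^sub>1 * z) = Y * ?w" unfolding ab by simp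
  qed
  ultimately show ?thesis using X Y skew by blast
qed

end

context frame_cayley
begin

text \<open>Without an upper block, \<open>w\<close> is the midpoint \<open>z\<close> itself, and \<open>e =
  (1 + W) z\<close> has trivial kernel.\<close>

lemma half_sum_bottom_invertible_square:
  assumes nk: "n = k" and W: "W \<in> carrier_mat n n" "adj W = - W"
  shows "invertible_mat (adj J\<^sub>2 * half_sum W)"
proof (rule invertible_of_inj)
  have z: "half_sum W \<in> carrier_mat n k" by (rule half_sum_carrier[OF W])
  have zd: "dim_row (half_sum W) = n" "dim_col (half_sum W) = k" using z by auto
  show "adj J\<^sub>2 * half_sum W \<in> carrier_mat k k" using zd by simp
  fix c assume c: "c \<in> carrier_mat k 1" "adj J\<^sub>2 * half_sum W * c = 0\<^sub>m k 1"
  have cd: "dim_row c = k" "dim_col c = 1" using c by auto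
  have "half_sum W * c = 0\<^sub>m n 1"
  proof (rule block_eqI)
    have "n - k = 0" using nk by simp
    then show "adj J\<^sub>1 * (half_sum W * c) = adj J\<^sub>1 * 0\<^sub>m n 1"
      using cd by (intro eq_matI) (auto simp del: index_mult_mat(1))
    show "adj J\<^sub>2 * (half_sum W * c) = adj J\<^sub>2 * 0\<^sub>m n 1" using c(2) zd cd by (simp add: mult_assoc_dim)
  qed (use zd cd in auto)
  then have "(half_sum W + W * half_sum W) * c = 0\<^sub>m n 1"
    using W zd cd by (simp add: add_mult_dim mult_assoc_dim)
  then have ec: "e * c = 0\<^sub>m n 1" unfolding half_sum_eq[OF W] .
  show "c = 0\<^sub>m k 1" by (rule left_inverse_cancel[OF _ e e_orth c(1) ec]) (simp add: e)
qed

end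

context unitary_frame
begin

lemma coord_line:
  assumes "v \<in> carrier_mat n k" "X \<in> carrier_mat (n - k) k" "Y \<in> carrier_mat k k"
  shows "coord_X (v + of_real t \<cdot>\<^sub>m of_coord X Y) = coord_X v + of_real t \<cdot>\<^sub>m X"
    and "coord_Y (v + of_real t \<cdot>\<^sub>m of_coord X Y) = coord_Y v + of_real t \<cdot>\<^sub>m Y"
proof -
  have H: "of_coord X Y \<in> carrier_mat n k" by (rule of_coord_carrier[OF assms(3)])
  have d: "dim_row (of_coord X Y) = n" "dim_col (of_coord X Y) = k" "dim_row v = n" "dim_col v = k"
    using H assms(1) by auto
  show "coord_X (v + of_real t \<cdot>\<^sub>m of_coord X Y) = coord_X v + of_real t \<cdot>\<^sub>m X"
    using coord_of_coord(1)[OF assms(2,3)] d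
    by (simp add: coord_X_def mult_add_dim of_real_smult_mult)
  show "coord_Y (v + of_real t \<cdot>\<^sub>m of_coord X Y) = coord_Y v + of_real t \<cdot>\<^sub>m Y"
    using coord_of_coord(2)[OF assms(2,3)] d
    by (simp add: coord_Y_def mult_add_dim of_real_smult_mult)
qed

text \<open>If \<open>W' z = 0\<close>, then \<open>z\<close> also solves \<open>z + (W + t W') z = e\<close>,
  so it is the midpoint all along the line.\<close>

lemma gamma_constant_along_annihilating_line:
  assumes v: "v \<in> tangent_stiefel n k (A * J\<^sub>2)"
    and X: "X \<in> carrier_mat (n - k) k" and Y: "Y \<in> carrier_mat k k" "adj Y = - Y"
    and ann: "skew_lift X Y * half_sum (skew_lift (coord_X v) (coord_Y v)) = 0\<^sub>m n k"
  shows "v + of_real t \<cdot>\<^sub>m of_coord X Y \<in> tangent_stiefel n k (A * J\<^sub>2)"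
    and "gamma (v + of_real t \<cdot>\<^sub>m of_coord X Y) = gamma v"
proof -
  let ?vt = "v + of_real t \<cdot>\<^sub>m of_coord X Y"
  let ?W = "skew_lift (coord_X v) (coord_Y v)" and ?Wt = "skew_lift (coord_X ?vt) (coord_Y ?vt)"
  have vc: "v \<in> carrier_mat n k" and skew: "adj (coord_Y v) = - coord_Y v"
    using v by (auto simp: tangent_iff)
  note c = coord_carrier[OF vc] and H = of_coord_carrier[OF Y(1), of X]
  note L = skew_lift_carrier adj_skew_lift[OF c skew]
  have tXY: "of_real t \<cdot>\<^sub>m X \<in> carrier_mat (n - k) k" "of_real t \<cdot>\<^sub>m Y \<in> carrier_mat k k" using X Y by auto
  have vt: "?vt \<in> carrier_mat n k" using vc H by auto
  have "adj (coord_Y ?vt) = - coord_Y v + of_real t \<cdot>\<^sub>m (- Y)"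
    unfolding coord_line[OF vc X Y(1)] using c Y skew by (simp add: adj_add adj_smult)
  also have "\<dots> = - coord_Y ?vt"
    unfolding coord_line[OF vc X Y(1)] using c Y by (intro eq_matI) auto
  finally have skewt: "adj (coord_Y ?vt) = - coord_Y ?vt" .
  with vt show tan: "?vt \<in> tangent_stiefel n k (A * J\<^sub>2)" by (simp add: tangent_iff)
  note Lt = skew_lift_carrier adj_skew_lift[OF coord_carrier[OF vt] skewt]
  let ?z = "half_sum ?W"
  have z: "?z \<in> carrier_mat n k" by (rule half_sum_carrier[OF L])
  have zd: "dim_row ?z = n" "dim_col ?z = k" using z by auto
  have tann: "skew_lift (of_real t \<cdot>\<^sub>m X) (of_real t \<cdot>\<^sub>m Y) * ?z = 0\<^sub>m n k"
  proof -
    have "skew_lift (of_real t \<cdot>\<^sub>m X) (of_real t \<cdot>\<^sub>m Y) = of_real t \<cdot>\<^sub>m skew_lift X Y"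
    proof -
      have "skew_lift (of_real t \<cdot>\<^sub>m X) (of_real t \<cdot>\<^sub>m Y) =
          of_real t \<cdot>\<^sub>m (J\<^sub>1 * (X * adj J\<^sub>2)) + (- (of_real t \<cdot>\<^sub>m (J\<^sub>2 * (adj X * adj J\<^sub>1))) + of_real t \<cdot>\<^sub>m (J\<^sub>2 * (Y * adj J\<^sub>2)))"
        unfolding skew_lift_def using X Y(1) by (simp add: adj_smult of_real_mult_smult of_real_smult_mult)
      also have "\<dots> = of_real t \<cdot>\<^sub>m skew_lift X Y"
        unfolding skew_lift_def using X Y(1) by (intro eq_matI) (auto simp: algebra_simps simp del: index_mult_mat(1))
      finally show ?thesis .
    qed
    then show ?thesis using zd ann by (simp add: of_real_mult_smult)
  qed
  have Wt: "?Wt = ?W + skew_lift (of_real t \<cdot>\<^sub>m X) (of_real t \<cdot>\<^sub>m Y)"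
    unfolding coord_line[OF vc X Y(1)] by (rule skew_lift_add[OF c tXY])
  have Wtz: "?Wt * ?z = ?W * ?z"
    unfolding Wt using zd tann by (simp add: add_mult_dim)
  have "?z = half_sum ?Wt * 1\<^sub>m k"
    by (rule half_sum_unique[OF Lt z]) (simp_all add: Wtz half_sum_eq[OF L])
  then have zt: "half_sum ?Wt = ?z" using half_sum_carrier[OF Lt] by simp
  show "gamma ?vt = gamma v"
    unfolding gamma_def transform_eq[OF L] transform_eq[OF Lt] zt Wtz ..
qed

text \<open>At a point outside \<open>\<Gamma>\<close> the midpoint has a singular lower block, so the
  transform is constant along a line through that point, and a piece of the line lies in
  \<open>U\<close>.\<close>

lemma injective_open_subset_Gamma:
  assumes dim: "\<not> (DIM('a) = 1 \<and> n = k + 1)"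
    and U: "openin (subtopology (mat_topology n k) (tangent_stiefel n k (A * J\<^sub>2))) U"
    and inj: "inj_on gamma U"
  shows "U \<subseteq> Gamma_set n k A"
proof
  fix v assume vU: "v \<in> U"
  obtain V where V: "openin (mat_topology n k) V" "U = V \<inter> tangent_stiefel n k (A * J\<^sub>2)"
    using U by (auto simp: openin_subtopology)
  have v: "v \<in> tangent_stiefel n k (A * J\<^sub>2)" "v \<in> V" using vU V by auto
  then have vc: "v \<in> carrier_mat n k" and skew: "adj (coord_Y v) = - coord_Y v"
    by (auto simp: tangent_iff)
  note c = coord_carrier[OF vc]
  note L = skew_lift_carrier adj_skew_lift[OF c skew]
  let ?z = "half_sum (skew_lift (coord_X v) (coord_Y v))"
  have z: "?z \<in> carrier_mat n k" by (rule half_sum_carrier[OF L])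
  show "v \<in> Gamma_set n k A"
  proof (rule ccontr)
    assume "v \<notin> Gamma_set n k A"
    then have sing: "\<not> invertible_mat (adj J\<^sub>2 * ?z)"
      using v(1) invertible_half_sum_bottom_iff[OF c skew] by (simp add: Gamma_set_eq)
    then have "n \<noteq> k" using half_sum_bottom_invertible_square[OF _ L] by blast
    then have "DIM('a) \<noteq> 1 \<or> k + 2 \<le> n" using dim kn by linarith
    then obtain X Y where X: "X \<in> carrier_mat (n - k) k" and Y: "Y \<in> carrier_mat k k" "adj Y = - Y"
      and nz: "\<not> (X = 0\<^sub>m (n - k) k \<and> Y = 0\<^sub>m k k)" and ann: "skew_lift X Y * ?z = 0\<^sub>m n k"
      using annihilating_skew_lift_imaginary[OF z sing] annihilating_skew_lift_codim2[OF z sing] by blast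
    note line = gamma_constant_along_annihilating_line[OF v(1) X Y ann]
    let ?H = "of_coord X Y"
    have H: "?H \<in> carrier_mat n k" by (rule of_coord_carrier[OF Y(1)])
    have "\<forall>\<^sub>F t::real in nhds 0. v + of_real t \<cdot>\<^sub>m ?H \<in> V"
      by (rule eventually_line[OF V(1) v(2) H])
    then have "\<forall>\<^sub>F t::real in at 0. v + of_real t \<cdot>\<^sub>m ?H \<in> V \<and> t \<noteq> 0"
      by (auto simp: eventually_at_filter elim: eventually_mono)
    then obtain t :: real where t: "v + of_real t \<cdot>\<^sub>m ?H \<in> V" "t \<noteq> 0"
      using eventually_happens'[OF at_neq_bot] by blast
    then have "v + of_real t \<cdot>\<^sub>m ?H = v"
      using inj line[of t] vU V(2) by (auto simp: inj_on_def)
    then have "coord_X v + of_real t \<cdot>\<^sub>m X = coord_X v" "coord_Y v + of_real t \<cdot>\<^sub>m Y = coord_Y v"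
      using coord_line[OF vc X Y(1), of t] by auto
    moreover have "N = 0\<^sub>m r s" if "M + of_real t \<cdot>\<^sub>m N = M" "M \<in> carrier_mat r s" "N \<in> carrier_mat r s" 
      for M N :: "'a mat" and r s
    proof (rule eq_matI)
      fix i j assume ij: "i < dim_row (0\<^sub>m r s :: 'a mat)" "j < dim_col (0\<^sub>m r s :: 'a mat)"
      then have "M $$ (i, j) + of_real t * N $$ (i, j) = M $$ (i, j)"
        using arg_cong[OF that(1), of "\<lambda>M. M $$ (i, j)"] that(2,3) by auto
      then show "N $$ (i, j) = 0\<^sub>m r s $$ (i, j)" using t(2) ij by simp
    qed (use that in auto)
    ultimately show False using nz c X Y(1) by blast
  qed
qed

end

section \<open>Cayley transforms of Stiefel manifolds\<close>

theorem theorem1: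
  fixes n k :: nat and \<alpha> \<beta> T P A x :: "'a::conj_div_algebra mat"
  assumes "k \<le> n"
    and "T \<in> carrier_mat (n - k) k" and "P \<in> carrier_mat k k"
    and "x = T @\<^sub>r P" and "x \<in> stiefel n k"
    and "\<alpha> \<in> carrier_mat (n - k) (n - k)" and "\<beta> \<in> carrier_mat k (n - k)"
    and "A = four_block_mat \<alpha> T \<beta> P" and "A \<in> unitary_grp n"
  shows "\<exists>\<gamma>.
    \<gamma> \<in> tangent_stiefel n k x \<rightarrow> stiefel n k \<and>
    (\<forall>Z\<in>horizontal_space n k A. \<gamma> (rho_diff n k A Z) = rho n k (cayley n A Z)) \<and>
    openin (subtopology (mat_topology n k) (tangent_stiefel n k x)) (Gamma_set n k A) \<and>
    inj_on \<gamma> (Gamma_set n k A) \<and>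
    (\<forall>A'\<in>unitary_grp n. rho n k A' = x \<longrightarrow> Gamma_set n k A' = Gamma_set n k A) \<and>
    (\<not> (DIM('a) = 1 \<and> n = k + 1) \<longrightarrow>
      (\<forall>U. openin (subtopology (mat_topology n k) (tangent_stiefel n k x)) U \<and> inj_on \<gamma> U \<longrightarrow>
        U \<subseteq> Gamma_set n k A)) \<and>
    openin (subtopology (mat_topology n k) (stiefel n k)) (Omega_set n k P) \<and>
    diffeo_mat n k n k (Gamma_set n k A) (Omega_set n k P) \<gamma>"
proof -
  interpret unitary_frame n k A
    by unfold_locales (use assms in auto)
  have x: "A * J\<^sub>2 = x"
  proof (rule eq_matI)
    fix i j assume "i < dim_row x" "j < dim_col x"
    then have ij: "i < n" "j < k" using assms(5) by (auto simp: stiefel_def)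
    then show "(A * J\<^sub>2) $$ (i, j) = x $$ (i, j)"
      using assms(1-3,6,7)
      by (subst index_incl_right(2)[OF A_carrier ij]) (auto simp: append_rows_def assms(4,8))
  qed (use assms(5) in \<open>auto simp: stiefel_def\<close>)
  have P: "adj J\<^sub>2 * (A * J\<^sub>2) = P"
    unfolding x assms(4) append_rows_eq[OF assms(2,3)] using assms(2,3) by (simp add: mult_add_dim)
  have indep: "Gamma_set n k A' = Gamma_set n k A" if A': "A' \<in> unitary_grp n" "rho n k A' = x" for A'
  proof -
    interpret A': unitary_frame n k A' by unfold_locales (use assms(1) A' in auto)
    have x': "A' * J\<^sub>2 = x" using A'(2) rho_eq[OF A'.A_carrier] by simp
    have "A'.denom (A'.coord_X v) = denom (coord_X v)" if "v \<in> carrier_mat n k" for v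
      unfolding denom_coord[OF that] A'.denom_coord[OF that] x x' ..
    then show ?thesis
      unfolding Gamma_set_eq A'.Gamma_set_eq x x' by (auto simp: tangent_stiefel_def)
  qed
  show ?thesis
  proof (intro exI[of _ gamma] conjI ballI impI allI; (elim conjE)?)
    show "gamma \<in> tangent_stiefel n k x \<rightarrow> stiefel n k"
      using gamma_stiefel unfolding x by blast
    show "inj_on gamma (Gamma_set n k A)" by (rule bij_betw_imp_inj_on[OF bij_gamma])
  qed (use gamma_horizontal open_Gamma injective_open_subset_Gamma open_omega diffeo_gamma indep
      in \<open>simp_all add: Omega_set_eq[unfolded P] x\<close>)
qed

end
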